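(* Let $\mathcal{A}$ be a semi-abelian category with enough projectives and $\mathcal{B}$ a Birkhoff subcategory of $\mathcal{A}$ with reflector $\mathsf{b}$. An object $A$ of $\mathcal{A}$ is $\mathsf{b}$-perfect if and only if it admits a universal $\mathsf{b}$-central extension. Moreover, this universal $\mathsf{b}$-central extension may be chosen in such a way that it occurs in a short exact sequence $$0\to \mathrm{H}_2(A,\mathsf{b})\to \mathrm{U}(A,\mathsf{b})\xrightarrow{\;u^{\mathsf{b}}_A\;} A\to 0.$$
   Context: A category is semi-abelian when it is pointed (terminal object $=$ initial object $=0$), Barr exact, Bourn protomodular (the regular Short Five Lemma holds: given a morphism between two regular epimorphisms inducing isomorphisms on kernels and on codomains, it induces an isomorphism on domains), and has binary coproducts. It has enough projectives when every object $A$ admits a projective presentation, i.e. a regular epimorphism $f\colon B\to A$ with $B$ (regular) projective. A short exact sequence $0\to K\xrightarrow{k} B\xrightarrow{f} A\to 0$ means $k=\ker f$ and $f=\mathrm{coker}\,k$. A Birkhoff subcategory $\mathcal{B}$ of $\mathcal{A}$ is a full and reflective subcategory closed under subobjects and regular quotients; its reflector is $\mathsf{b}\colon\mathcal{A}\to\mathcal{B}$, with unit $\eta\colon 1_{\mathcal{A}}\Rightarrow\mathsf{b}$. An extension is a regular epimorphism. An extension $f\colon B\to A$ is $\mathsf{b}$-trivial if the naturality square $\mathsf{b}(f)\circ\eta_B=\eta_A\circ f$ is a pullback, and $\mathsf{b}$-central if its pullback along some extension $g\colon C\to A$ is $\mathsf{b}$-trivial. An object $P$ is $\mathsf{b}$-perfect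 when $\mathsf{b}(P)=0$. A universal $\mathsf{b}$-central extension of $A$ is an initial object of $\mathsf{Centr}_{\mathsf{b}}(A)$, the full subcategory of $(\mathcal{A}\downarrow A)$ determined by the $\mathsf{b}$-central extensions of $A$. For an object $B$ of $\mathcal{A}$, $\mu_B\colon[B,B]_{\mathsf{b}}\to B$ denotes the kernel of $\eta_B$; this gives a functor $[-,-]_{\mathsf{b}}$, whose value on a morphism $g$ is written $[g,g]_{\mathsf{b}}$. For an extension $f\colon B\to A$ with kernel $K$ and kernel pair $(B\times_A B,f_0,f_1)$, $[K,B]_{\mathsf{b}}$ denotes the kernel of $[f_0,f_0]_{\mathsf{b}}\colon[B\times_A B,B\times_A B]_{\mathsf{b}}\to[B,B]_{\mathsf{b}}$, viewed as a normal subobject of $B$ through $\mu_B\circ[f_1,f_1]_{\mathsf{b}}\circ\ker[f_0,f_0]_{\mathsf{b}}$. For any projective presentation $f\colon B\to A$ with kernel $K$, put $$\mathrm{H}_2(A,\mathsf{b})=\frac{K\wedge[B,B]_{\mathsf{b}}}{[K,B]_{\mathsf{b}}},\qquad \mathrm{U}(A,\mathsf{b})=\frac{[B,B]_{\mathsf{b}}}{[K,B]_{\mathsf{b}}};$$ these are independent (up to isomorphism) of the chosen presentation. *)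

theory Defs
  imports Main
begin

record ('o, 'm) cat =
  Obj :: "'o set"
  Arr :: "'m set"
  Dom :: "'m \<Rightarrow> 'o"
  Cod :: "'m \<Rightarrow> 'o"
  Id :: "'o \<Rightarrow> 'm"
  Comp :: "'m \<Rightarrow> 'm \<Rightarrow> 'm"  (infixl "\<cdot>\<index>" 70)

definition Hom :: "('o, 'm) cat \<Rightarrow> 'o \<Rightarrow> 'o \<Rightarrow> 'm set" where
  "Hom C X Y = {f \<in> Arr C. Dom C f = X \<and> Cod C f = Y}"

text \<open>Composition is written in the usual order: \<open>g \<cdot> f\<close> is defined when \<open>Dom g = Cod f\<close>.
  Nothing is assumed about its value on non-composable pairs.\<close>

locale category =
  fixes C :: "('o, 'm) cat" (structure)
  assumes Dom_Obj: "f \<in> Arr C \<Longrightarrow> Dom C f \<in> Obj C"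
    and Cod_Obj: "f \<in> Arr C \<Longrightarrow> Cod C f \<in> Obj C"
    and Id_Hom: "X \<in> Obj C \<Longrightarrow> Id C X \<in> Hom C X X"
    and Comp_Hom: "\<lbrakk>f \<in> Hom C X Y; g \<in> Hom C Y Z\<rbrakk> \<Longrightarrow> g \<cdot> f \<in> Hom C X Z"
    and Id_left: "f \<in> Hom C X Y \<Longrightarrow> Id C Y \<cdot> f = f"
    and Id_right: "f \<in> Hom C X Y \<Longrightarrow> f \<cdot> Id C X = f"
    and Comp_assoc:
      "\<lbrakk>f \<in> Hom C W X; g \<in> Hom C X Y; h \<in> Hom C Y Z\<rbrakk> \<Longrightarrow> h \<cdot> (g \<cdot> f) = (h \<cdot> g) \<cdot> f"


section \<open>Limits, colimits and special morphisms\<close>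

definition is_terminal :: "('o, 'm) cat \<Rightarrow> 'o \<Rightarrow> bool" where
  "is_terminal C T \<longleftrightarrow> T \<in> Obj C \<and> (\<forall>X\<in>Obj C. \<exists>!t. t \<in> Hom C X T)"

definition is_initial :: "('o, 'm) cat \<Rightarrow> 'o \<Rightarrow> bool" where
  "is_initial C I \<longleftrightarrow> I \<in> Obj C \<and> (\<forall>X\<in>Obj C. \<exists>!t. t \<in> Hom C I X)"

definition is_zero_object :: "('o, 'm) cat \<Rightarrow> 'o \<Rightarrow> bool" where
  "is_zero_object C Z \<longleftrightarrow> is_terminal C Z \<and> is_initial C Z"

definition is_zero_arrow :: "('o, 'm) cat \<Rightarrow> 'm \<Rightarrow> bool" where
  "is_zero_arrow C f \<longleftrightarrow> f \<in> Arr C \<and>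
     (\<exists>Z s t. is_zero_object C Z \<and> s \<in> Hom C (Dom C f) Z \<and> t \<in> Hom C Z (Cod C f) \<and>
        f = t \<cdot>\<^bsub>C\<^esub> s)"

definition is_iso :: "('o, 'm) cat \<Rightarrow> 'm \<Rightarrow> bool" where
  "is_iso C f \<longleftrightarrow> f \<in> Arr C \<and>
     (\<exists>g \<in> Hom C (Cod C f) (Dom C f).
        g \<cdot>\<^bsub>C\<^esub> f = Id C (Dom C f) \<and> f \<cdot>\<^bsub>C\<^esub> g = Id C (Cod C f))"

definition is_mono :: "('o, 'm) cat \<Rightarrow> 'm \<Rightarrow> bool" where
  "is_mono C m \<longleftrightarrow> m \<in> Arr C \<and>
     (\<forall>X. \<forall>x \<in> Hom C X (Dom C m). \<forall>y \<in> Hom C X (Dom C m).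
        m \<cdot>\<^bsub>C\<^esub> x = m \<cdot>\<^bsub>C\<^esub> y \<longrightarrow> x = y)"

text \<open>The square \<open>f \<cdot> p = g \<cdot> q\<close> is a pullback; \<open>q\<close> is the pullback of \<open>f\<close> along \<open>g\<close>.\<close>

definition is_pullback :: "('o, 'm) cat \<Rightarrow> 'm \<Rightarrow> 'm \<Rightarrow> 'm \<Rightarrow> 'm \<Rightarrow> bool" where
  "is_pullback C f g p q \<longleftrightarrow>
     f \<in> Arr C \<and> g \<in> Arr C \<and> Cod C f = Cod C g \<and>
     p \<in> Hom C (Dom C p) (Dom C f) \<and> q \<in> Hom C (Dom C p) (Dom C g) \<and>
     f \<cdot>\<^bsub>C\<^esub> p = g \<cdot>\<^bsub>C\<^esub> q \<and>
     (\<forall>X. \<forall>x \<in> Hom C X (Dom C f). \<forall>y \<in> Hom C X (Dom C g).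
        f \<cdot>\<^bsub>C\<^esub> x = g \<cdot>\<^bsub>C\<^esub> y \<longrightarrow>
        (\<exists>!t. t \<in> Hom C X (Dom C p) \<and> p \<cdot>\<^bsub>C\<^esub> t = x \<and> q \<cdot>\<^bsub>C\<^esub> t = y))"

abbreviation is_kernel_pair :: "('o, 'm) cat \<Rightarrow> 'm \<Rightarrow> 'm \<Rightarrow> 'm \<Rightarrow> bool" where
  "is_kernel_pair C f f0 f1 \<equiv> is_pullback C f f f0 f1"

definition is_coproduct :: "('o, 'm) cat \<Rightarrow> 'o \<Rightarrow> 'o \<Rightarrow> 'm \<Rightarrow> 'm \<Rightarrow> bool" where
  "is_coproduct C X Y i j \<longleftrightarrow>
     i \<in> Hom C X (Cod C i) \<and> j \<in> Hom C Y (Cod C i) \<and>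
     (\<forall>Z. \<forall>x \<in> Hom C X Z. \<forall>y \<in> Hom C Y Z.
        \<exists>!t. t \<in> Hom C (Cod C i) Z \<and> t \<cdot>\<^bsub>C\<^esub> i = x \<and> t \<cdot>\<^bsub>C\<^esub> j = y)"

definition is_coequalizer :: "('o, 'm) cat \<Rightarrow> 'm \<Rightarrow> 'm \<Rightarrow> 'm \<Rightarrow> bool" where
  "is_coequalizer C r s e \<longleftrightarrow>
     r \<in> Arr C \<and> s \<in> Hom C (Dom C r) (Cod C r) \<and> e \<in> Hom C (Cod C r) (Cod C e) \<and>
     e \<cdot>\<^bsub>C\<^esub> r = e \<cdot>\<^bsub>C\<^esub> s \<and>
     (\<forall>Z. \<forall>x \<in> Hom C (Cod C r) Z. x \<cdot>\<^bsub>C\<^esub> r = x \<cdot>\<^bsub>C\<^esub> s \<longrightarrow>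
        (\<exists>!t. t \<in> Hom C (Cod C e) Z \<and> t \<cdot>\<^bsub>C\<^esub> e = x))"

definition regular_epi :: "('o, 'm) cat \<Rightarrow> 'm \<Rightarrow> bool" where
  "regular_epi C e \<longleftrightarrow> (\<exists>r s. is_coequalizer C r s e)"

definition is_kernel :: "('o, 'm) cat \<Rightarrow> 'm \<Rightarrow> 'm \<Rightarrow> bool" where
  "is_kernel C k f \<longleftrightarrow>
     f \<in> Arr C \<and> k \<in> Hom C (Dom C k) (Dom C f) \<and> is_zero_arrow C (f \<cdot>\<^bsub>C\<^esub> k) \<and>
     (\<forall>X. \<forall>x \<in> Hom C X (Dom C f). is_zero_arrow C (f \<cdot>\<^bsub>C\<^esub> x) \<longrightarrow>
        (\<exists>!t. t \<in> Hom C X (Dom C k) \<and> k \<cdot>\<^bsub>C\<^esub> t = x))"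

definition is_cokernel :: "('o, 'm) cat \<Rightarrow> 'm \<Rightarrow> 'm \<Rightarrow> bool" where
  "is_cokernel C q f \<longleftrightarrow>
     f \<in> Arr C \<and> q \<in> Hom C (Cod C f) (Cod C q) \<and> is_zero_arrow C (q \<cdot>\<^bsub>C\<^esub> f) \<and>
     (\<forall>Z. \<forall>x \<in> Hom C (Cod C f) Z. is_zero_arrow C (x \<cdot>\<^bsub>C\<^esub> f) \<longrightarrow>
        (\<exists>!t. t \<in> Hom C (Cod C q) Z \<and> t \<cdot>\<^bsub>C\<^esub> q = x))"

definition short_exact :: "('o, 'm) cat \<Rightarrow> 'm \<Rightarrow> 'm \<Rightarrow> bool" where
  "short_exact C k f \<longleftrightarrow> is_kernel C k f \<and> is_cokernel C f k"


section \<open>Semi-abelian categories\<close>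

definition equivalence_relation :: "('o, 'm) cat \<Rightarrow> 'o \<Rightarrow> 'm \<Rightarrow> 'm \<Rightarrow> bool" where
  "equivalence_relation C X r0 r1 \<longleftrightarrow>
     r0 \<in> Hom C (Dom C r0) X \<and> r1 \<in> Hom C (Dom C r0) X \<and>
     (\<forall>W. \<forall>x \<in> Hom C W (Dom C r0). \<forall>y \<in> Hom C W (Dom C r0).
        r0 \<cdot>\<^bsub>C\<^esub> x = r0 \<cdot>\<^bsub>C\<^esub> y \<and> r1 \<cdot>\<^bsub>C\<^esub> x = r1 \<cdot>\<^bsub>C\<^esub> y \<longrightarrow> x = y) \<and>
     (\<exists>d \<in> Hom C X (Dom C r0). r0 \<cdot>\<^bsub>C\<^esub> d = Id C X \<and> r1 \<cdot>\<^bsub>C\<^esub> d = Id C X) \<and>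
     (\<exists>s \<in> Hom C (Dom C r0) (Dom C r0). r0 \<cdot>\<^bsub>C\<^esub> s = r1 \<and> r1 \<cdot>\<^bsub>C\<^esub> s = r0) \<and>
     (\<forall>p q. is_pullback C r1 r0 p q \<longrightarrow>
        (\<exists>t \<in> Hom C (Dom C p) (Dom C r0).
           r0 \<cdot>\<^bsub>C\<^esub> t = r0 \<cdot>\<^bsub>C\<^esub> p \<and> r1 \<cdot>\<^bsub>C\<^esub> t = r1 \<cdot>\<^bsub>C\<^esub> q))"

text \<open>Finite completeness is expressed by a terminal object and pullbacks.\<close>

locale regular_category = category +
  assumes ex_terminal: "\<exists>T. is_terminal C T"
    and ex_pullback:
      "\<lbrakk>f \<in> Hom C X Z; g \<in> Hom C Y Z\<rbrakk> \<Longrightarrow> \<exists>p q. is_pullback C f g p q"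
    and ex_coequalizer_kernel_pair:
      "is_kernel_pair C f f0 f1 \<Longrightarrow> \<exists>e. is_coequalizer C f0 f1 e"
    and regular_epi_pullback_stable:
      "\<lbrakk>is_pullback C f g p q; regular_epi C f\<rbrakk> \<Longrightarrow> regular_epi C q"

locale barr_exact = regular_category +
  assumes effective:
    "equivalence_relation C X r0 r1 \<Longrightarrow> \<exists>f. is_kernel_pair C f r0 r1"

text \<open>Protomodularity is stated as the regular Short Five Lemma.\<close>

locale semi_abelian = barr_exact +
  assumes pointed: "\<exists>Z. is_zero_object C Z"
    and regular_short_five:
      "\<lbrakk>regular_epi C f; regular_epi C f'; is_kernel C k f; is_kernel C k' f';
        c \<in> Hom C (Dom C k) (Dom C k'); b \<in> Hom C (Dom C f) (Dom C f');
        a \<in> Hom C (Cod C f) (Cod C f');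
        k' \<cdot> c = b \<cdot> k; f' \<cdot> b = a \<cdot> f; is_iso C c; is_iso C a\<rbrakk> \<Longrightarrow> is_iso C b"
    and ex_coproduct:
      "\<lbrakk>X \<in> Obj C; Y \<in> Obj C\<rbrakk> \<Longrightarrow> \<exists>i j. is_coproduct C X Y i j"

definition is_projective :: "('o, 'm) cat \<Rightarrow> 'o \<Rightarrow> bool" where
  "is_projective C P \<longleftrightarrow> P \<in> Obj C \<and>
     (\<forall>e. regular_epi C e \<longrightarrow>
        (\<forall>g \<in> Hom C P (Cod C e). \<exists>h \<in> Hom C P (Dom C e). e \<cdot>\<^bsub>C\<^esub> h = g))"

definition projective_presentation :: "('o, 'm) cat \<Rightarrow> 'o \<Rightarrow> 'm \<Rightarrow> bool" where
  "projective_presentation C A f \<longleftrightarrow>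
     regular_epi C f \<and> Cod C f = A \<and> is_projective C (Dom C f)"

definition enough_projectives :: "('o, 'm) cat \<Rightarrow> bool" where
  "enough_projectives C \<longleftrightarrow> (\<forall>A \<in> Obj C. \<exists>f. projective_presentation C A f)"


section \<open>Birkhoff subcategories and central extensions\<close>

text \<open>A full subcategory is given by its set \<open>B\<close> of objects. The reflector is regarded as an
  endofunctor of the ambient category with values in \<open>B\<close>, the inclusion being left implicit.\<close>

record ('o, 'm) reflector =
  Robj :: "'o \<Rightarrow> 'o"
  Rarr :: "'m \<Rightarrow> 'm"
  Unit :: "'o \<Rightarrow> 'm"

locale reflective_subcategory = category C
  for C :: "('o, 'm) cat" (structure) +
  fixes B :: "'o set" and R :: "('o, 'm) reflector"
  assumes B_Obj: "B \<subseteq> Obj C"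
    and Robj_B: "X \<in> Obj C \<Longrightarrow> Robj R X \<in> B"
    and Rarr_Hom: "f \<in> Hom C X Y \<Longrightarrow> Rarr R f \<in> Hom C (Robj R X) (Robj R Y)"
    and Rarr_Id: "X \<in> Obj C \<Longrightarrow> Rarr R (Id C X) = Id C (Robj R X)"
    and Rarr_Comp:
      "\<lbrakk>f \<in> Hom C X Y; g \<in> Hom C Y Z\<rbrakk> \<Longrightarrow> Rarr R (g \<cdot> f) = Rarr R g \<cdot> Rarr R f"
    and Unit_Hom: "X \<in> Obj C \<Longrightarrow> Unit R X \<in> Hom C X (Robj R X)"
    and Unit_natural: "f \<in> Hom C X Y \<Longrightarrow> Rarr R f \<cdot> Unit R X = Unit R Y \<cdot> f"
    and Unit_universal:
      "\<lbrakk>X \<in> Obj C; Y \<in> B; f \<in> Hom C X Y\<rbrakk> \<Longrightarrow>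
        \<exists>!g. g \<in> Hom C (Robj R X) Y \<and> g \<cdot> Unit R X = f"

locale birkhoff_subcategory = reflective_subcategory +
  assumes closed_subobjects:
      "\<lbrakk>m \<in> Hom C X Y; is_mono C m; Y \<in> B\<rbrakk> \<Longrightarrow> X \<in> B"
    and closed_regular_quotients:
      "\<lbrakk>e \<in> Hom C X Y; regular_epi C e; X \<in> B\<rbrakk> \<Longrightarrow> Y \<in> B"

definition perfect :: "('o, 'm) cat \<Rightarrow> ('o, 'm) reflector \<Rightarrow> 'o \<Rightarrow> bool" where
  "perfect C R P \<longleftrightarrow> P \<in> Obj C \<and> is_zero_object C (Robj R P)"

definition trivial_extension :: "('o, 'm) cat \<Rightarrow> ('o, 'm) reflector \<Rightarrow> 'm \<Rightarrow> bool" where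
  "trivial_extension C R f \<longleftrightarrow> regular_epi C f \<and>
     is_pullback C (Rarr R f) (Unit R (Cod C f)) (Unit R (Dom C f)) f"

definition central_extension :: "('o, 'm) cat \<Rightarrow> ('o, 'm) reflector \<Rightarrow> 'm \<Rightarrow> bool" where
  "central_extension C R f \<longleftrightarrow> regular_epi C f \<and>
     (\<exists>g p q. regular_epi C g \<and> is_pullback C f g p q \<and> trivial_extension C R q)"

text \<open>The slice category over \<open>A\<close>: a morphism from \<open>f\<close> to \<open>g\<close> is a triple \<open>(f, h, g)\<close>
  with \<open>g \<cdot> h = f\<close>.\<close>

definition slice :: "('o, 'm) cat \<Rightarrow> 'o \<Rightarrow> ('m, 'm \<times> 'm \<times> 'm) cat" where
  "slice C A =
     \<lparr>Obj = {f \<in> Arr C. Cod C f = A},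
      Arr = {(f, h, g). f \<in> Arr C \<and> Cod C f = A \<and> g \<in> Arr C \<and> Cod C g = A \<and>
               h \<in> Hom C (Dom C f) (Dom C g) \<and> g \<cdot>\<^bsub>C\<^esub> h = f},
      Dom = (\<lambda>(f, h, g). f),
      Cod = (\<lambda>(f, h, g). g),
      Id = (\<lambda>f. (f, Id C (Dom C f), f)),
      Comp = (\<lambda>(g', h', k) (f, h, g). (f, h' \<cdot>\<^bsub>C\<^esub> h, k))\<rparr>"

definition full_subcategory :: "('o, 'm) cat \<Rightarrow> 'o set \<Rightarrow> ('o, 'm) cat" where
  "full_subcategory C S =
     C\<lparr>Obj := Obj C \<inter> S, Arr := {f \<in> Arr C. Dom C f \<in> S \<and> Cod C f \<in> S}\<rparr>"

definition Centr ::
  "('o, 'm) cat \<Rightarrow> ('o, 'm) reflector \<Rightarrow> 'o \<Rightarrow> ('m, 'm \<times> 'm \<times> 'm) cat" where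
  "Centr C R A = full_subcategory (slice C A) {f. central_extension C R f}"

definition universal_central_extension ::
  "('o, 'm) cat \<Rightarrow> ('o, 'm) reflector \<Rightarrow> 'o \<Rightarrow> 'm \<Rightarrow> bool" where
  "universal_central_extension C R A u \<longleftrightarrow> is_initial (Centr C R A) u"


section \<open>Commutators, the second homology object and the object U\<close>

text \<open>\<open>comm_incl C R X\<close> is the arrow \<open>\<mu>\<^sub>X\<close> from \<open>[X,X]\<close> to \<open>X\<close>, for a chosen kernel of the unit;
  \<open>comm_map C R g\<close> is the induced arrow \<open>[g,g]\<close>.\<close>

definition comm_incl :: "('o, 'm) cat \<Rightarrow> ('o, 'm) reflector \<Rightarrow> 'o \<Rightarrow> 'm" where
  "comm_incl C R X = (SOME m. is_kernel C m (Unit R X))"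

definition comm_obj :: "('o, 'm) cat \<Rightarrow> ('o, 'm) reflector \<Rightarrow> 'o \<Rightarrow> 'o" where
  "comm_obj C R X = Dom C (comm_incl C R X)"

definition comm_map :: "('o, 'm) cat \<Rightarrow> ('o, 'm) reflector \<Rightarrow> 'm \<Rightarrow> 'm" where
  "comm_map C R g =
     (THE h. h \<in> Hom C (comm_obj C R (Dom C g)) (comm_obj C R (Cod C g)) \<and>
        comm_incl C R (Cod C g) \<cdot>\<^bsub>C\<^esub> h = g \<cdot>\<^bsub>C\<^esub> comm_incl C R (Dom C g))"

text \<open>\<open>n\<close> represents the subobject \<open>[K,B]\<close> of \<open>B = Dom f\<close>, where \<open>K\<close> is the kernel of \<open>f\<close>.\<close>

definition relative_commutator ::
  "('o, 'm) cat \<Rightarrow> ('o, 'm) reflector \<Rightarrow> 'm \<Rightarrow> 'm \<Rightarrow> bool" where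
  "relative_commutator C R f n \<longleftrightarrow>
     (\<exists>f0 f1 k. is_kernel_pair C f f0 f1 \<and> is_kernel C k (comm_map C R f0) \<and>
        n = comm_incl C R (Dom C f) \<cdot>\<^bsub>C\<^esub> (comm_map C R f1 \<cdot>\<^bsub>C\<^esub> k))"

text \<open>\<open>w\<close> represents the meet of the subobjects \<open>m\<close> and \<open>n\<close>.\<close>

definition is_meet :: "('o, 'm) cat \<Rightarrow> 'm \<Rightarrow> 'm \<Rightarrow> 'm \<Rightarrow> bool" where
  "is_meet C m n w \<longleftrightarrow> is_mono C m \<and> is_mono C n \<and>
     (\<exists>p q. is_pullback C m n p q \<and> w = m \<cdot>\<^bsub>C\<^esub> p)"

text \<open>For subobjects \<open>n \<le> m\<close> of the same object, \<open>q\<close> is the projection of \<open>Dom m\<close> onto the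
  quotient of \<open>Dom m\<close> by \<open>Dom n\<close>.\<close>

definition subobject_quotient :: "('o, 'm) cat \<Rightarrow> 'm \<Rightarrow> 'm \<Rightarrow> 'm \<Rightarrow> bool" where
  "subobject_quotient C m n q \<longleftrightarrow> is_mono C m \<and> is_mono C n \<and>
     (\<exists>j \<in> Hom C (Dom C n) (Dom C m). m \<cdot>\<^bsub>C\<^esub> j = n \<and> is_cokernel C q j)"

text \<open>\<open>w\<close> represents the subobject \<open>K \<and> [B,B]\<close> of \<open>B = Dom f\<close>, and \<open>p\<close> is its projection onto
  the quotient by \<open>[K,B]\<close>; so \<open>Cod C p\<close> is the second homology object computed from \<open>f\<close>.\<close>

definition is_H2 :: "('o, 'm) cat \<Rightarrow> ('o, 'm) reflector \<Rightarrow> 'm \<Rightarrow> 'm \<Rightarrow> 'm \<Rightarrow> bool" where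
  "is_H2 C R f w p \<longleftrightarrow>
     (\<exists>k n. is_kernel C k f \<and> is_meet C k (comm_incl C R (Dom C f)) w \<and>
        relative_commutator C R f n \<and> subobject_quotient C w n p)"

text \<open>\<open>q\<close> is the projection of \<open>[B,B]\<close> onto its quotient by \<open>[K,B]\<close>.\<close>

definition is_U :: "('o, 'm) cat \<Rightarrow> ('o, 'm) reflector \<Rightarrow> 'm \<Rightarrow> 'm \<Rightarrow> bool" where
  "is_U C R f q \<longleftrightarrow>
     (\<exists>n. relative_commutator C R f n \<and>
        subobject_quotient C (comm_incl C R (Dom C f)) n q)"

text \<open>The arrows \<open>h\<close> from \<open>Cod p\<close> to \<open>Cod q\<close> and \<open>u\<close> from \<open>Cod q\<close> to \<open>Cod f\<close> are those induced
  by the inclusion of \<open>K \<and> [B,B]\<close> in \<open>[B,B]\<close> and by the restriction of \<open>f\<close> to \<open>[B,B]\<close>.\<close>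

definition induced_arrows ::
  "('o, 'm) cat \<Rightarrow> ('o, 'm) reflector \<Rightarrow> 'm \<Rightarrow> 'm \<Rightarrow> 'm \<Rightarrow> 'm \<Rightarrow> 'm \<Rightarrow> 'm \<Rightarrow> bool" where
  "induced_arrows C R f w p q h u \<longleftrightarrow>
     h \<in> Hom C (Cod C p) (Cod C q) \<and> u \<in> Hom C (Cod C q) (Cod C f) \<and>
     u \<cdot>\<^bsub>C\<^esub> q = f \<cdot>\<^bsub>C\<^esub> comm_incl C R (Dom C f) \<and>
     (\<exists>i \<in> Hom C (Dom C w) (comm_obj C R (Dom C f)).
        comm_incl C R (Dom C f) \<cdot>\<^bsub>C\<^esub> i = w \<and> h \<cdot>\<^bsub>C\<^esub> p = q \<cdot>\<^bsub>C\<^esub> i)"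

end

theory Submission
  imports Defs
begin

text \<open>
  All arguments are about generalized elements. An element of \<open>X\<close> at stage \<open>W\<close> is an arrow from \<open>W\<close>
  to \<open>X\<close>; regular epimorphisms act as covers, so that a regular epimorphism is a map whose
  elements lift locally, that is, after passing to a cover of the stage. In this language
  protomodularity is an induction principle (\<open>split_epi_generation\<close>): a property of the
  elements of \<open>V\<close> that defines a subobject holds for all of them once it holds on the kernel and on the
  section of some split epimorphism out of \<open>V\<close>. It gives in turn that arrows with zero kernel are
  monic, that regular epimorphisms are the cokernels of their kernels, the Mal'tsev property and,
  with exactness, that the image of a kernel along a regular epimorphism is a kernel
  (\<open>direct_image_of_kernel\<close>).

  Write \<open>x \<in> [X, X]\<close> if the unit of \<open>X\<close> kills \<open>x\<close>. Closure of the subcategory under quotients, by way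
  of direct images, shows that a regular epimorphism from \<open>X\<close> to \<open>Y\<close> maps \<open>[X, X]\<close> onto \<open>[Y, Y]\<close>
  (\<open>in_comm_lift\<close>). Therefore an extension \<open>g\<close> is central if and only if the two projections of its
  kernel pair agree on the commutator of the kernel pair (\<open>central_identifies_comm\<close>,
  \<open>identifies_comm_central\<close>).

  Let \<open>f: X \<rightarrow> A\<close> be a projective presentation with kernel \<open>K\<close>. The elements of \<open>[K, X]\<close> are the \<open>x\<close>
  for which \<open>(0, x)\<close> lies in the commutator of the kernel pair of \<open>f\<close>. By the criterion, every lift
  of \<open>f\<close> to a central extension of \<open>A\<close> kills \<open>[K, X]\<close>, and \<open>f\<close> itself becomes central after
  division by \<open>[K, X]\<close> (\<open>centralization\<close>). Hence the quotient of \<open>X\<close> by \<open>[K, X]\<close> maps to every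
  central extension of \<open>A\<close>, but in general not in a unique way. If \<open>A\<close> is perfect, its subobject
  \<open>U = [X, X] / [K, X]\<close> is still an extension of \<open>A\<close>, and \<open>U = [U, U]\<close>; since any two morphisms over
  \<open>A\<close> into a central extension agree on commutators, \<open>U\<close> is universal
  (\<open>universal_central_extension_of_presentation\<close>). Its kernel over \<open>A\<close> consists of the classes of
  elements of \<open>K \<and> [X, X]\<close>, which is the asserted exact sequence (\<open>H2_U_exact\<close>). Conversely, the
  projection of the product of \<open>A\<close> with its reflection is central, and a universal central
  extension would have two morphisms to it unless the reflection of \<open>A\<close> is zero.
\<close>

section \<open>Categories and pullbacks\<close>

context category
begin

lemma in_Hom: "f \<in> Hom C X Y \<longleftrightarrow> f \<in> Arr C \<and> Dom C f = X \<and> Cod C f = Y"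
  by (auto simp: Hom_def)

lemma comp_typing [simp]:
  assumes "f \<in> Arr C" "g \<in> Arr C" "Dom C g = Cod C f"
  shows "g \<cdot> f \<in> Arr C" "Dom C (g \<cdot> f) = Dom C f" "Cod C (g \<cdot> f) = Cod C g"
  using Comp_Hom[of f "Dom C f" "Cod C f" g "Cod C g"] assms by (auto simp: in_Hom)

lemma Id_typing [simp]:
  assumes "X \<in> Obj C"
  shows "Id C X \<in> Arr C" "Dom C (Id C X) = X" "Cod C (Id C X) = X"
  using Id_Hom[OF assms] by (auto simp: in_Hom)

lemma Id_comp [simp]: "\<lbrakk>f \<in> Arr C; Cod C f = Y\<rbrakk> \<Longrightarrow> Id C Y \<cdot> f = f"
  using Id_left[of f "Dom C f" Y] by (auto simp: in_Hom)

lemma comp_Id [simp]: "\<lbrakk>f \<in> Arr C; Dom C f = X\<rbrakk> \<Longrightarrow> f \<cdot> Id C X = f"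
  using Id_right[of f X "Cod C f"] by (auto simp: in_Hom)

lemma comp_assoc [simp]:
  "\<lbrakk>f \<in> Arr C; g \<in> Arr C; h \<in> Arr C; Dom C g = Cod C f; Dom C h = Cod C g\<rbrakk>
    \<Longrightarrow> (h \<cdot> g) \<cdot> f = h \<cdot> (g \<cdot> f)"
  using Comp_assoc[of f "Dom C f" "Cod C f" g "Cod C g" h "Cod C h"] by (auto simp: in_Hom)

text \<open>Composites are normalised to the right, so an equation between composites is only found
  by rewriting after it has been extended by a further factor.\<close>

lemma comp_reduce:
  "\<lbrakk>a \<cdot> b = c; a \<in> Arr C; b \<in> Arr C; Dom C a = Cod C b; x \<in> Arr C; Dom C b = Cod C x\<rbrakk>
    \<Longrightarrow> a \<cdot> (b \<cdot> x) = c \<cdot> x"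
  using comp_assoc[of x b a] by simp

lemma Hom_Obj: "f \<in> Hom C X Y \<Longrightarrow> X \<in> Obj C" "f \<in> Hom C X Y \<Longrightarrow> Y \<in> Obj C"
  using Dom_Obj Cod_Obj by (auto simp: in_Hom)

lemma arr_Hom: "f \<in> Arr C \<Longrightarrow> f \<in> Hom C (Dom C f) (Cod C f)"
  by (simp add: in_Hom)

lemma monoD:
  "\<lbrakk>is_mono C m; m \<in> Hom C P Q; x \<in> Hom C X P; y \<in> Hom C X P; m \<cdot> x = m \<cdot> y\<rbrakk> \<Longrightarrow> x = y"
  unfolding is_mono_def by (simp add: in_Hom)

lemma monoI:
  assumes "m \<in> Hom C P Q"
    and "\<And>X x y. \<lbrakk>x \<in> Hom C X P; y \<in> Hom C X P; m \<cdot> x = m \<cdot> y\<rbrakk> \<Longrightarrow> x = y"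
  shows "is_mono C m"
  using assms unfolding is_mono_def by (auto simp: in_Hom)

lemma mono_comp:
  assumes "is_mono C m" "is_mono C n" "m \<in> Hom C P Q" "n \<in> Hom C Q S"
  shows "is_mono C (n \<cdot> m)"
proof (rule monoI)
  show "n \<cdot> m \<in> Hom C P S" using assms by (simp add: in_Hom)
next
  fix X x y
  assume xy: "x \<in> Hom C X P" "y \<in> Hom C X P" and eq: "(n \<cdot> m) \<cdot> x = (n \<cdot> m) \<cdot> y"
  have "m \<cdot> x = m \<cdot> y"
    by (rule monoD[OF assms(2,4), of _ X]) (use eq xy assms in \<open>simp_all add: in_Hom\<close>)
  then show "x = y" using monoD[OF assms(1,3)] xy by blast
qed

lemma mono_cancel:
  assumes "is_mono C (n \<cdot> m)" "m \<in> Hom C P Q" "n \<in> Hom C Q S"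
  shows "is_mono C m"
proof (rule monoI[OF assms(2)])
  fix X x y
  assume xy: "x \<in> Hom C X P" "y \<in> Hom C X P" and eq: "m \<cdot> x = m \<cdot> y"
  have "(n \<cdot> m) \<cdot> x = (n \<cdot> m) \<cdot> y" using eq xy assms by (simp add: in_Hom)
  then show "x = y" using monoD[OF assms(1), of P S x X y] xy assms by (simp add: in_Hom)
qed

lemma isoI:
  assumes "f \<in> Hom C X Y" "g \<in> Hom C Y X" "g \<cdot> f = Id C X" "f \<cdot> g = Id C Y"
  shows "is_iso C f"
  using assms unfolding is_iso_def by (auto simp: in_Hom)

lemma isoE:
  assumes "is_iso C f" "f \<in> Hom C X Y"
  obtains g where "g \<in> Hom C Y X" "g \<cdot> f = Id C X" "f \<cdot> g = Id C Y"
  using assms unfolding is_iso_def by (auto simp: in_Hom)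

lemma iso_Id: "X \<in> Obj C \<Longrightarrow> is_iso C (Id C X)"
  by (rule isoI[of _ X X "Id C X"]) (simp_all add: in_Hom)

lemma pullback_typing:
  assumes "is_pullback C f g p q" "f \<in> Hom C X Z" "g \<in> Hom C Y Z"
  shows "p \<in> Hom C (Dom C p) X" "q \<in> Hom C (Dom C p) Y" "f \<cdot> p = g \<cdot> q"
  using assms unfolding is_pullback_def by (auto simp: in_Hom)

lemma pullback_lift:
  assumes "is_pullback C f g p q" "f \<in> Hom C X Z" "g \<in> Hom C Y Z"
    and "x \<in> Hom C W X" "y \<in> Hom C W Y" "f \<cdot> x = g \<cdot> y"
  obtains t where "t \<in> Hom C W (Dom C p)" "p \<cdot> t = x" "q \<cdot> t = y"
proof -
  have "x \<in> Hom C W (Dom C f)" "y \<in> Hom C W (Dom C g)" using assms(2-5) by (auto simp: in_Hom)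
  then have "\<exists>!t. t \<in> Hom C W (Dom C p) \<and> p \<cdot> t = x \<and> q \<cdot> t = y"
    using assms(1,6) unfolding is_pullback_def by blast
  then show ?thesis using that by blast
qed

lemma pullback_unique:
  assumes "is_pullback C f g p q"
    and "s \<in> Hom C W (Dom C p)" "t \<in> Hom C W (Dom C p)" "p \<cdot> s = p \<cdot> t" "q \<cdot> s = q \<cdot> t"
  shows "s = t"
proof -
  have ty: "p \<in> Arr C" "Cod C p = Dom C f" "q \<in> Arr C" "Dom C q = Dom C p" "Cod C q = Dom C g"
    "f \<in> Arr C" "g \<in> Arr C" "Cod C f = Cod C g" "f \<cdot> p = g \<cdot> q"
    using assms(1) unfolding is_pullback_def by (auto simp: in_Hom)
  have "f \<cdot> (p \<cdot> s) = g \<cdot> (q \<cdot> s)"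
    using comp_reduce[OF ty(9), of s] ty assms(2) by (simp add: in_Hom)
  moreover have "p \<cdot> s \<in> Hom C W (Dom C f)" "q \<cdot> s \<in> Hom C W (Dom C g)"
    using ty assms(2) by (auto simp: in_Hom)
  ultimately have "\<exists>!t. t \<in> Hom C W (Dom C p) \<and> p \<cdot> t = p \<cdot> s \<and> q \<cdot> t = q \<cdot> s"
    using assms(1) unfolding is_pullback_def by blast
  then show ?thesis using assms(2-5) by metis
qed

lemma pullback_mono:
  assumes pb: "is_pullback C m y p q" and m: "is_mono C m" "m \<in> Hom C M Z" and y: "y \<in> Hom C V Z"
  shows "is_mono C q"
proof -
  note ty = pullback_typing[OF pb m(2) y]
  show ?thesis
  proof (rule monoI[OF ty(2)])
    fix X s t
    assume st: "s \<in> Hom C X (Dom C p)" "t \<in> Hom C X (Dom C p)" and eq: "q \<cdot> s = q \<cdot> t"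
    have "m \<cdot> (p \<cdot> s) = m \<cdot> (p \<cdot> t)"
      using comp_reduce[OF ty(3), of s] comp_reduce[OF ty(3), of t] eq st ty m y
      by (simp add: in_Hom)
    then have "p \<cdot> s = p \<cdot> t"
      using monoD[OF m, of "p \<cdot> s" X "p \<cdot> t"] st ty by (simp add: in_Hom)
    then show "s = t" using pullback_unique[OF pb st] eq by blast
  qed
qed

end

section \<open>Regular categories: images and local existence\<close>

context category
begin

lemma regular_epi_arr: "regular_epi C e \<Longrightarrow> e \<in> Arr C"
  unfolding regular_epi_def is_coequalizer_def by (auto simp: in_Hom)

lemma regular_epi_epi:
  assumes "regular_epi C e" "e \<in> Hom C X Y" "s \<in> Hom C Y Z" "t \<in> Hom C Y Z" "s \<cdot> e = t \<cdot> e"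
  shows "s = t"
proof -
  obtain r r' where co: "is_coequalizer C r r' e" using assms(1) unfolding regular_epi_def by blast
  then have ty: "r \<in> Arr C" "r' \<in> Arr C" "Cod C r = X" "Cod C r' = X" "Dom C r' = Dom C r"
    "e \<cdot> r = e \<cdot> r'"
    using assms(2) unfolding is_coequalizer_def by (auto simp: in_Hom)
  have "s \<cdot> (e \<cdot> r) = s \<cdot> (e \<cdot> r')" by (simp add: ty)
  then have "(s \<cdot> e) \<cdot> r = (s \<cdot> e) \<cdot> r'" using ty assms by (simp add: in_Hom)
  moreover have "s \<cdot> e \<in> Hom C (Cod C r) Z" using ty assms by (simp add: in_Hom)
  ultimately have "\<exists>!t. t \<in> Hom C (Cod C e) Z \<and> t \<cdot> e = s \<cdot> e"
    using co unfolding is_coequalizer_def by blast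
  moreover have "Cod C e = Y" using assms(2) by (simp add: in_Hom)
  ultimately show ?thesis using assms(3-5) by metis
qed

text \<open>The pairs of generalized elements identified by \<open>e\<close> include the pair that \<open>e\<close> coequalizes.\<close>

lemma regular_epi_descend:
  assumes "regular_epi C e" "e \<in> Hom C X Y" "x \<in> Hom C X Z"
    and "\<And>W a b. \<lbrakk>a \<in> Hom C W X; b \<in> Hom C W X; e \<cdot> a = e \<cdot> b\<rbrakk> \<Longrightarrow> x \<cdot> a = x \<cdot> b"
  obtains t where "t \<in> Hom C Y Z" "t \<cdot> e = x"
proof -
  obtain r s where co: "is_coequalizer C r s e" using assms(1) unfolding regular_epi_def by blast
  then have ty: "r \<in> Hom C (Dom C r) X" "s \<in> Hom C (Dom C r) X" "e \<cdot> r = e \<cdot> s" "Cod C r = X"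
    using assms(2) unfolding is_coequalizer_def by (auto simp: in_Hom)
  have "x \<cdot> r = x \<cdot> s" using assms(4)[OF ty(1-3)] .
  then have "\<exists>!t. t \<in> Hom C (Cod C e) Z \<and> t \<cdot> e = x"
    using co assms(3) ty(4) unfolding is_coequalizer_def by blast
  then show ?thesis using that assms(2) by (auto simp: in_Hom)
qed

lemma regular_epi_strong:
  assumes e: "regular_epi C e" "e \<in> Hom C X Y" and m: "is_mono C m" "m \<in> Hom C P Q"
    and ab: "a \<in> Hom C X P" "b \<in> Hom C Y Q" "m \<cdot> a = b \<cdot> e"
  obtains t where "t \<in> Hom C Y P" "t \<cdot> e = a" "m \<cdot> t = b"
proof -
  obtain t where t: "t \<in> Hom C Y P" "t \<cdot> e = a"
  proof (rule regular_epi_descend[OF e ab(1)])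
    fix W u v assume uv: "u \<in> Hom C W X" "v \<in> Hom C W X" "e \<cdot> u = e \<cdot> v"
    have "m \<cdot> (a \<cdot> u) = m \<cdot> (a \<cdot> v)"
      using comp_reduce[OF ab(3), of u] comp_reduce[OF ab(3), of v] uv ab e m
      by (simp add: in_Hom)
    then show "a \<cdot> u = a \<cdot> v" using monoD[OF m, of "a \<cdot> u" W "a \<cdot> v"] uv ab by (simp add: in_Hom)
  qed blast
  have "m \<cdot> t = b"
    by (rule regular_epi_epi[OF e, of _ Q]) (use t ab e m in \<open>simp_all add: in_Hom\<close>)
  with t that show ?thesis by blast
qed

text \<open>Factorizations through a monomorphism can be found locally.\<close>

lemma mono_factor_descend:
  assumes c: "regular_epi C c" "c \<in> Hom C W X" and m: "is_mono C m" "m \<in> Hom C P Q"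
    and "x \<in> Hom C X Q" "h \<in> Hom C W P" "m \<cdot> h = x \<cdot> c"
  obtains t where "t \<in> Hom C X P" "m \<cdot> t = x"
  by (rule regular_epi_strong[OF c m assms(6,5,7)]) (rule that)

lemma split_epi_regular:
  assumes "e \<in> Hom C X Y" "s \<in> Hom C Y X" "e \<cdot> s = Id C Y"
  shows "regular_epi C e"
proof -
  have X: "X \<in> Obj C" and Y: "Y \<in> Obj C" using Hom_Obj assms(1) by auto
  have "is_coequalizer C (Id C X) (s \<cdot> e) e"
    unfolding is_coequalizer_def
  proof (intro conjI allI ballI impI)
    show "e \<cdot> Id C X = e \<cdot> (s \<cdot> e)"
      using comp_reduce[OF assms(3), of e] assms by (simp add: in_Hom)
  next
    fix Z x
    assume x: "x \<in> Hom C (Cod C (Id C X)) Z" and eq: "x \<cdot> Id C X = x \<cdot> (s \<cdot> e)"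
    show "\<exists>!t. t \<in> Hom C (Cod C e) Z \<and> t \<cdot> e = x"
    proof (rule ex1I[of _ "x \<cdot> s"])
      show "x \<cdot> s \<in> Hom C (Cod C e) Z \<and> (x \<cdot> s) \<cdot> e = x"
        using x eq assms X Y by (simp add: in_Hom)
    next
      fix t assume t: "t \<in> Hom C (Cod C e) Z \<and> t \<cdot> e = x"
      then have "x \<cdot> s = t \<cdot> (e \<cdot> s)" using assms by (auto simp: in_Hom)
      then show "t = x \<cdot> s" using assms t by (simp add: in_Hom)
    qed
  qed (use assms X Y in \<open>simp_all add: in_Hom\<close>)
  then show ?thesis unfolding regular_epi_def by blast
qed

lemma mono_split_epi_iso:
  assumes m: "is_mono C m" "m \<in> Hom C P Q" and t: "t \<in> Hom C Q P" "m \<cdot> t = Id C Q"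
  shows "is_iso C m"
proof (rule isoI[OF m(2) t(1) _ t(2)])
  show "t \<cdot> m = Id C P"
    by (rule monoD[OF m, of _ P])
      (use m t comp_reduce[OF t(2), of m] Hom_Obj[OF m(2)] in \<open>simp_all add: in_Hom\<close>)
qed

lemma iso_comp_regular_epi:
  assumes i: "is_iso C i" "i \<in> Hom C Y Z" and e: "regular_epi C e" "e \<in> Hom C X Y"
  shows "regular_epi C (i \<cdot> e)"
proof -
  obtain j where j: "j \<in> Hom C Z Y" "j \<cdot> i = Id C Y" "i \<cdot> j = Id C Z" using isoE[OF i] .
  obtain r s where co: "is_coequalizer C r s e" using e(1) unfolding regular_epi_def by blast
  then have ty: "r \<in> Arr C" "s \<in> Arr C" "Cod C r = X" "Cod C s = X" "Dom C s = Dom C r"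
    "e \<cdot> r = e \<cdot> s"
    using e(2) unfolding is_coequalizer_def by (auto simp: in_Hom)
  have "is_coequalizer C r s (i \<cdot> e)"
    unfolding is_coequalizer_def
  proof (intro conjI allI ballI impI)
    fix V x
    assume x: "x \<in> Hom C (Cod C r) V" "x \<cdot> r = x \<cdot> s"
    then obtain t where t: "t \<in> Hom C (Cod C e) V" "t \<cdot> e = x"
      using co unfolding is_coequalizer_def by metis
    show "\<exists>!t. t \<in> Hom C (Cod C (i \<cdot> e)) V \<and> t \<cdot> (i \<cdot> e) = x"
    proof (rule ex1I[of _ "t \<cdot> j"])
      show "t \<cdot> j \<in> Hom C (Cod C (i \<cdot> e)) V \<and> (t \<cdot> j) \<cdot> (i \<cdot> e) = x"
        using t i(2) e(2) j comp_reduce[OF j(2), of e] by (simp add: in_Hom)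
    next
      fix t' assume t': "t' \<in> Hom C (Cod C (i \<cdot> e)) V \<and> t' \<cdot> (i \<cdot> e) = x"
      have "t' \<cdot> i = t"
        by (rule regular_epi_epi[OF e, of _ V]) (use t t' i(2) e(2) in \<open>simp_all add: in_Hom\<close>)
      then have "t \<cdot> j = t' \<cdot> (i \<cdot> j)" using t' i(2) e(2) j by (auto simp: in_Hom)
      then show "t' = t \<cdot> j" using j i(2) e(2) t' by (simp add: in_Hom)
    qed
  qed (use ty e(2) i(2) in \<open>simp_all add: in_Hom\<close>)
  then show ?thesis unfolding regular_epi_def by blast
qed

text \<open>The statement that \<open>x\<close> lies in the image of \<open>g\<close>, in the internal language: a factorization
  through \<open>g\<close> exists after passing to a cover (a regular epimorphism onto) of the domain of \<open>x\<close>.\<close>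

definition locally_lifts where
  "locally_lifts g x \<longleftrightarrow>
     (\<exists>W c h. c \<in> Hom C W (Dom C x) \<and> regular_epi C c \<and> h \<in> Hom C W (Dom C g) \<and> g \<cdot> h = x \<cdot> c)"

end

context regular_category
begin

lemma pullback_exists:
  assumes "f \<in> Hom C X Z" "g \<in> Hom C Y Z"
  obtains P p q where "is_pullback C f g p q" "p \<in> Hom C P X" "q \<in> Hom C P Y" "f \<cdot> p = g \<cdot> q"
    "Dom C p = P"
proof -
  obtain p q where pb: "is_pullback C f g p q" using ex_pullback[OF assms] by blast
  show ?thesis using that[OF pb pullback_typing[OF pb assms]] by simp
qed

lemma cover_lift:
  assumes "regular_epi C e" "e \<in> Hom C B A" "y \<in> Hom C X A"
  obtains W c x where "c \<in> Hom C W X" "regular_epi C c" "x \<in> Hom C W B" "e \<cdot> x = y \<cdot> c"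
proof -
  obtain P p q where pb: "is_pullback C e y p q" "p \<in> Hom C P B" "q \<in> Hom C P X" "e \<cdot> p = y \<cdot> q"
    using pullback_exists[OF assms(2,3)] .
  show ?thesis using that[OF pb(3) regular_epi_pullback_stable[OF pb(1) assms(1)] pb(2,4)] .
qed

text \<open>The first factor is the coequalizer of the kernel pair. Two elements identified by the second
  factor lift, locally, to elements identified by \<open>f\<close>, hence by the first factor.\<close>

lemma image_factorization:
  assumes f: "f \<in> Hom C X Y"
  obtains I e m where "e \<in> Hom C X I" "regular_epi C e" "m \<in> Hom C I Y" "is_mono C m" "m \<cdot> e = f"
proof -
  obtain P f0 f1 where kp: "is_kernel_pair C f f0 f1" "f0 \<in> Hom C P X" "f1 \<in> Hom C P X"
    "f \<cdot> f0 = f \<cdot> f1" "Dom C f0 = P"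
    using pullback_exists[OF f f] .
  obtain e where co: "is_coequalizer C f0 f1 e" using ex_coequalizer_kernel_pair[OF kp(1)] by blast
  let ?I = "Cod C e"
  have re: "regular_epi C e" using co unfolding regular_epi_def by blast
  have e: "e \<in> Hom C X ?I" "e \<cdot> f0 = e \<cdot> f1"
    using co kp unfolding is_coequalizer_def by (auto simp: in_Hom)
  obtain m where m: "m \<in> Hom C ?I Y" "m \<cdot> e = f"
  proof -
    have "f \<in> Hom C (Cod C f0) Y" using f kp(2) by (simp add: in_Hom)
    then have "\<exists>!t. t \<in> Hom C (Cod C e) Y \<and> t \<cdot> e = f"
      using co kp(4) unfolding is_coequalizer_def by blast
    then show ?thesis using that by blast
  qed
  have "is_mono C m"
  proof (rule monoI[OF m(1)])
    fix W x y assume xy: "x \<in> Hom C W ?I" "y \<in> Hom C W ?I" "m \<cdot> x = m \<cdot> y"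
    obtain V c x' where c: "c \<in> Hom C V W" "regular_epi C c" "x' \<in> Hom C V X" "e \<cdot> x' = x \<cdot> c"
      using cover_lift[OF re e(1) xy(1)] .
    have yc: "y \<cdot> c \<in> Hom C V ?I" using xy c by (simp add: in_Hom)
    obtain V' c' y' where c': "c' \<in> Hom C V' V" "regular_epi C c'" "y' \<in> Hom C V' X"
      "e \<cdot> y' = (y \<cdot> c) \<cdot> c'"
      using cover_lift[OF re e(1) yc] .
    have "f \<cdot> (x' \<cdot> c') = f \<cdot> y'"
    proof -
      have "f \<cdot> (x' \<cdot> c') = m \<cdot> ((e \<cdot> x') \<cdot> c')"
        using m e(1) c(3) c'(1) comp_reduce[OF m(2), of "x' \<cdot> c'"] by (simp add: in_Hom)
      also have "\<dots> = (m \<cdot> x) \<cdot> (c \<cdot> c')"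
        unfolding c(4) using m(1) xy(1,2) c(1) c'(1) by (simp add: in_Hom)
      also have "\<dots> = m \<cdot> (e \<cdot> y')"
        unfolding xy(3) c'(4) using m(1) xy(1,2) c(1) c'(1) by (simp add: in_Hom)
      also have "\<dots> = f \<cdot> y'"
        using m e(1) c'(3) comp_reduce[OF m(2), of y'] by (simp add: in_Hom)
      finally show ?thesis .
    qed
    moreover have "x' \<cdot> c' \<in> Hom C V' X" using c c' by (simp add: in_Hom)
    ultimately obtain t where t: "t \<in> Hom C V' P" "f0 \<cdot> t = x' \<cdot> c'" "f1 \<cdot> t = y'"
      using pullback_lift[OF kp(1) f f _ c'(3)] kp(5) by blast
    have "e \<cdot> (x' \<cdot> c') = e \<cdot> y'"
      unfolding t(2,3)[symmetric] using comp_reduce[OF e(2), of t] t(1) e(1) kp by (simp add: in_Hom)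
    then have "(x \<cdot> c) \<cdot> c' = (y \<cdot> c) \<cdot> c'"
      using c'(4) comp_reduce[OF c(4), of c'] c c' e(1) by (simp add: in_Hom)
    then have "x \<cdot> c = y \<cdot> c"
      by (rule regular_epi_epi[OF c'(2,1), rotated 2]) (use c xy in \<open>simp_all add: in_Hom\<close>)
    then show "x = y" by (rule regular_epi_epi[OF c(2,1) xy(1,2)])
  qed
  then show ?thesis using that e(1) re m by blast
qed

lemma regular_epi_cancel:
  assumes "regular_epi C (g \<cdot> h)" "h \<in> Hom C X Y" "g \<in> Hom C Y Z"
  shows "regular_epi C g"
proof -
  have gh: "g \<cdot> h \<in> Hom C X Z" and Z: "Z \<in> Obj C"
    using assms Hom_Obj[OF assms(3)] by (auto simp: in_Hom)
  obtain I e m where f: "e \<in> Hom C Y I" "regular_epi C e" "m \<in> Hom C I Z" "is_mono C m" "m \<cdot> e = g"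
    using image_factorization[OF assms(3)] .
  obtain t where t: "t \<in> Hom C Z I" "m \<cdot> t = Id C Z"
  proof (rule mono_factor_descend[OF assms(1) gh f(4,3)])
    show "m \<cdot> (e \<cdot> h) = Id C Z \<cdot> (g \<cdot> h)"
      using comp_reduce[OF f(5), of h] f assms(2,3) by (simp add: in_Hom)
    show "e \<cdot> h \<in> Hom C X I" using f assms by (simp add: in_Hom)
    show "Id C Z \<in> Hom C Z Z" using Z by (simp add: in_Hom)
  qed blast
  show ?thesis
    using iso_comp_regular_epi[OF mono_split_epi_iso[OF f(4,3) t] f(3,2,1)] f(5) by simp
qed

lemma regular_epi_comp:
  assumes e: "regular_epi C e" "e \<in> Hom C X Y" and e': "regular_epi C e'" "e' \<in> Hom C Y Z"
  shows "regular_epi C (e' \<cdot> e)"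
proof -
  have ee: "e' \<cdot> e \<in> Hom C X Z" and Z: "Z \<in> Obj C"
    using e e' Hom_Obj[OF e'(2)] by (auto simp: in_Hom)
  obtain I d m where f: "d \<in> Hom C X I" "regular_epi C d" "m \<in> Hom C I Z" "is_mono C m"
    "m \<cdot> d = e' \<cdot> e"
    using image_factorization[OF ee] .
  obtain t where t: "t \<in> Hom C Y I" "m \<cdot> t = e'"
    using mono_factor_descend[OF e f(4,3) e'(2) f(1,5)] .
  obtain r where r: "r \<in> Hom C Z I" "m \<cdot> r = Id C Z"
    by (rule mono_factor_descend[OF e' f(4,3) _ t(1), of "Id C Z"])
      (use t e' Z in \<open>auto simp: in_Hom\<close>)
  show ?thesis
    using iso_comp_regular_epi[OF mono_split_epi_iso[OF f(4,3) r] f(3,2,1)] f(5) by simp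
qed

lemma locally_liftsI:
  "\<lbrakk>c \<in> Hom C W (Dom C x); regular_epi C c; h \<in> Hom C W (Dom C g); g \<cdot> h = x \<cdot> c\<rbrakk>
    \<Longrightarrow> locally_lifts g x"
  unfolding locally_lifts_def by blast

lemma locally_liftsE:
  assumes "locally_lifts g x" "g \<in> Hom C G Z" "x \<in> Hom C X Z"
  obtains W c h where "c \<in> Hom C W X" "regular_epi C c" "h \<in> Hom C W G" "g \<cdot> h = x \<cdot> c"
  using assms unfolding locally_lifts_def by (auto simp: in_Hom)

lemma regular_epi_Id: "X \<in> Obj C \<Longrightarrow> regular_epi C (Id C X)"
  by (rule split_epi_regular[of _ X X "Id C X"]) (simp_all add: in_Hom)

lemma factor_locally_lifts:
  assumes "t \<in> Hom C X (Dom C g)" "g \<cdot> t = x" "x \<in> Hom C X Z"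
  shows "locally_lifts g x"
  using assms Hom_Obj[OF assms(1)]
  by (intro locally_liftsI[of "Id C X" X _ t]) (auto simp: in_Hom regular_epi_Id)

lemma locally_lifts_precomp:
  assumes l: "locally_lifts g x" and ty: "g \<in> Hom C G Z" "x \<in> Hom C X Z" "y \<in> Hom C Y X"
  shows "locally_lifts g (x \<cdot> y)"
proof -
  obtain W c h where c: "c \<in> Hom C W X" "regular_epi C c" "h \<in> Hom C W G" "g \<cdot> h = x \<cdot> c"
    using locally_liftsE[OF l ty(1,2)] .
  obtain V d w where d: "d \<in> Hom C V Y" "regular_epi C d" "w \<in> Hom C V W" "c \<cdot> w = y \<cdot> d"
    using cover_lift[OF c(2,1) ty(3)] .
  show ?thesis
  proof (rule locally_liftsI[OF _ d(2), of V _ "h \<cdot> w"])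
    show "g \<cdot> (h \<cdot> w) = (x \<cdot> y) \<cdot> d"
      using comp_reduce[OF c(4), of w] c d ty by (simp add: in_Hom)
  qed (use c d ty in \<open>simp_all add: in_Hom\<close>)
qed

end

section \<open>Zero maps, kernels and products\<close>

context semi_abelian
begin

definition zmap where
  "zmap X Y = (THE z. z \<in> Hom C X Y \<and> is_zero_arrow C z)"

lemma zero_arrow_unique:
  assumes "is_zero_arrow C f" "is_zero_arrow C g" "f \<in> Hom C X Y" "g \<in> Hom C X Y"
  shows "f = g"
proof -
  obtain Z s t where Z: "is_zero_object C Z" "s \<in> Hom C X Z" "t \<in> Hom C Z Y" "f = t \<cdot> s"
    using assms(1,3) unfolding is_zero_arrow_def by (auto simp: in_Hom)
  obtain Z' s' t' where Z': "is_zero_object C Z'" "s' \<in> Hom C X Z'" "t' \<in> Hom C Z' Y" "g = t' \<cdot> s'"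
    using assms(2,4) unfolding is_zero_arrow_def by (auto simp: in_Hom)
  have ob: "X \<in> Obj C" "Y \<in> Obj C" "Z' \<in> Obj C" using Hom_Obj assms(3) Z'(2) by auto
  obtain i where i: "i \<in> Hom C Z Z'"
    using Z(1) ob(3) unfolding is_zero_object_def is_initial_def by metis
  have "i \<cdot> s \<in> Hom C X Z'" using i Z(2) by (simp add: in_Hom)
  then have a: "i \<cdot> s = s'"
    using Z'(1,2) ob(1) unfolding is_zero_object_def is_terminal_def by metis
  have "t' \<cdot> i \<in> Hom C Z Y" using i Z'(3) by (simp add: in_Hom)
  then have b: "t' \<cdot> i = t"
    using Z(1,3) ob(2) unfolding is_zero_object_def is_initial_def by metis
  show ?thesis
    unfolding Z(4) Z'(4) a[symmetric] b[symmetric] using Z(2,3) Z'(2,3) i by (simp add: in_Hom)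
qed

lemma zmap_zero_arrow:
  assumes "X \<in> Obj C" "Y \<in> Obj C"
  shows "zmap X Y \<in> Hom C X Y \<and> is_zero_arrow C (zmap X Y)"
proof -
  obtain Z where Z: "is_zero_object C Z" using pointed by blast
  obtain s where s: "s \<in> Hom C X Z"
    using Z assms(1) unfolding is_zero_object_def is_terminal_def by metis
  obtain t where t: "t \<in> Hom C Z Y"
    using Z assms(2) unfolding is_zero_object_def is_initial_def by metis
  have "t \<cdot> s \<in> Hom C X Y \<and> is_zero_arrow C (t \<cdot> s)"
    unfolding is_zero_arrow_def using Z s t by (auto simp: in_Hom)
  then show ?thesis unfolding zmap_def by (rule theI) (use zero_arrow_unique \<open>_ \<and> _\<close> in blast)
qed

lemma zmap_typing [simp]:
  assumes "X \<in> Obj C" "Y \<in> Obj C"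
  shows "zmap X Y \<in> Arr C" "Dom C (zmap X Y) = X" "Cod C (zmap X Y) = Y"
  using zmap_zero_arrow[OF assms] by (auto simp: in_Hom)

lemma zero_arrow_iff: "f \<in> Hom C X Y \<Longrightarrow> is_zero_arrow C f \<longleftrightarrow> f = zmap X Y"
  using zero_arrow_unique[of f "zmap X Y" X Y] zmap_zero_arrow[of X Y] Hom_Obj[of f X Y] by auto

lemma comp_zmap [simp]:
  assumes g: "g \<in> Arr C" "Dom C g = Y" and X: "X \<in> Obj C"
  shows "g \<cdot> zmap X Y = zmap X (Cod C g)"
proof -
  have Y: "Y \<in> Obj C" using g Dom_Obj by blast
  have "is_zero_arrow C (g \<cdot> f)" if f: "f \<in> Hom C X Y" "is_zero_arrow C f" for f
  proof -
    obtain Z s t where Z: "is_zero_object C Z" "s \<in> Hom C X Z" "t \<in> Hom C Z Y" "f = t \<cdot> s"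
      using f unfolding is_zero_arrow_def by (auto simp: in_Hom)
    have "g \<cdot> f = (g \<cdot> t) \<cdot> s" "g \<cdot> t \<in> Hom C Z (Cod C g)" unfolding Z(4)
      using Z(2,3) g by (simp_all add: in_Hom)
    then show ?thesis unfolding is_zero_arrow_def using Z(1,2) f(1) g by (auto simp: in_Hom)
  qed
  then have "is_zero_arrow C (g \<cdot> zmap X Y)" using zmap_zero_arrow[OF X Y] by blast
  moreover have "g \<cdot> zmap X Y \<in> Hom C X (Cod C g)" using g X Y by (simp add: in_Hom)
  ultimately show ?thesis using zero_arrow_iff by blast
qed

lemma zmap_comp [simp]:
  assumes f: "f \<in> Arr C" "Cod C f = Y" and Z: "Z \<in> Obj C"
  shows "zmap Y Z \<cdot> f = zmap (Dom C f) Z"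
proof -
  have Y: "Y \<in> Obj C" using f Cod_Obj by blast
  have "is_zero_arrow C (g \<cdot> f)" if g: "g \<in> Hom C Y Z" "is_zero_arrow C g" for g
  proof -
    obtain V s t where V: "is_zero_object C V" "s \<in> Hom C Y V" "t \<in> Hom C V Z" "g = t \<cdot> s"
      using g unfolding is_zero_arrow_def by (auto simp: in_Hom)
    have "g \<cdot> f = t \<cdot> (s \<cdot> f)" "s \<cdot> f \<in> Hom C (Dom C f) V" unfolding V(4)
      using V(2,3) f by (simp_all add: in_Hom)
    then show ?thesis unfolding is_zero_arrow_def using V(1,3) g(1) f by (auto simp: in_Hom)
  qed
  then have "is_zero_arrow C (zmap Y Z \<cdot> f)" using zmap_zero_arrow[OF Y Z] by blast
  moreover have "zmap Y Z \<cdot> f \<in> Hom C (Dom C f) Z" using f Y Z by (simp add: in_Hom)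
  ultimately show ?thesis using zero_arrow_iff by blast
qed

lemma zero_object_iff: "is_zero_object C Z \<longleftrightarrow> Z \<in> Obj C \<and> Id C Z = zmap Z Z"
proof
  assume Z: "is_zero_object C Z"
  then have ob: "Z \<in> Obj C" unfolding is_zero_object_def is_terminal_def by blast
  have "Id C Z \<in> Hom C Z Z" "zmap Z Z \<in> Hom C Z Z" using ob by (auto simp: in_Hom)
  then show "Z \<in> Obj C \<and> Id C Z = zmap Z Z"
    using Z ob unfolding is_zero_object_def is_terminal_def by metis
next
  assume Z: "Z \<in> Obj C \<and> Id C Z = zmap Z Z"
  have "is_terminal C Z"
    unfolding is_terminal_def
  proof (intro conjI ballI)
    fix X assume X: "X \<in> Obj C"
    have "t = zmap X Z" if "t \<in> Hom C X Z" for t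
    proof -
      have "t = Id C Z \<cdot> t" using that by (simp add: in_Hom)
      also have "\<dots> = zmap Z Z \<cdot> t" using Z by simp
      also have "\<dots> = zmap X Z" using that Z by (simp add: in_Hom)
      finally show ?thesis .
    qed
    then show "\<exists>!t. t \<in> Hom C X Z" using zmap_zero_arrow[of X Z] X Z by blast
  qed (use Z in blast)
  moreover have "is_initial C Z"
    unfolding is_initial_def
  proof (intro conjI ballI)
    fix X assume X: "X \<in> Obj C"
    have "t = zmap Z X" if "t \<in> Hom C Z X" for t
    proof -
      have "t = t \<cdot> Id C Z" using that by (simp add: in_Hom)
      also have "\<dots> = t \<cdot> zmap Z Z" using Z by simp
      also have "\<dots> = zmap Z X" using that Z by (simp add: in_Hom)
      finally show ?thesis .
    qed
    then show "\<exists>!t. t \<in> Hom C Z X" using zmap_zero_arrow[of Z X] X Z by blast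
  qed (use Z in blast)
  ultimately show "is_zero_object C Z" unfolding is_zero_object_def by blast
qed

lemma kernel_typing:
  assumes "is_kernel C k f" "f \<in> Hom C X Y"
  shows "k \<in> Hom C (Dom C k) X" "f \<cdot> k = zmap (Dom C k) Y"
proof -
  show k: "k \<in> Hom C (Dom C k) X" using assms unfolding is_kernel_def by (auto simp: in_Hom)
  have "f \<cdot> k \<in> Hom C (Dom C k) Y" using k assms(2) by (simp add: in_Hom)
  then show "f \<cdot> k = zmap (Dom C k) Y"
    using assms(1) zero_arrow_iff unfolding is_kernel_def by blast
qed

lemma kernel_factor:
  assumes "is_kernel C k f" "f \<in> Hom C X Y" "x \<in> Hom C W X" "f \<cdot> x = zmap W Y"
  shows "\<exists>!t. t \<in> Hom C W (Dom C k) \<and> k \<cdot> t = x"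
proof -
  have "f \<cdot> x \<in> Hom C W Y" using assms(2,3) by (simp add: in_Hom)
  then have "is_zero_arrow C (f \<cdot> x)" using assms(4) zero_arrow_iff by blast
  moreover have "x \<in> Hom C W (Dom C f)" using assms(2,3) by (simp add: in_Hom)
  ultimately show ?thesis using assms(1) unfolding is_kernel_def by blast
qed

lemma kernel_lift:
  assumes "is_kernel C k f" "f \<in> Hom C X Y" "x \<in> Hom C W X" "f \<cdot> x = zmap W Y"
  obtains t where "t \<in> Hom C W (Dom C k)" "k \<cdot> t = x"
  using kernel_factor[OF assms] by blast

lemma kernel_mono:
  assumes "is_kernel C k f" "f \<in> Hom C X Y"
  shows "is_mono C k"
proof (rule monoI)
  note ty = kernel_typing[OF assms]
  show "k \<in> Hom C (Dom C k) X" by (rule ty)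
  fix W s t assume st: "s \<in> Hom C W (Dom C k)" "t \<in> Hom C W (Dom C k)" "k \<cdot> s = k \<cdot> t"
  have "f \<cdot> (k \<cdot> s) = zmap W Y"
    using comp_reduce[OF ty(2), of s] st ty assms Hom_Obj[OF assms(2)] by (simp add: in_Hom)
  moreover have "k \<cdot> s \<in> Hom C W X" using st ty by (simp add: in_Hom)
  ultimately have "\<exists>!t. t \<in> Hom C W (Dom C k) \<and> k \<cdot> t = k \<cdot> s"
    using kernel_factor[OF assms] by blast
  then show "s = t" using st by metis
qed

lemma kernelI:
  assumes "k \<in> Hom C K X" "f \<in> Hom C X Y" "is_mono C k" "f \<cdot> k = zmap K Y"
    and "\<And>W x. \<lbrakk>x \<in> Hom C W X; f \<cdot> x = zmap W Y\<rbrakk> \<Longrightarrow> \<exists>t. t \<in> Hom C W K \<and> k \<cdot> t = x"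
  shows "is_kernel C k f"
  unfolding is_kernel_def
proof (intro conjI allI ballI impI)
  have "f \<cdot> k \<in> Hom C K Y" using assms(1,2) by (simp add: in_Hom)
  then show "is_zero_arrow C (f \<cdot> k)" using assms(4) zero_arrow_iff by blast
next
  fix W x assume x: "x \<in> Hom C W (Dom C f)" "is_zero_arrow C (f \<cdot> x)"
  have x': "x \<in> Hom C W X" "f \<cdot> x \<in> Hom C W Y" using x assms(2) by (auto simp: in_Hom)
  then obtain t where t: "t \<in> Hom C W K" "k \<cdot> t = x"
    using assms(5)[OF x'(1)] x(2) zero_arrow_iff[OF x'(2)] by blast
  show "\<exists>!t. t \<in> Hom C W (Dom C k) \<and> k \<cdot> t = x"
  proof (rule ex1I[of _ t])
    show "t \<in> Hom C W (Dom C k) \<and> k \<cdot> t = x" using t assms(1) by (simp add: in_Hom)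
    fix s assume "s \<in> Hom C W (Dom C k) \<and> k \<cdot> s = x"
    then show "s = t" using monoD[OF assms(3,1), of s W t] t assms(1) by (simp add: in_Hom)
  qed
qed (use assms in \<open>auto simp: in_Hom\<close>)

lemma kernel_exists:
  assumes "f \<in> Hom C X Y"
  obtains K k where "is_kernel C k f" "k \<in> Hom C K X" "f \<cdot> k = zmap K Y"
proof -
  obtain Z where Z: "is_zero_object C Z" using pointed by blast
  then have Zob: "Z \<in> Obj C" using zero_object_iff by blast
  note ob = Hom_Obj[OF assms]
  have z: "zmap Z Y \<in> Hom C Z Y" using Zob ob by (simp add: in_Hom)
  obtain K k q where pb: "is_pullback C f (zmap Z Y) k q" "k \<in> Hom C K X" "q \<in> Hom C K Z"
    "f \<cdot> k = zmap Z Y \<cdot> q" "Dom C k = K"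
    using pullback_exists[OF assms z] .
  have fk: "f \<cdot> k = zmap K Y" using pb(3,4) ob by (simp add: in_Hom)
  have to_Z: "s = t" if "s \<in> Hom C W Z" "t \<in> Hom C W Z" for s t W
    using Z that Hom_Obj[OF that(1)] unfolding is_zero_object_def is_terminal_def by metis
  have "is_kernel C k f"
  proof (rule kernelI[OF pb(2) assms _ fk])
    show "is_mono C k"
    proof (rule monoI[OF pb(2)])
      fix W s t assume st: "s \<in> Hom C W K" "t \<in> Hom C W K" "k \<cdot> s = k \<cdot> t"
      have "q \<cdot> s = q \<cdot> t" by (rule to_Z[of _ W]) (use st pb(3) in \<open>simp_all add: in_Hom\<close>)
      then show "s = t" using pullback_unique[OF pb(1)] st pb(5) by blast
    qed
  next
    fix W x assume x: "x \<in> Hom C W X" "f \<cdot> x = zmap W Y"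
    have W: "W \<in> Obj C" using Hom_Obj[OF x(1)] by blast
    have "zmap W Z \<in> Hom C W Z" "f \<cdot> x = zmap Z Y \<cdot> zmap W Z" using x W Zob ob by (simp_all add: in_Hom)
    then obtain t where "t \<in> Hom C W (Dom C k)" "k \<cdot> t = x"
      using pullback_lift[OF pb(1) assms z x(1)] by blast
    then show "\<exists>t. t \<in> Hom C W K \<and> k \<cdot> t = x" using pb(5) by blast
  qed
  then show ?thesis using that pb(2) fk by blast
qed

lemma product_exists:
  assumes "X \<in> Obj C" "Y \<in> Obj C"
  obtains P p q where "p \<in> Hom C P X" "q \<in> Hom C P Y"
    "\<And>W x y. \<lbrakk>x \<in> Hom C W X; y \<in> Hom C W Y\<rbrakk> \<Longrightarrow> \<exists>t. t \<in> Hom C W P \<and> p \<cdot> t = x \<and> q \<cdot> t = y"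
    "\<And>W s t. \<lbrakk>s \<in> Hom C W P; t \<in> Hom C W P; p \<cdot> s = p \<cdot> t; q \<cdot> s = q \<cdot> t\<rbrakk> \<Longrightarrow> s = t"
proof -
  have z: "zmap X X \<in> Hom C X X" "zmap Y X \<in> Hom C Y X" using assms by (simp_all add: in_Hom)
  obtain P p q where pb: "is_pullback C (zmap X X) (zmap Y X) p q" "p \<in> Hom C P X" "q \<in> Hom C P Y"
    "Dom C p = P"
    using pullback_exists[OF z] by metis
  show ?thesis
  proof (rule that[OF pb(2,3)])
    fix W x y assume xy: "x \<in> Hom C W X" "y \<in> Hom C W Y"
    have "zmap X X \<cdot> x = zmap Y X \<cdot> y" using xy assms by (simp add: in_Hom)
    then show "\<exists>t. t \<in> Hom C W P \<and> p \<cdot> t = x \<and> q \<cdot> t = y"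
      using pullback_lift[OF pb(1) z xy] pb(4) by metis
  next
    fix W s t assume "s \<in> Hom C W P" "t \<in> Hom C W P" "p \<cdot> s = p \<cdot> t" "q \<cdot> s = q \<cdot> t"
    then show "s = t" using pullback_unique[OF pb(1)] pb(4) by blast
  qed
qed

lemma kernel_pair_exists:
  assumes f: "f \<in> Hom C X Y"
  obtains P f0 f1 d where "is_kernel_pair C f f0 f1" "f0 \<in> Hom C P X" "f1 \<in> Hom C P X"
    "f \<cdot> f0 = f \<cdot> f1" "d \<in> Hom C X P" "f0 \<cdot> d = Id C X" "f1 \<cdot> d = Id C X" "Dom C f0 = P"
proof -
  obtain P f0 f1 where kp: "is_kernel_pair C f f0 f1" "f0 \<in> Hom C P X" "f1 \<in> Hom C P X"
    "f \<cdot> f0 = f \<cdot> f1" "Dom C f0 = P"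
    using pullback_exists[OF f f] .
  have "Id C X \<in> Hom C X X" using Hom_Obj[OF f] by (simp add: in_Hom)
  then obtain d where "d \<in> Hom C X P" "f0 \<cdot> d = Id C X" "f1 \<cdot> d = Id C X"
    using pullback_lift[OF kp(1) f f] kp(5) by metis
  then show ?thesis using that kp by blast
qed

section \<open>Protomodularity\<close>

text \<open>The form in which protomodularity is used: for a split epimorphism, the kernel and the section
  together generate the domain. A condition on the elements of \<open>V\<close> of the form ``\<open>y\<close> lands in the
  subobject \<open>m\<close>'' therefore holds everywhere once it holds on the kernel and on the section.
  The elements satisfying it form a subobject whose inclusion is an isomorphism on kernels and
  on codomains, so the Short Five Lemma applies.\<close>

lemma split_epi_generation:
  assumes p: "p \<in> Hom C V Y" and s: "s \<in> Hom C Y V" "p \<cdot> s = Id C Y"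
    and m: "is_mono C m" "m \<in> Hom C M Z" and y: "y \<in> Hom C V Z"
    and on_ker: "\<And>W z. \<lbrakk>z \<in> Hom C W V; p \<cdot> z = zmap W Y\<rbrakk> \<Longrightarrow> \<exists>t. t \<in> Hom C W M \<and> m \<cdot> t = y \<cdot> z"
    and on_sec: "\<exists>t. t \<in> Hom C Y M \<and> m \<cdot> t = y \<cdot> s"
  obtains t where "t \<in> Hom C V M" "m \<cdot> t = y"
proof -
  obtain P a b where pb: "is_pullback C m y a b" "a \<in> Hom C P M" "b \<in> Hom C P V" "m \<cdot> a = y \<cdot> b"
    "Dom C a = P"
    using pullback_exists[OF m(2) y] .
  have b: "is_mono C b" by (rule pullback_mono[OF pb(1) m y])
  obtain K k where k: "is_kernel C k p" "k \<in> Hom C K V" "p \<cdot> k = zmap K Y"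
    using kernel_exists[OF p] .
  obtain k' where k': "k' \<in> Hom C K P" "b \<cdot> k' = k"
    using on_ker[OF k(2,3)] pullback_lift[OF pb(1) m(2) y _ k(2)] pb(5) by metis
  obtain s' where s': "s' \<in> Hom C Y P" "b \<cdot> s' = s"
    using on_sec pullback_lift[OF pb(1) m(2) y _ s(1)] pb(5) by metis
  have ob: "K \<in> Obj C" "Y \<in> Obj C" using k(2) p Hom_Obj by auto
  have pb': "p \<cdot> b \<in> Hom C P Y" using p pb by (simp add: in_Hom)
  have "(p \<cdot> b) \<cdot> s' = Id C Y" using p pb s s' by (simp add: in_Hom)
  then have re: "regular_epi C (p \<cdot> b)" using split_epi_regular pb' s'(1) by blast
  have re': "regular_epi C p" using split_epi_regular p s by blast
  have ker: "is_kernel C k' (p \<cdot> b)"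
  proof (rule kernelI[OF k'(1) pb'])
    show "is_mono C k'" using mono_cancel[OF _ k'(1) pb(3)] kernel_mono[OF k(1) p] k'(2) by simp
    show "(p \<cdot> b) \<cdot> k' = zmap K Y" using p pb k' k by (simp add: in_Hom)
  next
    fix W x assume x: "x \<in> Hom C W P" "(p \<cdot> b) \<cdot> x = zmap W Y"
    have bx: "b \<cdot> x \<in> Hom C W V" "p \<cdot> (b \<cdot> x) = zmap W Y" using x pb p by (auto simp: in_Hom)
    obtain t where t: "t \<in> Hom C W K" "k \<cdot> t = b \<cdot> x"
      using kernel_lift[OF k(1) p bx] k(2) by (auto simp: in_Hom)
    have "k' \<cdot> t = x"
      by (rule monoD[OF b pb(3), of _ W])
        (use t k' x pb comp_reduce[OF k'(2), of t] in \<open>simp_all add: in_Hom\<close>)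
    with t(1) show "\<exists>t. t \<in> Hom C W K \<and> k' \<cdot> t = x" by blast
  qed
  have "is_iso C b"
    by (rule regular_short_five[OF re re' ker k(1), of "Id C K" b "Id C Y"])
      (use k k' pb p ob in \<open>simp_all add: in_Hom iso_Id\<close>)
  then obtain j where j: "j \<in> Hom C V P" "b \<cdot> j = Id C V" using isoE pb(3) by metis
  show ?thesis
  proof (rule that)
    show "a \<cdot> j \<in> Hom C V M" using j pb by (simp add: in_Hom)
    show "m \<cdot> (a \<cdot> j) = y" using comp_reduce[OF pb(4), of j] j pb m y by (simp add: in_Hom)
  qed
qed

lemma locally_lifts_image:
  assumes "e \<in> Hom C G I" "regular_epi C e" "m \<in> Hom C I Z" "is_mono C m" "m \<cdot> e = g"
    and x: "x \<in> Hom C X Z"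
  shows "locally_lifts g x \<longleftrightarrow> (\<exists>t. t \<in> Hom C X I \<and> m \<cdot> t = x)"
proof
  have g: "g \<in> Hom C G Z" using assms by (auto simp: in_Hom)
  assume "locally_lifts g x"
  then obtain W c h where c: "c \<in> Hom C W X" "regular_epi C c" "h \<in> Hom C W G" "g \<cdot> h = x \<cdot> c"
    by (rule locally_liftsE[OF _ g x])
  have eh: "e \<cdot> h \<in> Hom C W I" "m \<cdot> (e \<cdot> h) = x \<cdot> c"
    using assms c comp_reduce[OF assms(5), of h] by (simp_all add: in_Hom)
  obtain t where "t \<in> Hom C X I" "m \<cdot> t = x"
    using mono_factor_descend[OF c(2,1) assms(4,3) x eh] .
  then show "\<exists>t. t \<in> Hom C X I \<and> m \<cdot> t = x" by blast
next
  assume "\<exists>t. t \<in> Hom C X I \<and> m \<cdot> t = x"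
  then obtain t where t: "t \<in> Hom C X I" "m \<cdot> t = x" by blast
  obtain W c h where c: "c \<in> Hom C W X" "regular_epi C c" "h \<in> Hom C W G" "e \<cdot> h = t \<cdot> c"
    using cover_lift[OF assms(2,1) t(1)] .
  have g: "g \<in> Hom C G Z" using assms by (auto simp: in_Hom)
  show "locally_lifts g x"
  proof (rule locally_liftsI[OF _ c(2), of W _ h])
    show "g \<cdot> h = x \<cdot> c"
      using assms c t comp_reduce[OF assms(5), of h] comp_reduce[OF t(2), of c]
      by (simp add: in_Hom)
  qed (use c x g in \<open>simp_all add: in_Hom\<close>)
qed

text \<open>The same principle for conditions of the form ``\<open>y\<close> lands in the image of \<open>g\<close>''.\<close>

lemma split_epi_generation_local:
  assumes p: "p \<in> Hom C V Y" and s: "s \<in> Hom C Y V" "p \<cdot> s = Id C Y"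
    and g: "g \<in> Hom C G Z" and y: "y \<in> Hom C V Z"
    and on_ker: "\<And>W z. \<lbrakk>z \<in> Hom C W V; p \<cdot> z = zmap W Y\<rbrakk> \<Longrightarrow> locally_lifts g (y \<cdot> z)"
    and on_sec: "locally_lifts g (y \<cdot> s)"
  shows "locally_lifts g y"
proof -
  obtain I e m where f: "e \<in> Hom C G I" "regular_epi C e" "m \<in> Hom C I Z" "is_mono C m" "m \<cdot> e = g"
    using image_factorization[OF g] .
  obtain t where "t \<in> Hom C V I" "m \<cdot> t = y"
  proof (rule split_epi_generation[OF p s f(4,3) y])
    fix W z assume z: "z \<in> Hom C W V" "p \<cdot> z = zmap W Y"
    have "y \<cdot> z \<in> Hom C W Z" using z y by (simp add: in_Hom)
    then show "\<exists>t. t \<in> Hom C W I \<and> m \<cdot> t = y \<cdot> z"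
      using on_ker[OF z] locally_lifts_image[OF f] by blast
  next
    have "y \<cdot> s \<in> Hom C Y Z" using s y by (simp add: in_Hom)
    then show "\<exists>t. t \<in> Hom C Y I \<and> m \<cdot> t = y \<cdot> s"
      using on_sec locally_lifts_image[OF f] by blast
  qed blast
  then show ?thesis using locally_lifts_image[OF f y] by blast
qed

text \<open>Agreement of \<open>x\<close> and \<open>y\<close> is the condition that the pair \<open>(x, y)\<close> lands in the diagonal.\<close>

lemma split_epi_jointly_epic:
  assumes p: "p \<in> Hom C V Y" and s: "s \<in> Hom C Y V" "p \<cdot> s = Id C Y"
    and xy: "x \<in> Hom C V Z" "y \<in> Hom C V Z"
    and on_ker: "\<And>W z. \<lbrakk>z \<in> Hom C W V; p \<cdot> z = zmap W Y\<rbrakk> \<Longrightarrow> x \<cdot> z = y \<cdot> z"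
    and on_sec: "x \<cdot> s = y \<cdot> s"
  shows "x = y"
proof -
  have Z: "Z \<in> Obj C" using Hom_Obj[OF xy(1)] by blast
  obtain P a b where P: "a \<in> Hom C P Z" "b \<in> Hom C P Z"
    and pair: "\<And>W x y. \<lbrakk>x \<in> Hom C W Z; y \<in> Hom C W Z\<rbrakk> \<Longrightarrow> \<exists>t. t \<in> Hom C W P \<and> a \<cdot> t = x \<and> b \<cdot> t = y"
    and uniq: "\<And>W s t. \<lbrakk>s \<in> Hom C W P; t \<in> Hom C W P; a \<cdot> s = a \<cdot> t; b \<cdot> s = b \<cdot> t\<rbrakk> \<Longrightarrow> s = t"
    by (rule product_exists[OF Z Z]) blast
  have "Id C Z \<in> Hom C Z Z" using Z by (simp add: in_Hom)
  then obtain d where d: "d \<in> Hom C Z P" "a \<cdot> d = Id C Z" "b \<cdot> d = Id C Z" using pair by blast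
  have "is_mono C d"
  proof (rule mono_cancel[OF _ d(1) P(1)], unfold d(2), rule monoI[of _ Z Z])
    show "Id C Z \<in> Hom C Z Z" by fact
  qed (simp add: in_Hom)
  obtain w where w: "w \<in> Hom C V P" "a \<cdot> w = x" "b \<cdot> w = y" using pair[OF xy] by blast
  have red: "a \<cdot> (w \<cdot> v) = x \<cdot> v" "b \<cdot> (w \<cdot> v) = y \<cdot> v" "a \<cdot> (d \<cdot> u) = u" "b \<cdot> (d \<cdot> u) = u"
    if "v \<in> Hom C W V" "u \<in> Hom C W Z" for v u W
    using comp_reduce[OF w(2), of v] comp_reduce[OF w(3), of v] comp_reduce[OF d(2), of u]
      comp_reduce[OF d(3), of u] that w(1) d(1) P by (simp_all add: in_Hom)
  have eq: "\<exists>t. t \<in> Hom C W Z \<and> d \<cdot> t = w \<cdot> v" if v: "v \<in> Hom C W V" "x \<cdot> v = y \<cdot> v" for v W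
  proof (intro exI conjI)
    show xv: "x \<cdot> v \<in> Hom C W Z" using v xy by (simp add: in_Hom)
    show "d \<cdot> (x \<cdot> v) = w \<cdot> v"
      by (rule uniq[of _ W]) (use red[OF v(1) xv] v xv w(1) d(1) in \<open>simp_all add: in_Hom\<close>)
  qed
  obtain t where t: "t \<in> Hom C V Z" "d \<cdot> t = w"
    using split_epi_generation[OF p s \<open>is_mono C d\<close> d(1) w(1)] eq[OF s(1) on_sec] eq on_ker
    by metis
  have "a \<cdot> (d \<cdot> t) = t" "b \<cdot> (d \<cdot> t) = t"
    using comp_reduce[OF d(2), of t] comp_reduce[OF d(3), of t] t P d by (simp_all add: in_Hom)
  then show ?thesis using w(2,3) t(2) by simp
qed

text \<open>The two projections of the kernel pair agree on the diagonal, and both vanish on the kernel of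
  the first one.\<close>

lemma zero_kernel_mono:
  assumes f: "f \<in> Hom C X Y"
    and ker: "\<And>W z. \<lbrakk>z \<in> Hom C W X; f \<cdot> z = zmap W Y\<rbrakk> \<Longrightarrow> z = zmap W X"
  shows "is_mono C f"
proof (rule monoI[OF f])
  fix W x y assume xy: "x \<in> Hom C W X" "y \<in> Hom C W X" "f \<cdot> x = f \<cdot> y"
  obtain P f0 f1 d where kp: "is_kernel_pair C f f0 f1" "f0 \<in> Hom C P X" "f1 \<in> Hom C P X"
    "f \<cdot> f0 = f \<cdot> f1" "d \<in> Hom C X P" "f0 \<cdot> d = Id C X" "f1 \<cdot> d = Id C X" "Dom C f0 = P"
    using kernel_pair_exists[OF f] .
  have "f0 = f1"
  proof (rule split_epi_jointly_epic[OF kp(2,5,6,2,3)])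
    fix V z assume z: "z \<in> Hom C V P" "f0 \<cdot> z = zmap V X"
    have "f \<cdot> (f1 \<cdot> z) = zmap V Y"
      using comp_reduce[OF kp(4), of z] z kp(2,3) f Hom_Obj[OF z(1)] by (simp add: in_Hom)
    then show "f0 \<cdot> z = f1 \<cdot> z" using ker[of "f1 \<cdot> z" V] z kp(3) by (simp add: in_Hom)
  qed (use kp in simp)
  then show "x = y" using pullback_lift[OF kp(1) f f xy] by metis
qed

lemma zero_kernel_jointly_mono:
  assumes f: "f \<in> Hom C X Y" and g: "g \<in> Hom C X Z"
    and ker: "\<And>W z. \<lbrakk>z \<in> Hom C W X; f \<cdot> z = zmap W Y; g \<cdot> z = zmap W Z\<rbrakk> \<Longrightarrow> z = zmap W X"
    and xy: "x \<in> Hom C W X" "y \<in> Hom C W X" "f \<cdot> x = f \<cdot> y" "g \<cdot> x = g \<cdot> y"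
  shows "x = y"
proof -
  have ob: "Y \<in> Obj C" "Z \<in> Obj C" using f g Hom_Obj by auto
  obtain P a b where P: "a \<in> Hom C P Y" "b \<in> Hom C P Z"
    and pair: "\<And>W x y. \<lbrakk>x \<in> Hom C W Y; y \<in> Hom C W Z\<rbrakk> \<Longrightarrow> \<exists>t. t \<in> Hom C W P \<and> a \<cdot> t = x \<and> b \<cdot> t = y"
    and uniq: "\<And>W s t. \<lbrakk>s \<in> Hom C W P; t \<in> Hom C W P; a \<cdot> s = a \<cdot> t; b \<cdot> s = b \<cdot> t\<rbrakk> \<Longrightarrow> s = t"
    by (rule product_exists[OF ob]) blast
  obtain w where w: "w \<in> Hom C X P" "a \<cdot> w = f" "b \<cdot> w = g" using pair[OF f g] by blast
  have red: "a \<cdot> (w \<cdot> v) = f \<cdot> v" "b \<cdot> (w \<cdot> v) = g \<cdot> v" if "v \<in> Hom C V X" for v V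
    using comp_reduce[OF w(2), of v] comp_reduce[OF w(3), of v] that w(1) P by (simp_all add: in_Hom)
  have "is_mono C w"
  proof (rule zero_kernel_mono[OF w(1)])
    fix V z assume z: "z \<in> Hom C V X" "w \<cdot> z = zmap V P"
    then show "z = zmap V X"
      using red[OF z(1)] P Hom_Obj[OF z(1)] by (intro ker) (auto simp: in_Hom)
  qed
  moreover have "w \<cdot> x = w \<cdot> y"
    by (rule uniq[of _ W]) (use red[OF xy(1)] red[OF xy(2)] xy w(1) in \<open>simp_all add: in_Hom\<close>)
  ultimately show ?thesis using monoD w(1) xy(1,2) by blast
qed

text \<open>An arrow that vanishes on the kernel of \<open>f\<close> has equal composites with the two projections of
  the kernel pair: the projections agree on the diagonal, and both composites vanish on the kernel
  of the first projection.\<close>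

lemma regular_epi_factor:
  assumes f: "regular_epi C f" "f \<in> Hom C B A" and x: "x \<in> Hom C B Z"
    and ker: "\<And>W z. \<lbrakk>z \<in> Hom C W B; f \<cdot> z = zmap W A\<rbrakk> \<Longrightarrow> x \<cdot> z = zmap W Z"
  obtains t where "t \<in> Hom C A Z" "t \<cdot> f = x"
proof -
  obtain P f0 f1 d where kp: "is_kernel_pair C f f0 f1" "f0 \<in> Hom C P B" "f1 \<in> Hom C P B"
    "f \<cdot> f0 = f \<cdot> f1" "d \<in> Hom C B P" "f0 \<cdot> d = Id C B" "f1 \<cdot> d = Id C B" "Dom C f0 = P"
    using kernel_pair_exists[OF f(2)] .
  have ty: "x \<cdot> f0 \<in> Hom C P Z" "x \<cdot> f1 \<in> Hom C P Z" using x kp by (simp_all add: in_Hom)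
  have eq: "x \<cdot> f0 = x \<cdot> f1"
  proof (rule split_epi_jointly_epic[OF kp(2,5,6) ty])
    fix V z assume z: "z \<in> Hom C V P" "f0 \<cdot> z = zmap V B"
    have "f \<cdot> (f1 \<cdot> z) = zmap V A"
      using comp_reduce[OF kp(4), of z] z kp(2,3) f Hom_Obj[OF z(1)] by (simp add: in_Hom)
    then have "x \<cdot> (f1 \<cdot> z) = zmap V Z" using ker[of "f1 \<cdot> z" V] z kp(3) by (simp add: in_Hom)
    then show "(x \<cdot> f0) \<cdot> z = (x \<cdot> f1) \<cdot> z"
      using z kp(2,3) x Hom_Obj[OF z(1)] by (simp add: in_Hom)
  qed (use kp x in \<open>simp add: in_Hom\<close>)
  show ?thesis
  proof (rule regular_epi_descend[OF f x])
    fix W a b assume ab: "a \<in> Hom C W B" "b \<in> Hom C W B" "f \<cdot> a = f \<cdot> b"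
    obtain t where t: "t \<in> Hom C W P" "f0 \<cdot> t = a" "f1 \<cdot> t = b"
      using pullback_lift[OF kp(1) f(2) f(2) ab] kp(8) by metis
    then show "x \<cdot> a = x \<cdot> b"
      using comp_reduce[OF eq, of t] x kp by (auto simp: in_Hom)
  qed (rule that)
qed

lemma kernel_cokernel:
  assumes f: "regular_epi C f" "f \<in> Hom C B A" and k: "is_kernel C k f"
  shows "is_cokernel C f k"
  unfolding is_cokernel_def
proof (intro conjI allI ballI impI)
  note ty = kernel_typing[OF k f(2)]
  show "k \<in> Arr C" "f \<in> Hom C (Cod C k) (Cod C f)" using ty f by (auto simp: in_Hom)
  show "is_zero_arrow C (f \<cdot> k)" using k unfolding is_kernel_def by blast
  fix Z x assume x: "x \<in> Hom C (Cod C k) Z" "is_zero_arrow C (x \<cdot> k)"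
  have x': "x \<in> Hom C B Z" "x \<cdot> k \<in> Hom C (Dom C k) Z" using x ty by (auto simp: in_Hom)
  then have xk: "x \<cdot> k = zmap (Dom C k) Z" using x(2) zero_arrow_iff by blast
  obtain t where t: "t \<in> Hom C A Z" "t \<cdot> f = x"
  proof (rule regular_epi_factor[OF f x'(1)])
    fix W z assume z: "z \<in> Hom C W B" "f \<cdot> z = zmap W A"
    obtain u where u: "u \<in> Hom C W (Dom C k)" "k \<cdot> u = z" using kernel_lift[OF k f(2) z] .
    then show "x \<cdot> z = zmap W Z"
      using comp_reduce[OF xk, of u] x'(1) ty(1) Hom_Obj[OF x'(1)] by (auto simp: in_Hom)
  qed blast
  show "\<exists>!t. t \<in> Hom C (Cod C f) Z \<and> t \<cdot> f = x"
  proof (rule ex1I[of _ t])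
    show "t \<in> Hom C (Cod C f) Z \<and> t \<cdot> f = x" using t f by (simp add: in_Hom)
    fix s assume "s \<in> Hom C (Cod C f) Z \<and> s \<cdot> f = x"
    then show "s = t" using regular_epi_epi[OF f, of s Z t] t f by (simp add: in_Hom)
  qed
qed

lemma cokernel_regular_epi:
  assumes "is_cokernel C q j"
  shows "regular_epi C q"
proof -
  have ty: "j \<in> Hom C (Dom C j) (Cod C j)" "q \<in> Hom C (Cod C j) (Cod C q)"
    using assms unfolding is_cokernel_def by (auto simp: in_Hom)
  note ob = Hom_Obj[OF ty(1)] Hom_Obj[OF ty(2)]
  have qj: "q \<cdot> j \<in> Hom C (Dom C j) (Cod C q)" using ty by (simp add: in_Hom)
  have "is_coequalizer C j (zmap (Dom C j) (Cod C j)) q"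
    unfolding is_coequalizer_def
  proof (intro conjI allI ballI impI)
    show "q \<cdot> j = q \<cdot> zmap (Dom C j) (Cod C j)"
      using assms ty ob zero_arrow_iff[OF qj] unfolding is_cokernel_def by (simp add: in_Hom)
    fix Z x
    assume x: "x \<in> Hom C (Cod C j) Z" "x \<cdot> j = x \<cdot> zmap (Dom C j) (Cod C j)"
    have "x \<cdot> j \<in> Hom C (Dom C j) Z" using x(1) ty by (simp add: in_Hom)
    moreover have "x \<cdot> j = zmap (Dom C j) Z" using x ob ty by (simp add: in_Hom)
    ultimately have "is_zero_arrow C (x \<cdot> j)" using zero_arrow_iff by blast
    then show "\<exists>!t. t \<in> Hom C (Cod C q) Z \<and> t \<cdot> q = x"
      using assms x(1) unfolding is_cokernel_def by blast
  qed (use ty ob in \<open>auto simp: in_Hom\<close>)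
  then show ?thesis unfolding regular_epi_def by blast
qed

end

section \<open>Direct images of kernels\<close>

context semi_abelian
begin

text \<open>The Mal'tsev property of a reflexive relation. The triples \<open>(a, b, c)\<close> with \<open>a\<close> related to
  \<open>b\<close> and to \<open>c\<close> form a split epimorphism over the pairs \<open>(a, b)\<close>, the section being
  \<open>(a, b, b)\<close>; in the kernel \<open>a = b = 0\<close>. In both cases \<open>b\<close> is related to \<open>c\<close>.\<close>

lemma reflexive_relation_euclidean:
  assumes s: "s0 \<in> Hom C S X" "s1 \<in> Hom C S X"
    and jm: "\<And>W x y. \<lbrakk>x \<in> Hom C W S; y \<in> Hom C W S; s0 \<cdot> x = s0 \<cdot> y; s1 \<cdot> x = s1 \<cdot> y\<rbrakk> \<Longrightarrow> x = y"
    and d: "d \<in> Hom C X S" "s0 \<cdot> d = Id C X" "s1 \<cdot> d = Id C X"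
    and ab: "a \<in> Hom C W S" "b \<in> Hom C W S" "s0 \<cdot> a = s0 \<cdot> b"
  shows "\<exists>c. c \<in> Hom C W S \<and> s0 \<cdot> c = s1 \<cdot> a \<and> s1 \<cdot> c = s1 \<cdot> b"
proof -
  have X: "X \<in> Obj C" using Hom_Obj[OF d(1)] by blast
  obtain P u v i where kp: "is_kernel_pair C s0 u v" "u \<in> Hom C P S" "v \<in> Hom C P S"
    "s0 \<cdot> u = s0 \<cdot> v" "i \<in> Hom C S P" "u \<cdot> i = Id C S" "v \<cdot> i = Id C S" "Dom C u = P"
    using kernel_pair_exists[OF s(1)] .
  obtain Q p q where Q: "p \<in> Hom C Q X" "q \<in> Hom C Q X"
    and pair: "\<And>W x y. \<lbrakk>x \<in> Hom C W X; y \<in> Hom C W X\<rbrakk> \<Longrightarrow> \<exists>t. t \<in> Hom C W Q \<and> p \<cdot> t = x \<and> q \<cdot> t = y"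
    and uniq: "\<And>W s t. \<lbrakk>s \<in> Hom C W Q; t \<in> Hom C W Q; p \<cdot> s = p \<cdot> t; q \<cdot> s = q \<cdot> t\<rbrakk> \<Longrightarrow> s = t"
    by (rule product_exists[OF X X]) blast
  obtain m where m: "m \<in> Hom C S Q" "p \<cdot> m = s0" "q \<cdot> m = s1" using pair[OF s] by blast
  have "s1 \<cdot> u \<in> Hom C P X" "s1 \<cdot> v \<in> Hom C P X" using s kp by (simp_all add: in_Hom)
  then obtain y where y: "y \<in> Hom C P Q" "p \<cdot> y = s1 \<cdot> u" "q \<cdot> y = s1 \<cdot> v" using pair by blast
  have red: "p \<cdot> (m \<cdot> x) = s0 \<cdot> x" "q \<cdot> (m \<cdot> x) = s1 \<cdot> x" if "x \<in> Hom C V S" for x V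
    using comp_reduce[OF m(2), of x] comp_reduce[OF m(3), of x] that m(1) Q by (simp_all add: in_Hom)
  have red': "p \<cdot> (y \<cdot> x) = s1 \<cdot> (u \<cdot> x)" "q \<cdot> (y \<cdot> x) = s1 \<cdot> (v \<cdot> x)" if "x \<in> Hom C V P" for x V
    using comp_reduce[OF y(2), of x] comp_reduce[OF y(3), of x] that y(1) Q s kp
    by (simp_all add: in_Hom)
  have mono: "is_mono C m"
  proof (rule monoI[OF m(1)])
    fix V x x' assume "x \<in> Hom C V S" "x' \<in> Hom C V S" "m \<cdot> x = m \<cdot> x'"
    then show "x = x'" using jm[of x V x'] red[of x V] red[of x' V] by simp
  qed
  obtain t where t: "t \<in> Hom C P S" "m \<cdot> t = y"
  proof (rule split_epi_generation[OF kp(2,5,6) mono m(1) y(1)])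
    fix V z assume z: "z \<in> Hom C V P" "u \<cdot> z = zmap V S"
    have vz: "v \<cdot> z \<in> Hom C V S" using z kp by (simp add: in_Hom)
    have 0: "s0 \<cdot> (v \<cdot> z) = zmap V X" "s1 \<cdot> (u \<cdot> z) = zmap V X"
      using comp_reduce[OF kp(4), of z] z kp s Hom_Obj[OF z(1)] by (simp_all add: in_Hom)
    have "m \<cdot> (v \<cdot> z) = y \<cdot> z"
      by (rule uniq[of _ V])
        (use red[OF vz] red'[OF z(1)] 0 vz z(1) m(1) y(1) in \<open>simp_all add: in_Hom\<close>)
    with vz show "\<exists>t. t \<in> Hom C V S \<and> m \<cdot> t = y \<cdot> z" by blast
  next
    have ds: "d \<cdot> s1 \<in> Hom C S S" using d s by (simp add: in_Hom)
    have 0: "s0 \<cdot> (d \<cdot> s1) = s1" "s1 \<cdot> (d \<cdot> s1) = s1"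
      using comp_reduce[OF d(2), of s1] comp_reduce[OF d(3), of s1] d s by (simp_all add: in_Hom)
    have "m \<cdot> (d \<cdot> s1) = y \<cdot> i"
      by (rule uniq[of _ S])
        (use red[OF ds] red'[OF kp(5)] 0 ds kp m(1) y(1) s in \<open>simp_all add: in_Hom\<close>)
    with ds show "\<exists>t. t \<in> Hom C S S \<and> m \<cdot> t = y \<cdot> i" by blast
  qed blast
  obtain w where w: "w \<in> Hom C W P" "u \<cdot> w = a" "v \<cdot> w = b"
    using pullback_lift[OF kp(1) s(1) s(1) ab] kp(8) by metis
  have tw: "t \<cdot> w \<in> Hom C W S" using t w by (simp add: in_Hom)
  have "m \<cdot> (t \<cdot> w) = y \<cdot> w" using comp_reduce[OF t(2), of w] t w m by (simp add: in_Hom)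
  then show ?thesis using red[OF tw] red'[OF w(1)] w(2,3) tw by metis
qed

text \<open>Symmetry is the Euclidean property for \<open>(a, b)\<close> and \<open>(a, a)\<close>; transitivity follows from both.\<close>

lemma reflexive_relation_effective:
  assumes s: "s0 \<in> Hom C S X" "s1 \<in> Hom C S X"
    and jm: "\<And>W x y. \<lbrakk>x \<in> Hom C W S; y \<in> Hom C W S; s0 \<cdot> x = s0 \<cdot> y; s1 \<cdot> x = s1 \<cdot> y\<rbrakk> \<Longrightarrow> x = y"
    and d: "d \<in> Hom C X S" "s0 \<cdot> d = Id C X" "s1 \<cdot> d = Id C X"
  shows "\<exists>f. is_kernel_pair C f s0 s1"
proof (rule effective[of X])
  have euclidean: "\<exists>c. c \<in> Hom C W S \<and> s0 \<cdot> c = s1 \<cdot> a \<and> s1 \<cdot> c = s1 \<cdot> b"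
    if "a \<in> Hom C W S" "b \<in> Hom C W S" "s0 \<cdot> a = s0 \<cdot> b" for W a b
    using reflexive_relation_euclidean[OF s _ d that] jm by blast
  have S: "S \<in> Obj C" using Hom_Obj[OF s(1)] by blast
  have ty: "Id C S \<in> Hom C S S" "d \<cdot> s0 \<in> Hom C S S" using S d s by (simp_all add: in_Hom)
  have "s0 \<cdot> Id C S = s0 \<cdot> (d \<cdot> s0)" "s1 \<cdot> (d \<cdot> s0) = s0"
    using comp_reduce[OF d(2), of s0] comp_reduce[OF d(3), of s0] d s by (simp_all add: in_Hom)
  then obtain i where i: "i \<in> Hom C S S" "s0 \<cdot> i = s1" "s1 \<cdot> i = s0"
    using euclidean[OF ty] s S by (auto simp: in_Hom)
  show "equivalence_relation C X s0 s1"
    unfolding equivalence_relation_def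
  proof (intro conjI allI ballI impI)
    fix p q assume pb: "is_pullback C s1 s0 p q"
    note pq = pullback_typing[OF pb s(2,1)]
    have 0: "s0 \<cdot> (i \<cdot> p) = s1 \<cdot> p" "s1 \<cdot> (i \<cdot> p) = s0 \<cdot> p"
      using comp_reduce[OF i(2), of p] comp_reduce[OF i(3), of p] pq s i by (simp_all add: in_Hom)
    have "i \<cdot> p \<in> Hom C (Dom C p) S" using i pq by (simp add: in_Hom)
    then show "\<exists>t\<in>Hom C (Dom C p) (Dom C s0). s0 \<cdot> t = s0 \<cdot> p \<and> s1 \<cdot> t = s1 \<cdot> q"
      using euclidean[of "i \<cdot> p" "Dom C p" q] pq 0 s(1) by (auto simp: in_Hom)
  next
    fix W x y
    assume "x \<in> Hom C W (Dom C s0)" "y \<in> Hom C W (Dom C s0)" "s0 \<cdot> x = s0 \<cdot> y \<and> s1 \<cdot> x = s1 \<cdot> y"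
    then show "x = y" using jm[of x W y] s(1) by (simp add: in_Hom)
  next
    show "\<exists>d\<in>Hom C X (Dom C s0). s0 \<cdot> d = Id C X \<and> s1 \<cdot> d = Id C X"
      using d s(1) by (intro bexI[of _ d]) (simp_all add: in_Hom)
    show "\<exists>t\<in>Hom C (Dom C s0) (Dom C s0). s0 \<cdot> t = s1 \<and> s1 \<cdot> t = s0"
      using i s(1) by (intro bexI[of _ i]) (simp_all add: in_Hom)
  qed (use s in \<open>simp_all add: in_Hom\<close>)
qed

text \<open>The congruence of \<open>e\<close> has an image along \<open>f\<close>, which is a reflexive relation and hence, by the
  Mal'tsev property and exactness, the kernel pair of a quotient map \<open>q\<close>. An element killed by \<open>q\<close> is then locally of the form
  \<open>f b'\<close> for a pair \<open>(b, b')\<close> in the congruence with \<open>f b = 0\<close>. To replace \<open>b'\<close> by an element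
  of the kernel of \<open>e\<close>, consider all such pairs, projected to the kernel of \<open>f\<close> by \<open>b\<close>: this
  is a split epimorphism, and on its kernel (\<open>b = 0\<close>) and on its section (\<open>b = b'\<close>) the claim
  is clear.\<close>

theorem direct_image_of_kernel:
  assumes f: "regular_epi C f" "f \<in> Hom C B A" and e: "e \<in> Hom C B E"
  obtains Q q where "regular_epi C q" "q \<in> Hom C A Q"
    "\<And>W x. \<lbrakk>x \<in> Hom C W B; e \<cdot> x = zmap W E\<rbrakk> \<Longrightarrow> q \<cdot> (f \<cdot> x) = zmap W Q"
    "\<And>W a. \<lbrakk>a \<in> Hom C W A; q \<cdot> a = zmap W Q\<rbrakk> \<Longrightarrow>
       \<exists>V c x. c \<in> Hom C V W \<and> regular_epi C c \<and> x \<in> Hom C V B \<and> e \<cdot> x = zmap V E \<and> f \<cdot> x = a \<cdot> c"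
proof -
  have ob: "A \<in> Obj C" "B \<in> Obj C" "E \<in> Obj C" using f e Hom_Obj by auto
  obtain R r0 r1 d where kp: "is_kernel_pair C e r0 r1" "r0 \<in> Hom C R B" "r1 \<in> Hom C R B"
    "e \<cdot> r0 = e \<cdot> r1" "d \<in> Hom C B R" "r0 \<cdot> d = Id C B" "r1 \<cdot> d = Id C B" "Dom C r0 = R"
    using kernel_pair_exists[OF e] .
  obtain P p0 p1 where P: "p0 \<in> Hom C P A" "p1 \<in> Hom C P A"
    and pair: "\<And>W x y. \<lbrakk>x \<in> Hom C W A; y \<in> Hom C W A\<rbrakk> \<Longrightarrow>
      \<exists>t. t \<in> Hom C W P \<and> p0 \<cdot> t = x \<and> p1 \<cdot> t = y"
    and uniq: "\<And>W s t. \<lbrakk>s \<in> Hom C W P; t \<in> Hom C W P; p0 \<cdot> s = p0 \<cdot> t; p1 \<cdot> s = p1 \<cdot> t\<rbrakk> \<Longrightarrow> s = t"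
    by (rule product_exists[OF ob(1) ob(1)]) blast
  have "f \<cdot> r0 \<in> Hom C R A" "f \<cdot> r1 \<in> Hom C R A" using f kp by (simp_all add: in_Hom)
  then obtain r where r: "r \<in> Hom C R P" "p0 \<cdot> r = f \<cdot> r0" "p1 \<cdot> r = f \<cdot> r1" using pair by blast
  obtain S g m where im: "g \<in> Hom C R S" "regular_epi C g" "m \<in> Hom C S P" "is_mono C m" "m \<cdot> g = r"
    using image_factorization[OF r(1)] .
  define s0 s1 where "s0 = p0 \<cdot> m" and "s1 = p1 \<cdot> m"
  have s: "s0 \<in> Hom C S A" "s1 \<in> Hom C S A"
    unfolding s0_def s1_def using P im by (simp_all add: in_Hom)
  have sg: "s0 \<cdot> g = f \<cdot> r0" "s1 \<cdot> g = f \<cdot> r1"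
    unfolding s0_def s1_def using P im r by (simp_all add: in_Hom)
  have jm: "x = y"
    if xy: "x \<in> Hom C W S" "y \<in> Hom C W S" "s0 \<cdot> x = s0 \<cdot> y" "s1 \<cdot> x = s1 \<cdot> y" for W x y
  proof -
    have "m \<cdot> x = m \<cdot> y"
      by (rule uniq[of _ W]) (use xy P im in \<open>simp_all add: in_Hom s0_def s1_def\<close>)
    then show ?thesis using monoD[OF im(4,3)] xy by blast
  qed
  \<comment> \<open>The image relation is reflexive because \<open>f\<close> is a regular epimorphism.\<close>
  have "Id C A \<in> Hom C A A" using ob by (simp add: in_Hom)
  then obtain i where i: "i \<in> Hom C A P" "p0 \<cdot> i = Id C A" "p1 \<cdot> i = Id C A" using pair by blast
  have gd: "g \<cdot> d \<in> Hom C B S" using im kp by (simp add: in_Hom)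
  have "m \<cdot> (g \<cdot> d) = i \<cdot> f"
  proof (rule uniq[of _ B])
    show "p0 \<cdot> (m \<cdot> (g \<cdot> d)) = p0 \<cdot> (i \<cdot> f)"
      using comp_reduce[OF im(5), of d] comp_reduce[OF r(2), of d] comp_reduce[OF i(2), of f]
        im r kp f P i by (simp add: in_Hom)
    show "p1 \<cdot> (m \<cdot> (g \<cdot> d)) = p1 \<cdot> (i \<cdot> f)"
      using comp_reduce[OF im(5), of d] comp_reduce[OF r(3), of d] comp_reduce[OF i(3), of f]
        im r kp f P i by (simp add: in_Hom)
  qed (use gd im i f in \<open>simp_all add: in_Hom\<close>)
  then obtain j where j: "j \<in> Hom C A S" "m \<cdot> j = i"
    using mono_factor_descend[OF f im(4,3) i(1) gd] by blast
  have sj: "s0 \<cdot> j = Id C A" "s1 \<cdot> j = Id C A"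
    unfolding s0_def s1_def using j i im P by (simp_all add: in_Hom)
  obtain h where "is_kernel_pair C h s0 s1"
    using reflexive_relation_effective[OF s _ j(1) sj] jm by blast
  moreover define H where "H = Cod C h"
  ultimately have h: "is_kernel_pair C h s0 s1" "h \<in> Hom C A H" "h \<cdot> s0 = h \<cdot> s1"
    unfolding is_pullback_def using s by (auto simp: in_Hom)
  obtain q where co: "is_coequalizer C s0 s1 q" using ex_coequalizer_kernel_pair[OF h(1)] by blast
  define Q where "Q = Cod C q"
  have q: "q \<in> Hom C A Q" "q \<cdot> s0 = q \<cdot> s1" "regular_epi C q"
    using co s unfolding is_coequalizer_def regular_epi_def Q_def by (auto simp: in_Hom)
  have "h \<in> Hom C (Cod C s0) H" using h s by (simp add: in_Hom)
  then obtain h' where h': "h' \<in> Hom C Q H" "h' \<cdot> q = h"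
    using co h(3) unfolding is_coequalizer_def Q_def by metis
  have Q: "Q \<in> Obj C" using Hom_Obj[OF q(1)] by blast
  show ?thesis
  proof (rule that[OF q(3,1)])
    fix W x assume x: "x \<in> Hom C W B" "e \<cdot> x = zmap W E"
    have W: "W \<in> Obj C" using Hom_Obj[OF x(1)] by blast
    obtain t where t: "t \<in> Hom C W R" "r0 \<cdot> t = zmap W B" "r1 \<cdot> t = x"
      using pullback_lift[OF kp(1) e e _ x(1), of "zmap W B"] x(2) W ob e kp(8)
      by (auto simp: in_Hom)
    have "q \<cdot> (s0 \<cdot> (g \<cdot> t)) = q \<cdot> (s1 \<cdot> (g \<cdot> t))"
      using comp_reduce[OF q(2), of "g \<cdot> t"] t q s im by (simp add: in_Hom)
    then show "q \<cdot> (f \<cdot> x) = zmap W Q"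
      using comp_reduce[OF sg(1), of t] comp_reduce[OF sg(2), of t] t q s im f kp W ob
      by (simp add: in_Hom)
  next
    fix W a assume a: "a \<in> Hom C W A" "q \<cdot> a = zmap W Q"
    have W: "W \<in> Obj C" using Hom_Obj[OF a(1)] by blast
    have "h \<cdot> a = zmap W H"
      using comp_reduce[OF h'(2), of a] a q h' W Q by (simp add: in_Hom)
    then have "h \<cdot> zmap W A = h \<cdot> a" using h(2) W by (simp add: in_Hom)
    moreover have "zmap W A \<in> Hom C W A" using W ob by (simp add: in_Hom)
    ultimately obtain t where t: "t \<in> Hom C W S" "s0 \<cdot> t = zmap W A" "s1 \<cdot> t = a"
      using pullback_lift[OF h(1,2,2) _ a(1)] s(1) by (metis in_Hom)
    obtain V c z where c: "c \<in> Hom C V W" "regular_epi C c" "z \<in> Hom C V R" "g \<cdot> z = t \<cdot> c"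
      using cover_lift[OF im(2,1) t(1)] .
    have V: "V \<in> Obj C" using Hom_Obj[OF c(1)] by blast
    have fr0z: "f \<cdot> (r0 \<cdot> z) = zmap V A" and fr1z: "f \<cdot> (r1 \<cdot> z) = a \<cdot> c"
    proof -
      have "s0 \<cdot> (g \<cdot> z) = (s0 \<cdot> t) \<cdot> c" "s1 \<cdot> (g \<cdot> z) = (s1 \<cdot> t) \<cdot> c"
        unfolding c(4) using s t(1) c by (simp_all add: in_Hom)
      then show "f \<cdot> (r0 \<cdot> z) = zmap V A" "f \<cdot> (r1 \<cdot> z) = a \<cdot> c"
        using comp_reduce[OF sg(1), of z] comp_reduce[OF sg(2), of z] t(2,3) c s im f kp ob W
        by (simp_all add: in_Hom)
    qed
    \<comment> \<open>Pairs \<open>(b, b')\<close> in the congruence with \<open>f b = 0\<close>, over the kernel of \<open>f\<close>.\<close>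
    have fr0: "f \<cdot> r0 \<in> Hom C R A" using f kp by (simp add: in_Hom)
    obtain T n where n: "is_kernel C n (f \<cdot> r0)" "n \<in> Hom C T R" "(f \<cdot> r0) \<cdot> n = zmap T A"
      using kernel_exists[OF fr0] .
    obtain L l where l: "is_kernel C l f" "l \<in> Hom C L B" "f \<cdot> l = zmap L A"
      using kernel_exists[OF f(2)] .
    obtain K k where k: "is_kernel C k e" "k \<in> Hom C K B" "e \<cdot> k = zmap K E"
      using kernel_exists[OF e] .
    have obs: "T \<in> Obj C" "L \<in> Obj C" "K \<in> Obj C" using n l k Hom_Obj by auto
    have dn: "Dom C n = T" "Dom C l = L" "Dom C k = K" using n l k by (auto simp: in_Hom)
    have "r0 \<cdot> n \<in> Hom C T B" "f \<cdot> (r0 \<cdot> n) = zmap T A" using n kp f by (simp_all add: in_Hom)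
    then obtain p where p: "p \<in> Hom C T L" "l \<cdot> p = r0 \<cdot> n"
      using kernel_lift[OF l(1) f(2)] dn by metis
    have "d \<cdot> l \<in> Hom C L R" "(f \<cdot> r0) \<cdot> (d \<cdot> l) = zmap L A"
      using comp_reduce[OF kp(6), of l] l kp f ob by (simp_all add: in_Hom)
    then obtain y where y: "y \<in> Hom C L T" "n \<cdot> y = d \<cdot> l"
      using kernel_lift[OF n(1) fr0] dn by metis
    have py: "p \<cdot> y = Id C L"
      by (rule monoD[OF kernel_mono[OF l(1) f(2)] l(2), of _ L])
        (use comp_reduce[OF p(2), of y] comp_reduce[OF kp(6), of l] y p n l kp obs
          in \<open>simp_all add: in_Hom\<close>)
    have fk: "f \<cdot> k \<in> Hom C K A" and fn: "f \<cdot> (r1 \<cdot> n) \<in> Hom C T A"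
      using f k kp n by (simp_all add: in_Hom)
    have lift: "locally_lifts (f \<cdot> k) (f \<cdot> (r1 \<cdot> n))"
    proof (rule split_epi_generation_local[OF p(1) y(1) py fk fn])
      fix U u assume u: "u \<in> Hom C U T" "p \<cdot> u = zmap U L"
      have U: "U \<in> Obj C" using Hom_Obj[OF u(1)] by blast
      have "r0 \<cdot> (n \<cdot> u) = zmap U B"
        using comp_reduce[OF p(2), of u] u p n l kp U by (simp add: in_Hom)
      then have "e \<cdot> (r1 \<cdot> (n \<cdot> u)) = zmap U E"
        using comp_reduce[OF kp(4), of "n \<cdot> u"] u n kp e U by (simp add: in_Hom)
      moreover have nu: "r1 \<cdot> (n \<cdot> u) \<in> Hom C U B" using u n kp by (simp add: in_Hom)
      ultimately obtain v where v: "v \<in> Hom C U K" "k \<cdot> v = r1 \<cdot> (n \<cdot> u)"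
        using kernel_lift[OF k(1) e] dn by metis
      show "locally_lifts (f \<cdot> k) ((f \<cdot> (r1 \<cdot> n)) \<cdot> u)"
        by (rule factor_locally_lifts[of v U _ _ A])
          (use v u n kp f k in \<open>simp_all add: in_Hom\<close>)
    next
      show "locally_lifts (f \<cdot> k) ((f \<cdot> (r1 \<cdot> n)) \<cdot> y)"
        by (rule factor_locally_lifts[of "zmap L K" L _ _ A])
          (use comp_reduce[OF kp(7), of l] y n kp f k l ob obs in \<open>simp_all add: in_Hom\<close>)
    qed
    obtain w where w: "w \<in> Hom C V T" "n \<cdot> w = z"
      using kernel_lift[OF n(1) fr0 c(3)] fr0z c(3) kp f dn by (auto simp: in_Hom)
    have fnw: "(f \<cdot> (r1 \<cdot> n)) \<cdot> w = a \<cdot> c" using w n kp f fr1z by (simp add: in_Hom)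
    have "locally_lifts (f \<cdot> k) (a \<cdot> c)"
      using locally_lifts_precomp[OF lift fk fn w(1)] fnw by simp
    moreover have "a \<cdot> c \<in> Hom C V A" using a c by (simp add: in_Hom)
    ultimately obtain U c' x where c': "c' \<in> Hom C U V" "regular_epi C c'" "x \<in> Hom C U K"
      "(f \<cdot> k) \<cdot> x = (a \<cdot> c) \<cdot> c'"
      using locally_liftsE[OF _ fk] by blast
    have "c \<cdot> c' \<in> Hom C U W" "regular_epi C (c \<cdot> c')" "k \<cdot> x \<in> Hom C U B"
      "e \<cdot> (k \<cdot> x) = zmap U E" "f \<cdot> (k \<cdot> x) = a \<cdot> (c \<cdot> c')"
      using c c' k f e a ob comp_reduce[OF k(3), of x] regular_epi_comp[OF c'(2,1) c(2,1)]
      by (simp_all add: in_Hom)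
    then show "\<exists>V c x. c \<in> Hom C V W \<and> regular_epi C c \<and> x \<in> Hom C V B \<and> e \<cdot> x = zmap V E \<and>
        f \<cdot> x = a \<cdot> c" by blast
  qed
qed

end

section \<open>Commutators and central extensions\<close>

locale semi_abelian_birkhoff = semi_abelian C + birkhoff_subcategory C B R
  for C :: "('o, 'm) cat" (structure) and B :: "'o set" and R :: "('o, 'm) reflector"
begin

lemma unit_typing [simp]:
  assumes "X \<in> Obj C"
  shows "Unit R X \<in> Arr C" "Dom C (Unit R X) = X" "Cod C (Unit R X) = Robj R X" "Robj R X \<in> Obj C"
  using Unit_Hom[OF assms] Robj_B[OF assms] B_Obj by (auto simp: in_Hom)

lemma Rarr_typing [simp]:
  assumes "f \<in> Arr C"
  shows "Rarr R f \<in> Arr C" "Dom C (Rarr R f) = Robj R (Dom C f)" "Cod C (Rarr R f) = Robj R (Cod C f)"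
  using Rarr_Hom[OF arr_Hom[OF assms]] by (auto simp: in_Hom)

lemma unit_factor:
  assumes "f \<in> Hom C X Y" "Y \<in> B"
  obtains g where "g \<in> Hom C (Robj R X) Y" "g \<cdot> Unit R X = f"
  using Unit_universal[OF Hom_Obj(1)[OF assms(1)] assms(2,1)] that by (elim ex1E conjE)

text \<open>The image of a unit component is a subobject of an object of the subcategory, so the unit
  factors through its own image by universality.\<close>

lemma unit_regular_epi:
  assumes X: "X \<in> Obj C"
  shows "regular_epi C (Unit R X)"
proof -
  note u = Unit_Hom[OF X]
  obtain I e m where f: "e \<in> Hom C X I" "regular_epi C e" "m \<in> Hom C I (Robj R X)" "is_mono C m"
    "m \<cdot> e = Unit R X"
    using image_factorization[OF u] .
  have "I \<in> B" using closed_subobjects f(3,4) Robj_B[OF X] by blast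
  then obtain g where g: "g \<in> Hom C (Robj R X) I" "g \<cdot> Unit R X = e"
    by (rule unit_factor[OF f(1)])
  have "m \<cdot> g \<in> Hom C (Robj R X) (Robj R X)" "(m \<cdot> g) \<cdot> Unit R X = Unit R X"
    "Id C (Robj R X) \<in> Hom C (Robj R X) (Robj R X)" "Id C (Robj R X) \<cdot> Unit R X = Unit R X"
    using f g X by (simp_all add: in_Hom)
  then have "m \<cdot> g = Id C (Robj R X)" using Unit_universal[OF X Robj_B[OF X] u] by metis
  then have "is_iso C m" using mono_split_epi_iso[OF f(4,3) g(1)] by blast
  then show ?thesis using iso_comp_regular_epi[OF _ f(3,2,1)] f(5) by simp
qed

text \<open>Membership of a generalized element in the commutator \<open>[X, X]\<close>.\<close>

definition in_comm where
  "in_comm x \<longleftrightarrow> Unit R (Cod C x) \<cdot> x = zmap (Dom C x) (Robj R (Cod C x))"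

lemma in_comm_iff: "x \<in> Hom C W X \<Longrightarrow> in_comm x \<longleftrightarrow> Unit R X \<cdot> x = zmap W (Robj R X)"
  unfolding in_comm_def by (simp add: in_Hom)

lemmas in_commD = iffD1[OF in_comm_iff] and in_commI = iffD2[OF in_comm_iff]

lemma in_comm_postcomp:
  assumes x: "x \<in> Hom C W X" "in_comm x" and g: "g \<in> Hom C X Y"
  shows "in_comm (g \<cdot> x)"
proof -
  have ob: "X \<in> Obj C" "Y \<in> Obj C" "W \<in> Obj C" using x g Hom_Obj by auto
  have "Unit R Y \<cdot> (g \<cdot> x) = (Rarr R g \<cdot> Unit R X) \<cdot> x"
    unfolding Unit_natural[OF g] using x(1) g ob by (simp add: in_Hom)
  also have "\<dots> = zmap W (Robj R Y)" using x in_comm_iff[OF x(1)] g ob by (simp add: in_Hom)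
  finally show ?thesis using in_comm_iff[of "g \<cdot> x" W Y] x(1) g by (simp add: in_Hom)
qed

lemma in_comm_precomp:
  assumes x: "x \<in> Hom C W X" "in_comm x" and y: "y \<in> Hom C V W"
  shows "in_comm (x \<cdot> y)"
proof -
  have ob: "X \<in> Obj C" "W \<in> Obj C" using x y Hom_Obj by auto
  have eq: "Unit R X \<cdot> x = zmap W (Robj R X)" by (rule in_commD[OF x])
  have "Unit R X \<cdot> (x \<cdot> y) = zmap V (Robj R X)"
    using x(1) y ob by (simp add: in_Hom comp_reduce[OF eq])
  then show ?thesis using in_comm_iff[of "x \<cdot> y" V X] x(1) y by (simp add: in_Hom)
qed

lemma in_comm_descend:
  assumes x: "x \<in> Hom C W X" and c: "c \<in> Hom C V W" "regular_epi C c" and xc: "in_comm (x \<cdot> c)"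
  shows "in_comm x"
proof -
  have ob: "X \<in> Obj C" "W \<in> Obj C" using x Hom_Obj by auto
  have eq: "Unit R X \<cdot> (x \<cdot> c) = zmap V (Robj R X)"
    using xc in_comm_iff[of "x \<cdot> c" V X] x c by (simp add: in_Hom)
  have "Unit R X \<cdot> x = zmap W (Robj R X)"
    by (rule regular_epi_epi[OF c(2,1), of _ "Robj R X"]) (use eq x c ob in \<open>simp_all add: in_Hom\<close>)
  then show ?thesis using in_comm_iff[OF x] by blast
qed

lemma in_comm_subcategory:
  assumes x: "x \<in> Hom C W Y" "in_comm x" and Y: "Y \<in> B"
  shows "x = zmap W Y"
proof -
  have ob: "Y \<in> Obj C" "W \<in> Obj C" using Hom_Obj[OF x(1)] by auto
  have "Id C Y \<in> Hom C Y Y" using ob by (simp add: in_Hom)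
  then obtain g where g: "g \<in> Hom C (Robj R Y) Y" "g \<cdot> Unit R Y = Id C Y"
    by (rule unit_factor[OF _ Y])
  have red: "g \<cdot> (Unit R Y \<cdot> x) = x" using g(1) x(1) ob by (simp add: in_Hom comp_reduce[OF g(2)])
  have "Unit R Y \<cdot> x = zmap W (Robj R Y)" by (rule in_commD[OF x])
  then have "g \<cdot> (Unit R Y \<cdot> x) = zmap W Y" using g(1) ob by (simp add: in_Hom)
  then show ?thesis unfolding red .
qed

text \<open>The image of \<open>[X, X]\<close> under \<open>f\<close> is the kernel of some quotient \<open>q\<close> of \<open>Y\<close>. The codomain of
  \<open>q\<close> is a quotient of the reflection of \<open>X\<close>, hence lies in the subcategory, so \<open>q\<close> vanishes on
  \<open>[Y, Y]\<close>. This is where closure under regular quotients enters.\<close>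

lemma in_comm_lift:
  assumes f: "regular_epi C f" "f \<in> Hom C X Y" and a: "a \<in> Hom C W Y" "in_comm a"
  obtains V c x where "c \<in> Hom C V W" "regular_epi C c" "x \<in> Hom C V X" "in_comm x" "f \<cdot> x = a \<cdot> c"
proof -
  have ob: "X \<in> Obj C" "Y \<in> Obj C" "W \<in> Obj C" using f a Hom_Obj by auto
  obtain Q q where q: "regular_epi C q" "q \<in> Hom C Y Q"
    and q_zero: "\<And>W x. \<lbrakk>x \<in> Hom C W X; Unit R X \<cdot> x = zmap W (Robj R X)\<rbrakk> \<Longrightarrow> q \<cdot> (f \<cdot> x) = zmap W Q"
    and q_lift: "\<And>W a. \<lbrakk>a \<in> Hom C W Y; q \<cdot> a = zmap W Q\<rbrakk> \<Longrightarrow>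
       \<exists>V c x. c \<in> Hom C V W \<and> regular_epi C c \<and> x \<in> Hom C V X \<and>
         Unit R X \<cdot> x = zmap V (Robj R X) \<and> f \<cdot> x = a \<cdot> c"
    by (rule direct_image_of_kernel[OF f Unit_Hom[OF ob(1)]]) blast
  have qf: "q \<cdot> f \<in> Hom C X Q" using q f by (simp add: in_Hom)
  obtain t where t: "t \<in> Hom C (Robj R X) Q" "t \<cdot> Unit R X = q \<cdot> f"
  proof (rule regular_epi_factor[OF unit_regular_epi[OF ob(1)] Unit_Hom[OF ob(1)] qf])
    fix V z assume "z \<in> Hom C V X" "Unit R X \<cdot> z = zmap V (Robj R X)"
    then show "(q \<cdot> f) \<cdot> z = zmap V Q" using q_zero[of z V] q f by (simp add: in_Hom)
  qed blast
  have "regular_epi C t"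
    by (rule regular_epi_cancel[OF _ Unit_Hom[OF ob(1)] t(1)])
      (use t(2) regular_epi_comp[OF f q] in simp)
  then have "Q \<in> B" using closed_regular_quotients t(1) Robj_B[OF ob(1)] by blast
  then obtain s where s: "s \<in> Hom C (Robj R Y) Q" "s \<cdot> Unit R Y = q"
    by (rule unit_factor[OF q(2)])
  have red: "s \<cdot> (Unit R Y \<cdot> a) = q \<cdot> a"
    using s a(1) ob by (simp add: in_Hom comp_reduce[OF s(2)])
  have "Unit R Y \<cdot> a = zmap W (Robj R Y)" by (rule in_commD[OF a])
  then have "s \<cdot> (Unit R Y \<cdot> a) = zmap W Q" using s(1) ob by (simp add: in_Hom)
  then have "q \<cdot> a = zmap W Q" unfolding red .
  then obtain V c x where "c \<in> Hom C V W" "regular_epi C c" "x \<in> Hom C V X"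
    "Unit R X \<cdot> x = zmap V (Robj R X)" "f \<cdot> x = a \<cdot> c"
    using q_lift[OF a(1)] by blast
  then show ?thesis using that in_commI by blast
qed

lemma trivial_extension_unique:
  assumes f: "trivial_extension C R f" "f \<in> Hom C X Y"
    and xy: "x \<in> Hom C W X" "y \<in> Hom C W X" "in_comm x" "in_comm y" "f \<cdot> x = f \<cdot> y"
  shows "x = y"
proof -
  have X: "X \<in> Obj C" using Hom_Obj[OF f(2)] by blast
  have pb: "is_pullback C (Rarr R f) (Unit R Y) (Unit R X) f"
    using f unfolding trivial_extension_def by (simp add: in_Hom)
  show ?thesis
    using pullback_unique[OF pb, of x W y] xy in_comm_iff[OF xy(1)] in_comm_iff[OF xy(2)] X
    by simp
qed

text \<open>The unit and \<open>f\<close> are jointly monic by assumption, so only local existence is in question. Given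
  an element \<open>x\<close> of \<open>X\<close> and an element \<open>y\<close> of \<open>Y\<close> such that \<open>f x\<close> and \<open>y\<close> have the same class in
  the reflection of \<open>Y\<close>, one needs an element with the class of \<open>x\<close> that is mapped to \<open>y\<close>. The pairs
  \<open>(x, y)\<close> form a split epimorphism over \<open>X\<close>, with section \<open>(x, f x)\<close>; for pairs on the section
  the claim is clear, and for \<open>x = 0\<close> it is the surjectivity of \<open>f\<close> on commutators.\<close>

lemma trivial_extensionI:
  assumes f: "regular_epi C f" "f \<in> Hom C X Y"
    and ker: "\<And>W z. \<lbrakk>z \<in> Hom C W X; in_comm z; f \<cdot> z = zmap W Y\<rbrakk> \<Longrightarrow> z = zmap W X"
  shows "trivial_extension C R f"
proof -
  have ob: "X \<in> Obj C" "Y \<in> Obj C" using Hom_Obj[OF f(2)] by auto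
  note uX = Unit_Hom[OF ob(1)] and uY = Unit_Hom[OF ob(2)]
  have Rf: "Rarr R f \<in> Hom C (Robj R X) (Robj R Y)" by (rule Rarr_Hom[OF f(2)])
  note nat = Unit_natural[OF f(2)]
  have jm: "x = y"
    if "x \<in> Hom C W X" "y \<in> Hom C W X" "Unit R X \<cdot> x = Unit R X \<cdot> y" "f \<cdot> x = f \<cdot> y" for W x y
    by (rule zero_kernel_jointly_mono[OF uX f(2) _ that]) (use ker in_comm_iff in blast)
  have uf: "Unit R Y \<cdot> f \<in> Hom C X (Robj R Y)" using uY f by (simp add: in_Hom)
  obtain V a b where pb: "is_pullback C (Unit R Y \<cdot> f) (Unit R Y) a b" "a \<in> Hom C V X" "b \<in> Hom C V Y"
    "(Unit R Y \<cdot> f) \<cdot> a = Unit R Y \<cdot> b" "Dom C a = V"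
    using pullback_exists[OF uf uY] .
  have pair: "\<exists>t. t \<in> Hom C W V \<and> a \<cdot> t = x \<and> b \<cdot> t = y"
    if "x \<in> Hom C W X" "y \<in> Hom C W Y" "Unit R Y \<cdot> (f \<cdot> x) = Unit R Y \<cdot> y" for W x y
    using pullback_lift[OF pb(1) uf uY that(1,2)] that pb(5) f(2) uY by (auto simp: in_Hom)
  have uniq: "s = t" if "s \<in> Hom C W V" "t \<in> Hom C W V" "a \<cdot> s = a \<cdot> t" "b \<cdot> s = b \<cdot> t" for W s t
    using pullback_unique[OF pb(1)] that pb(5) by blast
  obtain P h0 h1 d where kp: "is_kernel_pair C (Unit R X) h0 h1" "h0 \<in> Hom C P X" "h1 \<in> Hom C P X"
    "Unit R X \<cdot> h0 = Unit R X \<cdot> h1" "d \<in> Hom C X P" "h0 \<cdot> d = Id C X" "h1 \<cdot> d = Id C X" "Dom C h0 = P"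
    using kernel_pair_exists[OF uX] .
  have idX: "Id C X \<in> Hom C X X" using ob by (simp add: in_Hom)
  obtain s where s: "s \<in> Hom C X V" "a \<cdot> s = Id C X" "b \<cdot> s = f"
    using pair[OF idX f(2)] f(2) uY by (auto simp: in_Hom)
  have fh: "f \<cdot> h1 \<in> Hom C P Y" using f kp by (simp add: in_Hom)
  have "Unit R Y \<cdot> (f \<cdot> h0) = Rarr R f \<cdot> (Unit R X \<cdot> h0)"
    "Unit R Y \<cdot> (f \<cdot> h1) = Rarr R f \<cdot> (Unit R X \<cdot> h1)"
    using f uX uY Rf kp(2,3)
    by (simp_all add: in_Hom comp_reduce[OF nat])
  then obtain g where g: "g \<in> Hom C P V" "a \<cdot> g = h0" "b \<cdot> g = f \<cdot> h1"
    using pair[OF kp(2) fh] kp(4) by auto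
  have ag: "a \<cdot> (g \<cdot> t) = h0 \<cdot> t" "b \<cdot> (g \<cdot> t) = f \<cdot> (h1 \<cdot> t)" if "t \<in> Hom C W P" for t W
    using g(1) pb kp f that
    by (simp_all add: in_Hom comp_reduce[OF g(2)] comp_reduce[OF g(3)])
  have Vob: "V \<in> Obj C" using Hom_Obj[OF pb(2)] by blast
  have idV: "Id C V \<in> Hom C V V" using Vob by (simp add: in_Hom)
  have surj: "locally_lifts g (Id C V)"
  proof (rule split_epi_generation_local[OF pb(2) s(1,2) g(1) idV])
    fix W z assume z: "z \<in> Hom C W V" "a \<cdot> z = zmap W X"
    have W: "W \<in> Obj C" using Hom_Obj[OF z(1)] by blast
    have bz: "b \<cdot> z \<in> Hom C W Y" using z pb by (simp add: in_Hom)
    have "Unit R Y \<cdot> (b \<cdot> z) = zmap W (Robj R Y)"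
      using z pb f uY W ob comp_reduce[OF pb(4), of z] by (simp add: in_Hom)
    then have "in_comm (b \<cdot> z)" using in_comm_iff[OF bz] by blast
    then obtain U c x where c: "c \<in> Hom C U W" "regular_epi C c" "x \<in> Hom C U X" "in_comm x"
      "f \<cdot> x = (b \<cdot> z) \<cdot> c"
      using in_comm_lift[OF f bz] by blast
    have U: "U \<in> Obj C" using Hom_Obj[OF c(1)] by blast
    have "zmap U X \<in> Hom C U X" "Unit R X \<cdot> zmap U X = Unit R X \<cdot> x"
      using U ob uX in_comm_iff[OF c(3)] c(4) by (simp_all add: in_Hom)
    then obtain t where t: "t \<in> Hom C U P" "h0 \<cdot> t = zmap U X" "h1 \<cdot> t = x"
      using pullback_lift[OF kp(1) uX uX _ c(3)] kp(8) by metis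
    have "g \<cdot> t = z \<cdot> c"
      by (rule uniq[of _ U])
        (use ag[OF t(1)] t c z g(1) pb W ob in \<open>simp_all add: in_Hom comp_reduce[OF z(2)]\<close>)
    then show "locally_lifts g (Id C V \<cdot> z)"
      using t(1) g(1) z(1) c(1,2) by (intro locally_liftsI[of c U _ t]) (simp_all add: in_Hom)
  next
    have "g \<cdot> d = s"
      by (rule uniq[of _ X]) (use ag[OF kp(5)] kp g(1) s f in \<open>simp_all add: in_Hom\<close>)
    then show "locally_lifts g (Id C V \<cdot> s)"
      by (intro factor_locally_lifts[of d X _ _ V]) (use kp g(1) s in \<open>simp_all add: in_Hom\<close>)
  qed
  have "is_pullback C (Rarr R f) (Unit R Y) (Unit R X) f"
    unfolding is_pullback_def
  proof (intro conjI allI ballI impI)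
    fix W x y
    assume xy: "x \<in> Hom C W (Dom C (Rarr R f))" "y \<in> Hom C W (Dom C (Unit R Y))"
      "Rarr R f \<cdot> x = Unit R Y \<cdot> y"
    then have x: "x \<in> Hom C W (Robj R X)" and y: "y \<in> Hom C W Y"
      using Rf uY by (simp_all add: in_Hom)
    obtain W1 c1 x1 where c1: "c1 \<in> Hom C W1 W" "regular_epi C c1" "x1 \<in> Hom C W1 X"
      "Unit R X \<cdot> x1 = x \<cdot> c1"
      using cover_lift[OF unit_regular_epi[OF ob(1)] uX x] .
    have yc: "y \<cdot> c1 \<in> Hom C W1 Y" using y c1 by (simp add: in_Hom)
    have "Rarr R f \<cdot> (Unit R X \<cdot> x1) = Unit R Y \<cdot> (f \<cdot> x1)"
      "Rarr R f \<cdot> (x \<cdot> c1) = Unit R Y \<cdot> (y \<cdot> c1)"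
      using c1(1,3) x y f uX uY Rf
      by (simp_all add: in_Hom comp_reduce[OF nat] comp_reduce[OF xy(3)])
    then have "Unit R Y \<cdot> (f \<cdot> x1) = Unit R Y \<cdot> (y \<cdot> c1)" unfolding c1(4) by simp
    then obtain w where w: "w \<in> Hom C W1 V" "a \<cdot> w = x1" "b \<cdot> w = y \<cdot> c1"
      using pair[OF c1(3) yc] by blast
    have "locally_lifts g w"
      using locally_lifts_precomp[OF surj g(1) idV w(1)] w(1) by (simp add: in_Hom)
    then obtain W2 c2 p where c2: "c2 \<in> Hom C W2 W1" "regular_epi C c2" "p \<in> Hom C W2 P"
      "g \<cdot> p = w \<cdot> c2"
      using locally_liftsE[OF _ g(1) w(1)] by blast
    have p0: "h0 \<cdot> p = x1 \<cdot> c2" and p1: "f \<cdot> (h1 \<cdot> p) = y \<cdot> (c1 \<cdot> c2)"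
      using ag[OF c2(3)] c1 c2 w(1) pb y
      by (simp_all add: in_Hom comp_reduce[OF w(2)] comp_reduce[OF w(3)])
    define c where "c = c1 \<cdot> c2"
    define t where "t = h1 \<cdot> p"
    have c: "c \<in> Hom C W2 W" "regular_epi C c" and t: "t \<in> Hom C W2 X"
      using c1 c2 kp regular_epi_comp[OF c2(2,1) c1(2,1)] by (simp_all add: c_def t_def in_Hom)
    have ut: "Unit R X \<cdot> t = x \<cdot> c" and ft: "f \<cdot> t = y \<cdot> c"
      using p0 p1 c1 c2 kp(2,3) uX x
      by (simp_all add: c_def t_def in_Hom comp_reduce[OF kp(4)[symmetric]] comp_reduce[OF c1(4)])
    obtain r where r: "r \<in> Hom C W X" "r \<cdot> c = t"
    proof (rule regular_epi_descend[OF c(2,1) t])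
      fix U u v assume uv: "u \<in> Hom C U W2" "v \<in> Hom C U W2" "c \<cdot> u = c \<cdot> v"
      show "t \<cdot> u = t \<cdot> v"
        by (rule jm[of _ U])
          (use uv t c x y f uX in \<open>simp_all add: in_Hom comp_reduce[OF ut] comp_reduce[OF ft]\<close>)
    qed blast
    have "Unit R X \<cdot> r = x"
      by (rule regular_epi_epi[OF c(2,1)]) (use r x uX ut c in \<open>simp_all add: in_Hom\<close>)
    moreover have "f \<cdot> r = y"
      by (rule regular_epi_epi[OF c(2,1)]) (use r y f ft c in \<open>simp_all add: in_Hom\<close>)
    ultimately show "\<exists>!t. t \<in> Hom C W (Dom C (Unit R X)) \<and> Unit R X \<cdot> t = x \<and> f \<cdot> t = y"
      using r(1) ob jm by (intro ex1I[of _ r]) auto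
  qed (use f Rf uX uY nat in \<open>simp_all add: in_Hom\<close>)
  then show ?thesis unfolding trivial_extension_def using f by (simp add: in_Hom)
qed

text \<open>Centrality in terms of elements: the two projections of the kernel pair of \<open>g\<close> agree on the
  commutator of the kernel pair. Quantifying over all pairs of elements that \<open>g\<close> identifies spares
  the choice of a kernel pair.\<close>

definition identifies_comm where
  "identifies_comm g \<longleftrightarrow> (\<forall>V W x0 x1 z. x0 \<in> Hom C V (Dom C g) \<longrightarrow> x1 \<in> Hom C V (Dom C g) \<longrightarrow>
     g \<cdot> x0 = g \<cdot> x1 \<longrightarrow> z \<in> Hom C W V \<longrightarrow> in_comm z \<longrightarrow> x0 \<cdot> z = x1 \<cdot> z)"

lemma identifies_commD:
  assumes ic: "identifies_comm g" and g: "g \<in> Hom C X Y"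
    and "x0 \<in> Hom C V X" "x1 \<in> Hom C V X" "g \<cdot> x0 = g \<cdot> x1" "z \<in> Hom C W V" "in_comm z"
  shows "x0 \<cdot> z = x1 \<cdot> z"
proof -
  have "Dom C g = X" using g by (simp add: in_Hom)
  then show ?thesis using ic[unfolded identifies_comm_def, rule_format, of x0 V x1 z W] assms(3-7)
    by simp
qed

text \<open>If the pullback \<open>q\<close> of \<open>g\<close> along a cover is trivial, then \<open>q\<close> is injective on commutators,
  which settles the matter for elements of the pullback; all elements of a commutator lift to such.\<close>

lemma central_identifies_comm:
  assumes "central_extension C R g"
  shows "identifies_comm g"
proof -
  define X Y where "X = Dom C g" and "Y = Cod C g"
  obtain h p q where h: "regular_epi C h" and pb: "is_pullback C g h p q"
    and tr: "trivial_extension C R q" and "regular_epi C g"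
    using assms unfolding central_extension_def by blast
  then have g: "g \<in> Hom C X Y" using regular_epi_arr by (simp add: in_Hom X_def Y_def)
  define E P where "E = Dom C h" and "P = Dom C p"
  have hE: "h \<in> Hom C E Y"
    using pb regular_epi_arr[OF h] unfolding is_pullback_def by (simp add: in_Hom E_def Y_def)
  have pq: "p \<in> Hom C P X" "q \<in> Hom C P E" "g \<cdot> p = h \<cdot> q"
    using pullback_typing[OF pb g hE] by (simp_all add: P_def)
  have "x0 \<cdot> z = x1 \<cdot> z"
    if x: "x0 \<in> Hom C V X" "x1 \<in> Hom C V X" "g \<cdot> x0 = g \<cdot> x1" and z: "z \<in> Hom C W V" "in_comm z"
    for V W x0 x1 z
  proof -
    have gx: "g \<cdot> x0 \<in> Hom C V Y" using x g by (simp add: in_Hom)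
    obtain U e v where pb': "is_pullback C h (g \<cdot> x0) e v" "e \<in> Hom C U E" "v \<in> Hom C U V"
      "h \<cdot> e = (g \<cdot> x0) \<cdot> v"
      using pullback_exists[OF hE gx] by metis
    have v: "regular_epi C v" by (rule regular_epi_pullback_stable[OF pb'(1) h])
    have lift: "\<exists>y. y \<in> Hom C U P \<and> p \<cdot> y = x \<cdot> v \<and> q \<cdot> y = e"
      if "x \<in> Hom C V X" "g \<cdot> x = g \<cdot> x0" for x
    proof -
      have "x \<cdot> v \<in> Hom C U X" using that pb' by (simp add: in_Hom)
      moreover have "g \<cdot> (x \<cdot> v) = h \<cdot> e"
        using that pb' g x by (simp add: in_Hom comp_reduce[OF that(2)])
      ultimately show ?thesis using pullback_lift[OF pb g hE _ pb'(2)] P_def by metis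
    qed
    obtain y0 where y0: "y0 \<in> Hom C U P" "p \<cdot> y0 = x0 \<cdot> v" "q \<cdot> y0 = e" using lift x by blast
    obtain y1 where y1: "y1 \<in> Hom C U P" "p \<cdot> y1 = x1 \<cdot> v" "q \<cdot> y1 = e"
      using lift[OF x(2)] x(3) by auto
    obtain T c w where c: "c \<in> Hom C T W" "regular_epi C c" "w \<in> Hom C T U" "in_comm w"
      "v \<cdot> w = z \<cdot> c"
      using in_comm_lift[OF v pb'(3) z] .
    have "y0 \<cdot> w = y1 \<cdot> w"
    proof (rule trivial_extension_unique[OF tr pq(2)])
      show "in_comm (y0 \<cdot> w)" "in_comm (y1 \<cdot> w)" using in_comm_postcomp[OF c(3,4)] y0 y1 by auto
      show "q \<cdot> (y0 \<cdot> w) = q \<cdot> (y1 \<cdot> w)"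
        using y0 y1 c pq
        by (simp add: in_Hom comp_reduce[OF y0(3)] comp_reduce[OF y1(3)])
    qed (use y0 y1 c in \<open>simp_all add: in_Hom\<close>)
    then have "p \<cdot> (y0 \<cdot> w) = p \<cdot> (y1 \<cdot> w)" by simp
    then have "x0 \<cdot> (v \<cdot> w) = x1 \<cdot> (v \<cdot> w)"
      using y0 y1 c pq pb' x
      by (simp add: in_Hom comp_reduce[OF y0(2)] comp_reduce[OF y1(2)])
    then have eq: "(x0 \<cdot> z) \<cdot> c = (x1 \<cdot> z) \<cdot> c" unfolding c(5) using x z c by (simp add: in_Hom)
    show ?thesis
      by (rule regular_epi_epi[OF c(2,1) _ _ eq, of X]) (use x z in \<open>simp_all add: in_Hom\<close>)
  qed
  then show ?thesis unfolding identifies_comm_def X_def by blast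
qed

lemma identifies_comm_central:
  assumes g: "regular_epi C g" "g \<in> Hom C X Y" and ic: "identifies_comm g"
  shows "central_extension C R g"
proof -
  obtain P g0 g1 d where kp: "is_kernel_pair C g g0 g1" "g0 \<in> Hom C P X" "g1 \<in> Hom C P X"
    "g \<cdot> g0 = g \<cdot> g1" "d \<in> Hom C X P" "g0 \<cdot> d = Id C X" "g1 \<cdot> d = Id C X" "Dom C g0 = P"
    using kernel_pair_exists[OF g(2)] .
  have X: "X \<in> Obj C" using Hom_Obj[OF g(2)] by blast
  have "trivial_extension C R g1"
  proof (rule trivial_extensionI[OF split_epi_regular[OF kp(3,5,7)] kp(3)])
    fix W z assume z: "z \<in> Hom C W P" "in_comm z" "g1 \<cdot> z = zmap W X"
    have W: "W \<in> Obj C" "P \<in> Obj C" using Hom_Obj[OF z(1)] by auto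
    have g0z: "g0 \<cdot> z = zmap W X" using identifies_commD[OF ic g(2) kp(2-4) z(1,2)] z(3) by simp
    show "z = zmap W P"
      by (rule pullback_unique[OF kp(1), of _ W]) (use g0z z W kp X in \<open>simp_all add: in_Hom\<close>)
  qed
  then show ?thesis unfolding central_extension_def using g(1) kp(1) by blast
qed

end

section \<open>The relative commutator and the quotients by it\<close>

context semi_abelian_birkhoff
begin

lemma comm_incl_kernel:
  assumes "X \<in> Obj C"
  shows "is_kernel C (comm_incl C R X) (Unit R X)"
proof -
  obtain K k where "is_kernel C k (Unit R X)" using kernel_exists[OF Unit_Hom[OF assms]] by metis
  then show ?thesis unfolding comm_incl_def by (rule someI)
qed

lemma comm_incl_typing:
  assumes X: "X \<in> Obj C"
  shows "comm_incl C R X \<in> Hom C (comm_obj C R X) X" "is_mono C (comm_incl C R X)"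
    "in_comm (comm_incl C R X)"
proof -
  note k = comm_incl_kernel[OF X] Unit_Hom[OF X]
  show "comm_incl C R X \<in> Hom C (comm_obj C R X) X" "is_mono C (comm_incl C R X)"
    using kernel_typing(1)[OF k] kernel_mono[OF k] unfolding comm_obj_def by auto
  show "in_comm (comm_incl C R X)"
    by (rule in_commI[OF kernel_typing[OF k]])
qed

lemma in_comm_factor:
  assumes x: "x \<in> Hom C W X" "in_comm x"
  obtains t where "t \<in> Hom C W (comm_obj C R X)" "comm_incl C R X \<cdot> t = x"
proof -
  have X: "X \<in> Obj C" using Hom_Obj[OF x(1)] by blast
  show ?thesis
    by (rule kernel_lift[OF comm_incl_kernel[OF X] Unit_Hom[OF X] x(1) in_commD[OF x]])
      (rule that, simp_all add: comm_obj_def)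
qed

lemma comm_map:
  assumes g: "g \<in> Hom C X Y"
  shows "comm_map C R g \<in> Hom C (comm_obj C R X) (comm_obj C R Y)"
    "comm_incl C R Y \<cdot> comm_map C R g = g \<cdot> comm_incl C R X"
proof -
  have ob: "X \<in> Obj C" "Y \<in> Obj C" using Hom_Obj[OF g] by auto
  note i = comm_incl_typing[OF ob(1)] and j = comm_incl_typing[OF ob(2)]
  have gi: "g \<cdot> comm_incl C R X \<in> Hom C (comm_obj C R X) Y" using g i by (simp add: in_Hom)
  obtain t where t: "t \<in> Hom C (comm_obj C R X) (comm_obj C R Y)"
    "comm_incl C R Y \<cdot> t = g \<cdot> comm_incl C R X"
    by (rule in_comm_factor[OF gi in_comm_postcomp[OF i(1,3) g]])
  have DC: "Dom C g = X" "Cod C g = Y" using g by (simp_all add: in_Hom)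
  have "\<exists>!h. h \<in> Hom C (comm_obj C R X) (comm_obj C R Y) \<and>
      comm_incl C R Y \<cdot> h = g \<cdot> comm_incl C R X"
  proof (rule ex1I[of _ t])
    fix h assume h: "h \<in> Hom C (comm_obj C R X) (comm_obj C R Y) \<and>
      comm_incl C R Y \<cdot> h = g \<cdot> comm_incl C R X"
    show "h = t" by (rule monoD[OF j(2,1), of _ "comm_obj C R X"]) (use h t in simp_all)
  qed (use t in simp)
  from theI'[OF this] show "comm_map C R g \<in> Hom C (comm_obj C R X) (comm_obj C R Y)"
    "comm_incl C R Y \<cdot> comm_map C R g = g \<cdot> comm_incl C R X"
    unfolding comm_map_def DC by auto
qed

text \<open>Membership of \<open>x\<close> in \<open>[K, X]\<close>, for \<open>K\<close> the kernel of \<open>f: X \<rightarrow> Y\<close>: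
  the pair \<open>(0, x)\<close> lies in the commutator of the kernel pair of \<open>f\<close>. As for centrality, all pairs
  of elements that \<open>f\<close> identifies are admitted in place of a chosen kernel pair.\<close>

definition in_rel_comm where
  "in_rel_comm f x \<longleftrightarrow> (\<exists>V x0 x1 z. x0 \<in> Hom C V (Dom C f) \<and> x1 \<in> Hom C V (Dom C f) \<and>
     f \<cdot> x0 = f \<cdot> x1 \<and> z \<in> Hom C (Dom C x) V \<and> in_comm z \<and>
     x0 \<cdot> z = zmap (Dom C x) (Dom C f) \<and> x1 \<cdot> z = x)"

lemma in_rel_commI:
  "\<lbrakk>f \<in> Hom C X Y; x0 \<in> Hom C V X; x1 \<in> Hom C V X; f \<cdot> x0 = f \<cdot> x1; z \<in> Hom C W V; in_comm z;
    x0 \<cdot> z = zmap W X\<rbrakk> \<Longrightarrow> in_rel_comm f (x1 \<cdot> z)"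
  unfolding in_rel_comm_def
  by (rule exI[of _ V], rule exI[of _ x0], rule exI[of _ x1], rule exI[of _ z]) (simp add: in_Hom)

lemma in_rel_commE:
  assumes "in_rel_comm f x" "f \<in> Hom C X Y" "x \<in> Hom C W X"
  obtains V x0 x1 z where "x0 \<in> Hom C V X" "x1 \<in> Hom C V X" "f \<cdot> x0 = f \<cdot> x1" "z \<in> Hom C W V"
    "in_comm z" "x0 \<cdot> z = zmap W X" "x1 \<cdot> z = x"
proof -
  have "Dom C f = X" "Dom C x = W" using assms by (simp_all add: in_Hom)
  then show ?thesis using assms(1) that unfolding in_rel_comm_def by metis
qed

lemma in_rel_comm_kernel:
  assumes rc: "in_rel_comm f x" and f: "f \<in> Hom C X Y" and x: "x \<in> Hom C W X"
  shows "f \<cdot> x = zmap W Y"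
proof -
  obtain V x0 x1 z where w: "x0 \<in> Hom C V X" "x1 \<in> Hom C V X" "f \<cdot> x0 = f \<cdot> x1" "z \<in> Hom C W V"
    "in_comm z" "x0 \<cdot> z = zmap W X" "x1 \<cdot> z = x"
    by (rule in_rel_commE[OF assms])
  have "f \<cdot> (x1 \<cdot> z) = f \<cdot> (x0 \<cdot> z)"
    using w(1,2,4) f by (simp add: in_Hom comp_reduce[OF w(3)])
  then show ?thesis unfolding w(6,7) using f Hom_Obj[OF x] by (simp add: in_Hom)
qed

text \<open>What \<open>[K, X]\<close> has to do with central extensions: a morphism \<open>h\<close> over \<open>Y\<close> takes a pair \<open>(0, x)\<close>
  in the commutator of the kernel pair of \<open>f\<close> to such a pair \<open>(0, h x)\<close> for \<open>g\<close>, and the two entries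
  of the latter are equal.\<close>

lemma in_rel_comm_vanishes:
  assumes rc: "in_rel_comm f x" and f: "f \<in> Hom C X Y" and x: "x \<in> Hom C W X"
    and g: "identifies_comm g" "g \<in> Hom C Z Y" and h: "h \<in> Hom C X Z" "g \<cdot> h = f"
  shows "h \<cdot> x = zmap W Z"
proof -
  obtain V x0 x1 z where w: "x0 \<in> Hom C V X" "x1 \<in> Hom C V X" "f \<cdot> x0 = f \<cdot> x1" "z \<in> Hom C W V"
    "in_comm z" "x0 \<cdot> z = zmap W X" "x1 \<cdot> z = x"
    by (rule in_rel_commE[OF rc f x])
  have ty: "h \<cdot> x0 \<in> Hom C V Z" "h \<cdot> x1 \<in> Hom C V Z" using h w by (simp_all add: in_Hom)
  have "g \<cdot> (h \<cdot> x0) = g \<cdot> (h \<cdot> x1)"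
    using w(1,2,3) h(1) g(2) by (simp add: in_Hom comp_reduce[OF h(2)])
  then have "(h \<cdot> x0) \<cdot> z = (h \<cdot> x1) \<cdot> z" by (rule identifies_commD[OF g ty _ w(4,5)])
  then have "h \<cdot> (x0 \<cdot> z) = h \<cdot> (x1 \<cdot> z)" using h(1) w(1,2,4) by (simp add: in_Hom)
  then show ?thesis unfolding w(6,7) using h(1) Hom_Obj[OF x] by (simp add: in_Hom)
qed

lemma relative_commutator_factor:
  assumes n: "relative_commutator C R f n" and f: "f \<in> Hom C X Y"
  shows "n \<in> Hom C (Dom C n) X" "is_mono C n"
    "\<exists>j. j \<in> Hom C (Dom C n) (comm_obj C R X) \<and> comm_incl C R X \<cdot> j = n"
    "x \<in> Hom C W X \<Longrightarrow> in_rel_comm f x \<longleftrightarrow> (\<exists>t. t \<in> Hom C W (Dom C n) \<and> n \<cdot> t = x)"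
proof -
  obtain f0 f1 k where kp: "is_kernel_pair C f f0 f1" and k: "is_kernel C k (comm_map C R f0)"
    and "n = comm_incl C R (Dom C f) \<cdot> (comm_map C R f1 \<cdot> k)"
    using n unfolding relative_commutator_def by blast
  then have n_eq: "n = comm_incl C R X \<cdot> (comm_map C R f1 \<cdot> k)" using f by (simp add: in_Hom)
  define P N where "P = Dom C f0" and "N = Dom C k"
  have f01: "f0 \<in> Hom C P X" "f1 \<in> Hom C P X" "f \<cdot> f0 = f \<cdot> f1"
    using pullback_typing[OF kp f f] by (simp_all add: P_def)
  have ob: "P \<in> Obj C" "X \<in> Obj C" using Hom_Obj[OF f01(1)] by auto
  define m i where "m = comm_incl C R X" and "i = comm_incl C R P"
  note m = comm_incl_typing[OF ob(2), folded m_def] and i = comm_incl_typing[OF ob(1), folded i_def]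
  note M0 = comm_map[OF f01(1), folded m_def i_def] and M1 = comm_map[OF f01(2), folded m_def i_def]
  have kt: "k \<in> Hom C N (comm_obj C R P)" "comm_map C R f0 \<cdot> k = zmap N (comm_obj C R X)"
    using kernel_typing[OF k M0(1)] by (simp_all add: N_def)
  have Nob: "N \<in> Obj C" using Hom_Obj[OF kt(1)] by blast
  have cob: "comm_obj C R X \<in> Obj C" using Hom_Obj[OF m(1)] by blast
  have n_eq': "n = f1 \<cdot> (i \<cdot> k)"
    unfolding n_eq m_def[symmetric]
    using m(1) M1(1) kt(1) i(1) f01(2) by (simp add: in_Hom comp_reduce[OF M1(2)])
  have zero: "f0 \<cdot> (i \<cdot> k) = zmap N X"
  proof -
    have "m \<cdot> (comm_map C R f0 \<cdot> k) = f0 \<cdot> (i \<cdot> k)"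
      using m(1) M0(1) kt(1) i(1) f01(1) by (simp add: in_Hom comp_reduce[OF M0(2)])
    then show ?thesis unfolding kt(2) using m(1) Nob by (simp add: in_Hom)
  qed
  have nt: "n \<in> Hom C N X" unfolding n_eq' using f01(2) i(1) kt(1) by (simp add: in_Hom)
  then have Dn: "Dom C n = N" by (simp add: in_Hom)
  have ik: "i \<cdot> k \<in> Hom C N P" using i(1) kt(1) by (simp add: in_Hom)
  have ik_mono: "is_mono C (i \<cdot> k)"
    by (rule mono_comp[OF kernel_mono[OF k M0(1)] i(2) kt(1) i(1)])
  show "n \<in> Hom C (Dom C n) X" unfolding Dn by (rule nt)
  show "is_mono C n"
  proof (rule monoI[OF nt])
    fix W s t assume st: "s \<in> Hom C W N" "t \<in> Hom C W N" "n \<cdot> s = n \<cdot> t"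
    have "(i \<cdot> k) \<cdot> s = (i \<cdot> k) \<cdot> t"
    proof (rule pullback_unique[OF kp, folded P_def])
      have "n \<cdot> s = f1 \<cdot> ((i \<cdot> k) \<cdot> s)" "n \<cdot> t = f1 \<cdot> ((i \<cdot> k) \<cdot> t)"
        unfolding n_eq' using f01(2) i(1) kt(1) st(1,2) by (simp_all add: in_Hom)
      then show "f1 \<cdot> ((i \<cdot> k) \<cdot> s) = f1 \<cdot> ((i \<cdot> k) \<cdot> t)" using st(3) by simp
      have "(f0 \<cdot> (i \<cdot> k)) \<cdot> s = (f0 \<cdot> (i \<cdot> k)) \<cdot> t"
        unfolding zero using st(1,2) ob by (simp add: in_Hom)
      then show "f0 \<cdot> ((i \<cdot> k) \<cdot> s) = f0 \<cdot> ((i \<cdot> k) \<cdot> t)"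
        using f01(1) i(1) kt(1) st(1,2) by (simp add: in_Hom)
    qed (use ik st(1,2) in \<open>simp_all add: in_Hom\<close>)
    then show "s = t" by (rule monoD[OF ik_mono ik st(1,2)])
  qed
  show "\<exists>j. j \<in> Hom C (Dom C n) (comm_obj C R X) \<and> comm_incl C R X \<cdot> j = n"
    using M1(1) kt(1) by (intro exI[of _ "comm_map C R f1 \<cdot> k"]) (simp add: Dn n_eq[symmetric] in_Hom)
  assume x: "x \<in> Hom C W X"
  have W: "W \<in> Obj C" using Hom_Obj[OF x] by blast
  show "in_rel_comm f x \<longleftrightarrow> (\<exists>t. t \<in> Hom C W (Dom C n) \<and> n \<cdot> t = x)"
  proof
    assume "in_rel_comm f x"
    then obtain V x0 x1 z where w: "x0 \<in> Hom C V X" "x1 \<in> Hom C V X" "f \<cdot> x0 = f \<cdot> x1"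
      "z \<in> Hom C W V" "in_comm z" "x0 \<cdot> z = zmap W X" "x1 \<cdot> z = x"
      by (rule in_rel_commE[OF _ f x])
    obtain t where t: "t \<in> Hom C V P" "f0 \<cdot> t = x0" "f1 \<cdot> t = x1"
      using pullback_lift[OF kp f f w(1-3)] P_def by blast
    have tz: "t \<cdot> z \<in> Hom C W P" using t w by (simp add: in_Hom)
    obtain z' where z': "z' \<in> Hom C W (comm_obj C R P)" "i \<cdot> z' = t \<cdot> z"
      using in_comm_factor[OF tz in_comm_postcomp[OF w(4,5) t(1)]] unfolding i_def by blast
    have f0z: "f0 \<cdot> (t \<cdot> z) = zmap W X" and f1z: "f1 \<cdot> (t \<cdot> z) = x"
      using t(1) w(4,6,7) f01 by (simp_all add: in_Hom comp_reduce[OF t(2)] comp_reduce[OF t(3)])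
    have "comm_map C R f0 \<cdot> z' = zmap W (comm_obj C R X)"
    proof (rule monoD[OF m(2,1), of _ W])
      have "m \<cdot> (comm_map C R f0 \<cdot> z') = f0 \<cdot> (i \<cdot> z')"
        using m(1) M0(1) z'(1) i(1) f01(1) by (simp add: in_Hom comp_reduce[OF M0(2)])
      then show "m \<cdot> (comm_map C R f0 \<cdot> z') = m \<cdot> zmap W (comm_obj C R X)"
        unfolding z'(2) f0z using m(1) W by (simp add: in_Hom)
    qed (use M0(1) z'(1) W cob in \<open>simp_all add: in_Hom\<close>)
    then obtain s where s: "s \<in> Hom C W N" "k \<cdot> s = z'"
      using kernel_lift[OF k M0(1) z'(1)] unfolding N_def by blast
    have "n \<cdot> s = f1 \<cdot> (i \<cdot> (k \<cdot> s))" unfolding n_eq'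
      using f01(2) i(1) kt(1) s(1) by (simp add: in_Hom)
    then have "n \<cdot> s = x" unfolding s(2) z'(2) f1z .
    then show "\<exists>t. t \<in> Hom C W (Dom C n) \<and> n \<cdot> t = x" using s(1) Dn by blast
  next
    assume "\<exists>t. t \<in> Hom C W (Dom C n) \<and> n \<cdot> t = x"
    then obtain t where t: "t \<in> Hom C W N" "n \<cdot> t = x" using Dn by blast
    have kt': "k \<cdot> t \<in> Hom C W (comm_obj C R P)" using kt(1) t(1) by (simp add: in_Hom)
    have z: "i \<cdot> (k \<cdot> t) \<in> Hom C W P" using i(1) kt' by (simp add: in_Hom)
    have "(f0 \<cdot> (i \<cdot> k)) \<cdot> t = zmap W X" unfolding zero using t(1) ob by (simp add: in_Hom)
    then have "f0 \<cdot> (i \<cdot> (k \<cdot> t)) = zmap W X" using f01(1) i(1) kt(1) t(1) by (simp add: in_Hom)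
    then have "in_rel_comm f (f1 \<cdot> (i \<cdot> (k \<cdot> t)))"
      by (rule in_rel_commI[OF f f01 z in_comm_precomp[OF i(1,3) kt']])
    moreover have "f1 \<cdot> (i \<cdot> (k \<cdot> t)) = n \<cdot> t"
      unfolding n_eq' using f01(2) i(1) kt(1) t(1) by (simp add: in_Hom)
    ultimately show "in_rel_comm f x" using t(2) by simp
  qed
qed

lemma relative_commutator_self:
  assumes n: "relative_commutator C R f n" and f: "f \<in> Hom C X Y"
  shows "in_rel_comm f n"
proof -
  note nf = relative_commutator_factor[OF n f]
  have "Id C (Dom C n) \<in> Hom C (Dom C n) (Dom C n)" "n \<cdot> Id C (Dom C n) = n"
    using nf(1) Hom_Obj[OF nf(1)] by (simp_all add: in_Hom)
  then show ?thesis using nf(4)[OF nf(1)] by blast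
qed

lemma relative_commutator_exists:
  assumes f: "f \<in> Hom C X Y"
  obtains n where "relative_commutator C R f n"
proof -
  obtain P f0 f1 d where kp: "is_kernel_pair C f f0 f1" "f0 \<in> Hom C P X"
    using kernel_pair_exists[OF f] by metis
  obtain k where "is_kernel C k (comm_map C R f0)"
    using kernel_exists[OF comm_map(1)[OF kp(2)]] by metis
  then show ?thesis using that kp(1) unfolding relative_commutator_def by blast
qed

text \<open>Normality of \<open>[K, X]\<close> in \<open>X\<close>: this subobject is the image, along the second projection \<open>f1\<close> of
  the kernel pair, of the elements of the commutator that the first projection kills, and these form
  the kernel of the arrow with components \<open>f0\<close> and the unit.\<close>

lemma relative_commutator_quotient:
  assumes f: "f \<in> Hom C X Y"
  obtains D p where "regular_epi C p" "p \<in> Hom C X D"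
    "\<And>W x. x \<in> Hom C W X \<Longrightarrow> p \<cdot> x = zmap W D \<longleftrightarrow> in_rel_comm f x"
proof -
  obtain P f0 f1 d where kp: "is_kernel_pair C f f0 f1" "f0 \<in> Hom C P X" "f1 \<in> Hom C P X"
    "f \<cdot> f0 = f \<cdot> f1" "d \<in> Hom C X P" "f0 \<cdot> d = Id C X" "f1 \<cdot> d = Id C X" "Dom C f0 = P"
    using kernel_pair_exists[OF f] .
  have ob: "X \<in> Obj C" "P \<in> Obj C" using Hom_Obj[OF kp(2)] by auto
  then have RP: "Robj R P \<in> Obj C" by simp
  note u = Unit_Hom[OF ob(2)]
  obtain E a b where E: "a \<in> Hom C E X" "b \<in> Hom C E (Robj R P)"
    and pair: "\<And>W x y. \<lbrakk>x \<in> Hom C W X; y \<in> Hom C W (Robj R P)\<rbrakk> \<Longrightarrow>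
      \<exists>t. t \<in> Hom C W E \<and> a \<cdot> t = x \<and> b \<cdot> t = y"
    and uniq: "\<And>W s t. \<lbrakk>s \<in> Hom C W E; t \<in> Hom C W E; a \<cdot> s = a \<cdot> t; b \<cdot> s = b \<cdot> t\<rbrakk> \<Longrightarrow> s = t"
    by (rule product_exists[OF ob(1) RP]) blast
  obtain e where e: "e \<in> Hom C P E" "a \<cdot> e = f0" "b \<cdot> e = Unit R P" using pair[OF kp(2) u] by blast
  have e_zero: "e \<cdot> z = zmap W E \<longleftrightarrow> f0 \<cdot> z = zmap W X \<and> in_comm z" if z: "z \<in> Hom C W P" for z W
  proof
    assume ez: "e \<cdot> z = zmap W E"
    have W: "W \<in> Obj C" using Hom_Obj[OF z] by blast
    have "a \<cdot> (e \<cdot> z) = f0 \<cdot> z" "b \<cdot> (e \<cdot> z) = Unit R P \<cdot> z"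
      using e(1) E z u kp(2) by (simp_all add: in_Hom comp_reduce[OF e(2)] comp_reduce[OF e(3)])
    then have "f0 \<cdot> z = zmap W X" "Unit R P \<cdot> z = zmap W (Robj R P)"
      unfolding ez using E W by (simp_all add: in_Hom)
    then show "f0 \<cdot> z = zmap W X \<and> in_comm z" using in_commI[OF z] by blast
  next
    assume fz: "f0 \<cdot> z = zmap W X \<and> in_comm z"
    have W: "W \<in> Obj C" "E \<in> Obj C" using Hom_Obj[OF z] Hom_Obj[OF e(1)] by auto
    have uz: "Unit R P \<cdot> z = zmap W (Robj R P)" using in_commD[OF z] fz by blast
    show "e \<cdot> z = zmap W E"
      by (rule uniq[of _ W])
        (use e(1) E z u kp(2) W fz uz in
          \<open>simp_all add: in_Hom comp_reduce[OF e(2)] comp_reduce[OF e(3)]\<close>)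
  qed
  obtain D p where p: "regular_epi C p" "p \<in> Hom C X D"
    and p_zero: "\<And>W x. \<lbrakk>x \<in> Hom C W P; e \<cdot> x = zmap W E\<rbrakk> \<Longrightarrow> p \<cdot> (f1 \<cdot> x) = zmap W D"
    and p_lift: "\<And>W a. \<lbrakk>a \<in> Hom C W X; p \<cdot> a = zmap W D\<rbrakk> \<Longrightarrow>
       \<exists>V c x. c \<in> Hom C V W \<and> regular_epi C c \<and> x \<in> Hom C V P \<and> e \<cdot> x = zmap V E \<and> f1 \<cdot> x = a \<cdot> c"
    by (rule direct_image_of_kernel[OF split_epi_regular[OF kp(3,5,7)] kp(3) e(1)]) blast
  show ?thesis
  proof (rule that[OF p])
    fix W x assume x: "x \<in> Hom C W X"
    show "p \<cdot> x = zmap W D \<longleftrightarrow> in_rel_comm f x"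
    proof
      assume "p \<cdot> x = zmap W D"
      then obtain V c z where c: "c \<in> Hom C V W" "regular_epi C c" "z \<in> Hom C V P"
        "e \<cdot> z = zmap V E" "f1 \<cdot> z = x \<cdot> c"
        using p_lift[OF x] by blast
      have fz: "f0 \<cdot> z = zmap V X" "in_comm z" using e_zero[OF c(3)] c(4) by auto
      have xc: "x \<cdot> c \<in> Hom C V X" using x c by (simp add: in_Hom)
      have rc: "in_rel_comm f (x \<cdot> c)"
        using in_rel_commI[OF f kp(2-4) c(3) fz(2,1)] unfolding c(5) .
      obtain n where n: "relative_commutator C R f n" using relative_commutator_exists[OF f] .
      note nf = relative_commutator_factor[OF n f]
      obtain t where "t \<in> Hom C V (Dom C n)" "n \<cdot> t = x \<cdot> c" using nf(4)[OF xc] rc by blast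
      then obtain t' where "t' \<in> Hom C W (Dom C n)" "n \<cdot> t' = x"
        by (rule mono_factor_descend[OF c(2,1) nf(2,1) x])
      then show "in_rel_comm f x" using nf(4)[OF x] by blast
    next
      assume "in_rel_comm f x"
      then obtain V x0 x1 z where w: "x0 \<in> Hom C V X" "x1 \<in> Hom C V X" "f \<cdot> x0 = f \<cdot> x1"
        "z \<in> Hom C W V" "in_comm z" "x0 \<cdot> z = zmap W X" "x1 \<cdot> z = x"
        by (rule in_rel_commE[OF _ f x])
      obtain t where t: "t \<in> Hom C V P" "f0 \<cdot> t = x0" "f1 \<cdot> t = x1"
        using pullback_lift[OF kp(1) f f w(1-3)] kp(8) by blast
      have tz: "t \<cdot> z \<in> Hom C W P" using t w by (simp add: in_Hom)
      have f0z: "f0 \<cdot> (t \<cdot> z) = zmap W X" and f1z: "f1 \<cdot> (t \<cdot> z) = x"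
        using t(1) w(4,6,7) kp(2,3)
        by (simp_all add: in_Hom comp_reduce[OF t(2)] comp_reduce[OF t(3)])
      have "e \<cdot> (t \<cdot> z) = zmap W E"
        using e_zero[OF tz] f0z in_comm_postcomp[OF w(4,5) t(1)] by blast
      from p_zero[OF tz this] show "p \<cdot> x = zmap W D" unfolding f1z .
    qed
  qed
qed

text \<open>After division by \<open>[K, X]\<close>, the two projections of the kernel pair of \<open>f\<close> are equal on its
  commutator: this is clear on the diagonal,
  and on the kernel of the first projection it holds by the definition of \<open>[K, X]\<close>.\<close>

lemma centralization:
  assumes f: "regular_epi C f" "f \<in> Hom C X Y"
  obtains D p d where "regular_epi C p" "p \<in> Hom C X D" "d \<in> Hom C D Y" "d \<cdot> p = f"
    "\<And>W x. x \<in> Hom C W X \<Longrightarrow> p \<cdot> x = zmap W D \<longleftrightarrow> in_rel_comm f x" "identifies_comm d"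
proof -
  obtain D p where p: "regular_epi C p" "p \<in> Hom C X D"
    and p_zero: "\<And>W x. x \<in> Hom C W X \<Longrightarrow> p \<cdot> x = zmap W D \<longleftrightarrow> in_rel_comm f x"
    by (rule relative_commutator_quotient[OF f(2)]) blast
  obtain d where d: "d \<in> Hom C D Y" "d \<cdot> p = f"
  proof (rule regular_epi_factor[OF p f(2)])
    fix W z assume z: "z \<in> Hom C W X" "p \<cdot> z = zmap W D"
    then have "in_rel_comm f z" using p_zero by blast
    then show "f \<cdot> z = zmap W Y" by (rule in_rel_comm_kernel[OF _ f(2) z(1)])
  qed
  obtain P f0 f1 s where kp: "is_kernel_pair C f f0 f1" "f0 \<in> Hom C P X" "f1 \<in> Hom C P X"
    "f \<cdot> f0 = f \<cdot> f1" "s \<in> Hom C X P" "f0 \<cdot> s = Id C X" "f1 \<cdot> s = Id C X" "Dom C f0 = P"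
    using kernel_pair_exists[OF f(2)] .
  have ob: "X \<in> Obj C" "P \<in> Obj C" "D \<in> Obj C" using Hom_Obj[OF kp(2)] Hom_Obj[OF p(2)] by auto
  define m i where "m = comm_incl C R X" and "i = comm_incl C R P"
  note m = comm_incl_typing[OF ob(1), folded m_def] and i = comm_incl_typing[OF ob(2), folded i_def]
  note M0 = comm_map[OF kp(2), folded m_def i_def] and Ms = comm_map[OF kp(5), folded m_def i_def]
  have ty: "p \<cdot> (f0 \<cdot> i) \<in> Hom C (comm_obj C R P) D" "p \<cdot> (f1 \<cdot> i) \<in> Hom C (comm_obj C R P) D"
    using p(2) kp(2,3) i(1) by (simp_all add: in_Hom)
  have sec: "comm_map C R f0 \<cdot> comm_map C R s = Id C (comm_obj C R X)"
  proof (rule monoD[OF m(2,1), of _ "comm_obj C R X"])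
    show "m \<cdot> (comm_map C R f0 \<cdot> comm_map C R s) = m \<cdot> Id C (comm_obj C R X)"
      using m(1) i(1) M0(1) Ms kp(2,5)
      by (simp add: in_Hom comp_reduce[OF M0(2)] comp_reduce[OF kp(6)])
  qed (use M0(1) Ms(1) Hom_Obj[OF m(1)] in \<open>simp_all add: in_Hom\<close>)
  have eq: "p \<cdot> (f0 \<cdot> i) = p \<cdot> (f1 \<cdot> i)"
  proof (rule split_epi_jointly_epic[OF M0(1) Ms(1) sec ty])
    fix W z assume z: "z \<in> Hom C W (comm_obj C R P)"
      "comm_map C R f0 \<cdot> z = zmap W (comm_obj C R X)"
    have W: "W \<in> Obj C" using Hom_Obj[OF z(1)] by blast
    have iz: "i \<cdot> z \<in> Hom C W P" and f1z: "f1 \<cdot> (i \<cdot> z) \<in> Hom C W X"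
      using i(1) z(1) kp(3) by (simp_all add: in_Hom)
    have "m \<cdot> (comm_map C R f0 \<cdot> z) = f0 \<cdot> (i \<cdot> z)"
      using m(1) M0(1) z(1) i(1) kp(2) by (simp add: in_Hom comp_reduce[OF M0(2)])
    then have f0z: "f0 \<cdot> (i \<cdot> z) = zmap W X" unfolding z(2) using m(1) W by (simp add: in_Hom)
    have "in_rel_comm f (f1 \<cdot> (i \<cdot> z))"
      by (rule in_rel_commI[OF f(2) kp(2-4) iz in_comm_precomp[OF i(1,3) z(1)] f0z])
    then have "p \<cdot> (f1 \<cdot> (i \<cdot> z)) = zmap W D" using p_zero[OF f1z] by blast
    moreover have "p \<cdot> (f0 \<cdot> (i \<cdot> z)) = zmap W D" unfolding f0z using p(2) W by (simp add: in_Hom)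
    ultimately show "(p \<cdot> (f0 \<cdot> i)) \<cdot> z = (p \<cdot> (f1 \<cdot> i)) \<cdot> z"
      using p(2) kp(2,3) i(1) z(1) by (simp add: in_Hom)
  next
    have "f0 \<cdot> (i \<cdot> comm_map C R s) = m" "f1 \<cdot> (i \<cdot> comm_map C R s) = m"
      unfolding Ms(2) using kp(2,3,5) m(1)
      by (simp_all add: in_Hom comp_reduce[OF kp(6)] comp_reduce[OF kp(7)])
    then show "(p \<cdot> (f0 \<cdot> i)) \<cdot> comm_map C R s = (p \<cdot> (f1 \<cdot> i)) \<cdot> comm_map C R s"
      using p(2) kp(2,3) i(1) Ms(1) by (simp add: in_Hom)
  qed
  have on_comm: "p \<cdot> (f0 \<cdot> w) = p \<cdot> (f1 \<cdot> w)" if w: "w \<in> Hom C W P" "in_comm w" for w W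
  proof -
    obtain w' where w': "w' \<in> Hom C W (comm_obj C R P)" "i \<cdot> w' = w"
      using in_comm_factor[OF w] unfolding i_def by blast
    have "(p \<cdot> (f0 \<cdot> i)) \<cdot> w' = (p \<cdot> (f1 \<cdot> i)) \<cdot> w'" by (simp only: eq)
    then have "p \<cdot> (f0 \<cdot> (i \<cdot> w')) = p \<cdot> (f1 \<cdot> (i \<cdot> w'))"
      using p(2) kp(2,3) i(1) w'(1) by (simp add: in_Hom)
    then show ?thesis unfolding w'(2) .
  qed
  have "x0 \<cdot> z = x1 \<cdot> z"
    if x: "x0 \<in> Hom C V D" "x1 \<in> Hom C V D" "d \<cdot> x0 = d \<cdot> x1" and z: "z \<in> Hom C W V" "in_comm z"
    for V W x0 x1 z
  proof -
    obtain V0 c0 y0 where c0: "c0 \<in> Hom C V0 V" "regular_epi C c0" "y0 \<in> Hom C V0 X" "p \<cdot> y0 = x0 \<cdot> c0"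
      using cover_lift[OF p x(1)] .
    have xc: "x1 \<cdot> c0 \<in> Hom C V0 D" using x c0 by (simp add: in_Hom)
    obtain V1 c1 y1 where c1: "c1 \<in> Hom C V1 V0" "regular_epi C c1" "y1 \<in> Hom C V1 X"
      "p \<cdot> y1 = (x1 \<cdot> c0) \<cdot> c1"
      using cover_lift[OF p xc] .
    have y0: "y0 \<cdot> c1 \<in> Hom C V1 X" using c0 c1 by (simp add: in_Hom)
    have red: "d \<cdot> (p \<cdot> v) = f \<cdot> v" if "v \<in> Hom C V1 X" for v
      using that d(1) p(2) f(2) by (simp add: in_Hom comp_reduce[OF d(2)])
    have py0: "p \<cdot> (y0 \<cdot> c1) = x0 \<cdot> (c0 \<cdot> c1)"
      using p(2) c0(1,3) c1(1) x(1) by (simp add: in_Hom comp_reduce[OF c0(4)])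
    have py1: "p \<cdot> y1 = x1 \<cdot> (c0 \<cdot> c1)"
      unfolding c1(4) using c0(1) c1(1) x(2) by (simp add: in_Hom)
    have "d \<cdot> (x0 \<cdot> (c0 \<cdot> c1)) = d \<cdot> (x1 \<cdot> (c0 \<cdot> c1))"
      using d(1) x(1,2) c0(1) c1(1) by (simp add: in_Hom comp_reduce[OF x(3)])
    then have "f \<cdot> (y0 \<cdot> c1) = f \<cdot> y1" using red[OF y0] red[OF c1(3)] unfolding py0 py1 by simp
    then obtain t where t: "t \<in> Hom C V1 P" "f0 \<cdot> t = y0 \<cdot> c1" "f1 \<cdot> t = y1"
      using pullback_lift[OF kp(1) f(2) f(2) y0 c1(3)] kp(8) by blast
    have c: "c0 \<cdot> c1 \<in> Hom C V1 V" using c0 c1 by (simp add: in_Hom)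
    obtain T c2 w where c2: "c2 \<in> Hom C T W" "regular_epi C c2" "w \<in> Hom C T V1" "in_comm w"
      "(c0 \<cdot> c1) \<cdot> w = z \<cdot> c2"
      using in_comm_lift[OF regular_epi_comp[OF c1(2,1) c0(2,1)] c z] .
    have tw: "t \<cdot> w \<in> Hom C T P" using t c2 by (simp add: in_Hom)
    have "p \<cdot> (f0 \<cdot> (t \<cdot> w)) = p \<cdot> (f1 \<cdot> (t \<cdot> w))"
      by (rule on_comm[OF tw in_comm_postcomp[OF c2(3,4) t(1)]])
    moreover have "p \<cdot> (f0 \<cdot> (t \<cdot> w)) = (p \<cdot> (f0 \<cdot> t)) \<cdot> w" "p \<cdot> (f1 \<cdot> (t \<cdot> w)) = (p \<cdot> (f1 \<cdot> t)) \<cdot> w"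
      using p(2) kp(2,3) t(1) c2(3) by (simp_all add: in_Hom)
    ultimately have "(x0 \<cdot> (c0 \<cdot> c1)) \<cdot> w = (x1 \<cdot> (c0 \<cdot> c1)) \<cdot> w"
      unfolding t(2,3) py0 py1 by simp
    then have "x0 \<cdot> ((c0 \<cdot> c1) \<cdot> w) = x1 \<cdot> ((c0 \<cdot> c1) \<cdot> w)"
      using x(1,2) c0(1) c1(1) c2(3) by (simp add: in_Hom)
    then have eq: "(x0 \<cdot> z) \<cdot> c2 = (x1 \<cdot> z) \<cdot> c2"
      unfolding c2(5) using x(1,2) z(1) c2(1) by (simp add: in_Hom)
    show ?thesis
      by (rule regular_epi_epi[OF c2(2,1) _ _ eq, of D]) (use x z in \<open>simp_all add: in_Hom\<close>)
  qed
  moreover have "Dom C d = D" using d(1) by (simp add: in_Hom)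
  ultimately have "identifies_comm d" unfolding identifies_comm_def by blast
  then show ?thesis using that p d p_zero by blast
qed

end

section \<open>Quotients of subobjects by the relative commutator\<close>

context semi_abelian_birkhoff
begin

text \<open>Factor the composite of \<open>m\<close> with the projection of \<open>X\<close> onto its quotient by \<open>[K, X]\<close>. The
  second factor being monic, the kernel of the first is \<open>[K, X]\<close>.\<close>

lemma subobject_quotient_exists:
  assumes f: "regular_epi C f" "f \<in> Hom C X Y" and n: "relative_commutator C R f n"
    and m: "is_mono C m" "m \<in> Hom C M X" and j: "j \<in> Hom C (Dom C n) M" "m \<cdot> j = n"
  obtains q where "subobject_quotient C m n q"
proof -
  note nf = relative_commutator_factor[OF n f(2)]
  obtain D p where p: "p \<in> Hom C X D"
    and p_zero: "\<And>W x. x \<in> Hom C W X \<Longrightarrow> p \<cdot> x = zmap W D \<longleftrightarrow> in_rel_comm f x"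
    by (rule relative_commutator_quotient[OF f(2)]) blast
  have pm: "p \<cdot> m \<in> Hom C M D" using p m by (simp add: in_Hom)
  obtain Q q i where q: "q \<in> Hom C M Q" "regular_epi C q" "i \<in> Hom C Q D" "is_mono C i"
    "i \<cdot> q = p \<cdot> m"
    using image_factorization[OF pm] .
  have Q: "Q \<in> Obj C" using Hom_Obj[OF q(1)] by blast
  have q_zero: "q \<cdot> x = zmap W Q \<longleftrightarrow> in_rel_comm f (m \<cdot> x)" if x: "x \<in> Hom C W M" for x W
  proof -
    have W: "W \<in> Obj C" using Hom_Obj[OF x] by blast
    have ipm: "i \<cdot> (q \<cdot> x) = p \<cdot> (m \<cdot> x)"
      using q(1,3) p m(2) x by (simp add: in_Hom comp_reduce[OF q(5)])
    have iz: "i \<cdot> zmap W Q = zmap W D" using q(3) W by (simp add: in_Hom)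
    have "q \<cdot> x \<in> Hom C W Q" "zmap W Q \<in> Hom C W Q" using q(1) x W Q by (simp_all add: in_Hom)
    then have "q \<cdot> x = zmap W Q \<longleftrightarrow> i \<cdot> (q \<cdot> x) = i \<cdot> zmap W Q" using monoD[OF q(4,3)] by metis
    also have "\<dots> \<longleftrightarrow> p \<cdot> (m \<cdot> x) = zmap W D" unfolding ipm iz ..
    also have "\<dots> \<longleftrightarrow> in_rel_comm f (m \<cdot> x)" using p_zero[of "m \<cdot> x" W] m(2) x by (simp add: in_Hom)
    finally show ?thesis .
  qed
  have "is_kernel C j q"
  proof (rule kernelI[OF j(1) q(1)])
    show "is_mono C j" using mono_cancel[OF _ j(1) m(2)] nf(2) j(2) by simp
    have "in_rel_comm f n" by (rule relative_commutator_self[OF n f(2)])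
    then show "q \<cdot> j = zmap (Dom C n) Q" using q_zero[OF j(1)] j(2) by simp
    fix W x assume x: "x \<in> Hom C W M" "q \<cdot> x = zmap W Q"
    have mx: "m \<cdot> x \<in> Hom C W X" using m(2) x(1) by (simp add: in_Hom)
    obtain t where t: "t \<in> Hom C W (Dom C n)" "n \<cdot> t = m \<cdot> x"
      using q_zero[OF x(1)] x(2) nf(4)[OF mx] by blast
    have "j \<cdot> t = x"
      by (rule monoD[OF m, of _ W])
        (use t j m(2) x(1) in \<open>simp_all add: in_Hom comp_reduce[OF j(2)]\<close>)
    with t(1) show "\<exists>t. t \<in> Hom C W (Dom C n) \<and> j \<cdot> t = x" by blast
  qed
  then have "is_cokernel C q j" by (rule kernel_cokernel[OF q(2,1)])
  moreover have "j \<in> Hom C (Dom C n) (Dom C m)" using j(1) m(2) by (simp add: in_Hom)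
  ultimately have "subobject_quotient C m n q"
    unfolding subobject_quotient_def using m(1) nf(2) j(2) by blast
  then show ?thesis by (rule that)
qed

lemma subobject_quotient_typing:
  assumes "subobject_quotient C m n q" "m \<in> Hom C M X"
  shows "q \<in> Hom C M (Cod C q)" "regular_epi C q"
proof -
  obtain j where j: "j \<in> Hom C (Dom C n) (Dom C m)" "is_cokernel C q j"
    using assms(1) unfolding subobject_quotient_def by blast
  show "regular_epi C q" by (rule cokernel_regular_epi[OF j(2)])
  have "q \<in> Hom C (Cod C j) (Cod C q)" using j(2) unfolding is_cokernel_def by blast
  then show "q \<in> Hom C M (Cod C q)" using j(1) assms(2) by (simp add: in_Hom)
qed

text \<open>A cokernel of an arbitrary subobject may kill more than the subobject. Here it does not, because
  the quotient of all of \<open>X\<close> by the normal subobject \<open>[K, X]\<close> factors through it on \<open>M\<close>.\<close>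

lemma subobject_quotient_zero:
  assumes f: "f \<in> Hom C X Y" and n: "relative_commutator C R f n"
    and sq: "subobject_quotient C m n q" and m: "m \<in> Hom C M X" and x: "x \<in> Hom C W M"
  shows "q \<cdot> x = zmap W (Cod C q) \<longleftrightarrow> in_rel_comm f (m \<cdot> x)"
proof -
  note nf = relative_commutator_factor[OF n f]
  note q = subobject_quotient_typing[OF sq m]
  obtain j where j0: "j \<in> Hom C (Dom C n) (Dom C m)" "m \<cdot> j = n" "is_cokernel C q j" and mm: "is_mono C m"
    using sq unfolding subobject_quotient_def by blast
  have j: "j \<in> Hom C (Dom C n) M" using j0(1) m by (simp add: in_Hom)
  obtain D p where p: "p \<in> Hom C X D"
    and p_zero: "\<And>W x. x \<in> Hom C W X \<Longrightarrow> p \<cdot> x = zmap W D \<longleftrightarrow> in_rel_comm f x"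
    by (rule relative_commutator_quotient[OF f]) blast
  have W: "W \<in> Obj C" using Hom_Obj[OF x] by blast
  have mx: "m \<cdot> x \<in> Hom C W X" using m x by (simp add: in_Hom)
  have "in_rel_comm f n" by (rule relative_commutator_self[OF n f])
  then have pn: "p \<cdot> n = zmap (Dom C n) D" using p_zero[OF nf(1)] by blast
  have "(p \<cdot> m) \<cdot> j = zmap (Dom C n) D" using p m j pn j0(2) by (simp add: in_Hom)
  moreover have "(p \<cdot> m) \<cdot> j \<in> Hom C (Dom C n) D" and pm: "p \<cdot> m \<in> Hom C (Cod C j) D"
    using p m j by (simp_all add: in_Hom)
  ultimately have "is_zero_arrow C ((p \<cdot> m) \<cdot> j)" using zero_arrow_iff by blast
  then have "\<exists>!t. t \<in> Hom C (Cod C q) D \<and> t \<cdot> q = p \<cdot> m"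
    using j0(3) pm unfolding is_cokernel_def by blast
  then obtain t where t: "t \<in> Hom C (Cod C q) D" "t \<cdot> q = p \<cdot> m" by (elim ex1E conjE)
  show ?thesis
  proof
    assume qx: "q \<cdot> x = zmap W (Cod C q)"
    have "t \<cdot> (q \<cdot> x) = p \<cdot> (m \<cdot> x)"
      using t(1) q(1) p m x by (simp add: in_Hom comp_reduce[OF t(2)])
    then have "p \<cdot> (m \<cdot> x) = zmap W D" unfolding qx using t(1) W by (simp add: in_Hom)
    then show "in_rel_comm f (m \<cdot> x)" using p_zero[OF mx] by blast
  next
    assume "in_rel_comm f (m \<cdot> x)"
    then obtain s where s: "s \<in> Hom C W (Dom C n)" "n \<cdot> s = m \<cdot> x" using nf(4)[OF mx] by blast
    have "j \<cdot> s = x"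
      by (rule monoD[OF mm m, of _ W])
        (use s j m x in \<open>simp_all add: in_Hom comp_reduce[OF j0(2)]\<close>)
    moreover have qj: "q \<cdot> j \<in> Hom C (Dom C n) (Cod C q)" using q(1) j by (simp add: in_Hom)
    moreover have "is_zero_arrow C (q \<cdot> j)" using j0(3) unfolding is_cokernel_def by blast
    then have eq: "q \<cdot> j = zmap (Dom C n) (Cod C q)" using zero_arrow_iff[OF qj] by blast
    have "q \<cdot> (j \<cdot> s) = zmap W (Cod C q)"
      using q(1) j s(1) Hom_Obj[OF q(1)] by (simp add: in_Hom comp_reduce[OF eq])
    ultimately show "q \<cdot> x = zmap W (Cod C q)" by simp
  qed
qed

section \<open>Universal central extensions\<close>

lemma Hom_Centr:
  "t \<in> Hom (Centr C R A) u g \<longleftrightarrow>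
     (\<exists>h. t = (u, h, g) \<and> u \<in> Arr C \<and> Cod C u = A \<and> central_extension C R u \<and>
       g \<in> Arr C \<and> Cod C g = A \<and> central_extension C R g \<and> h \<in> Hom C (Dom C u) (Dom C g) \<and> g \<cdot> h = u)"
  unfolding Hom_def Centr_def full_subcategory_def slice_def by auto

lemma universal_central_extension_iff:
  "universal_central_extension C R A u \<longleftrightarrow>
     central_extension C R u \<and> Cod C u = A \<and>
     (\<forall>g. central_extension C R g \<longrightarrow> Cod C g = A \<longrightarrow>
       (\<exists>!h. h \<in> Hom C (Dom C u) (Dom C g) \<and> g \<cdot> h = u))"
proof -
  have obj: "g \<in> Obj (Centr C R A) \<longleftrightarrow> central_extension C R g \<and> Cod C g = A" for g
    unfolding Centr_def full_subcategory_def slice_def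
    using regular_epi_arr by (auto simp: central_extension_def)
  have ex: "(\<exists>!t. t \<in> Hom (Centr C R A) u g) \<longleftrightarrow> (\<exists>!h. h \<in> Hom C (Dom C u) (Dom C g) \<and> g \<cdot> h = u)"
    if "u \<in> Obj (Centr C R A)" "g \<in> Obj (Centr C R A)" for g
  proof -
    have "u \<in> Arr C" "g \<in> Arr C" using that regular_epi_arr unfolding obj central_extension_def by auto
    then have "t \<in> Hom (Centr C R A) u g \<longleftrightarrow>
        (\<exists>h. t = (u, h, g) \<and> h \<in> Hom C (Dom C u) (Dom C g) \<and> g \<cdot> h = u)" for t
      using that Hom_Centr unfolding obj by simp
    moreover have "(\<exists>!t. \<exists>h. t = (u, h, g) \<and> Q h) \<longleftrightarrow> (\<exists>!h. Q h)" for Q by (auto simp: Ex1_def)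
    ultimately show ?thesis by (simp only:)
  qed
  have "universal_central_extension C R A u \<longleftrightarrow> u \<in> Obj (Centr C R A) \<and> (\<forall>g \<in> Obj (Centr C R A).
      \<exists>!h. h \<in> Hom C (Dom C u) (Dom C g) \<and> g \<cdot> h = u)"
    unfolding universal_central_extension_def is_initial_def
    by (rule conj_cong[OF refl], rule ball_cong[OF refl], rule ex)
  then show ?thesis by (simp only: obj Ball_def imp_conjL conj_assoc)
qed

lemma perfect_in_comm:
  assumes A: "perfect C R A" and x: "x \<in> Hom C W A"
  shows "in_comm x"
proof (rule in_commI[OF x])
  have ob: "A \<in> Obj C" "W \<in> Obj C" using Hom_Obj[OF x] by auto
  have z: "Id C (Robj R A) = zmap (Robj R A) (Robj R A)"
    using A zero_object_iff unfolding perfect_def by blast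
  have "Unit R A \<cdot> x = Id C (Robj R A) \<cdot> (Unit R A \<cdot> x)" using x ob by (simp add: in_Hom)
  also have "\<dots> = zmap W (Robj R A)" unfolding z using x ob by (simp add: in_Hom)
  finally show "Unit R A \<cdot> x = zmap W (Robj R A)" .
qed

text \<open>If \<open>A\<close> has a universal central extension \<open>u\<close>, compare it with the projection of the product of
  \<open>A\<close> and its reflection, which is central because the second factor lies in the subcategory. The two
  morphisms with second components \<open>Unit R A \<cdot> u\<close> and \<open>0\<close> must coincide, so the unit is zero.\<close>

lemma universal_central_extension_perfect:
  assumes univ: "universal_central_extension C R A u" and A: "A \<in> Obj C"
  shows "perfect C R A"
proof -
  let ?F = "Robj R A"
  have F: "?F \<in> Obj C" using A by simp
  note u = univ[unfolded universal_central_extension_iff]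
  have re: "regular_epi C u" using u unfolding central_extension_def by blast
  define U where "U = Dom C u"
  have ut: "u \<in> Hom C U A" using u regular_epi_arr[OF re] by (simp add: U_def in_Hom)
  have U: "U \<in> Obj C" using Hom_Obj[OF ut] by blast
  obtain P a b where P: "a \<in> Hom C P A" "b \<in> Hom C P ?F"
    and pair: "\<And>W x y. \<lbrakk>x \<in> Hom C W A; y \<in> Hom C W ?F\<rbrakk> \<Longrightarrow> \<exists>t. t \<in> Hom C W P \<and> a \<cdot> t = x \<and> b \<cdot> t = y"
    and uniq: "\<And>W s t. \<lbrakk>s \<in> Hom C W P; t \<in> Hom C W P; a \<cdot> s = a \<cdot> t; b \<cdot> s = b \<cdot> t\<rbrakk> \<Longrightarrow> s = t"
    by (rule product_exists[OF A F]) blast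
  have "Id C A \<in> Hom C A A" "zmap A ?F \<in> Hom C A ?F" using A F by (simp_all add: in_Hom)
  then obtain s where s: "s \<in> Hom C A P" "a \<cdot> s = Id C A" using pair by blast
  have "identifies_comm a"
    unfolding identifies_comm_def
  proof (intro allI impI)
    fix V W x0 x1 z
    assume x: "x0 \<in> Hom C V (Dom C a)" "x1 \<in> Hom C V (Dom C a)" "a \<cdot> x0 = a \<cdot> x1"
      and z: "z \<in> Hom C W V" "in_comm z"
    have x': "x0 \<in> Hom C V P" "x1 \<in> Hom C V P" using x P(1) by (simp_all add: in_Hom)
    have bz: "b \<cdot> (x \<cdot> z) = zmap W ?F" if xx: "x \<in> Hom C V P" for x
    proof -
      have xz: "x \<cdot> z \<in> Hom C W P" and bxz: "b \<cdot> (x \<cdot> z) \<in> Hom C W ?F"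
        using xx z(1) P(2) by (simp_all add: in_Hom)
      have "in_comm (b \<cdot> (x \<cdot> z))"
        by (rule in_comm_postcomp[OF xz in_comm_postcomp[OF z xx] P(2)])
      then show ?thesis by (rule in_comm_subcategory[OF bxz _ Robj_B[OF A]])
    qed
    show "x0 \<cdot> z = x1 \<cdot> z"
    proof (rule uniq[of _ W])
      show "a \<cdot> (x0 \<cdot> z) = a \<cdot> (x1 \<cdot> z)"
        using x' z(1) P(1) by (simp add: in_Hom comp_reduce[OF x(3)])
      show "b \<cdot> (x0 \<cdot> z) = b \<cdot> (x1 \<cdot> z)" using bz x' by simp
    qed (use x' z(1) in \<open>simp_all add: in_Hom\<close>)
  qed
  then have cen: "central_extension C R a"
    by (rule identifies_comm_central[OF split_epi_regular[OF P(1) s] P(1)])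
  have "Cod C a = A" "Dom C a = P" using P(1) by (simp_all add: in_Hom)
  then have ex1: "\<exists>!h. h \<in> Hom C U P \<and> a \<cdot> h = u" using u cen unfolding U_def by metis
  have uu: "Unit R A \<cdot> u \<in> Hom C U ?F" "zmap U ?F \<in> Hom C U ?F"
    using ut A U by (simp_all add: in_Hom)
  obtain t0 where t0: "t0 \<in> Hom C U P" "a \<cdot> t0 = u" "b \<cdot> t0 = Unit R A \<cdot> u"
    using pair[OF ut uu(1)] by blast
  obtain t1 where t1: "t1 \<in> Hom C U P" "a \<cdot> t1 = u" "b \<cdot> t1 = zmap U ?F"
    using pair[OF ut uu(2)] by blast
  have "t0 = t1" using ex1 t0(1,2) t1(1,2) by metis
  then have uz: "Unit R A \<cdot> u = zmap U ?F" using t0(3) t1(3) by simp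
  have unit_zero: "Unit R A = zmap A ?F"
    by (rule regular_epi_epi[OF re ut, of _ ?F]) (use uz ut A F in \<open>simp_all add: in_Hom\<close>)
  have "Id C ?F = zmap ?F ?F"
  proof (rule regular_epi_epi[OF unit_regular_epi[OF A] Unit_Hom[OF A], of _ ?F])
    have "Id C ?F \<cdot> Unit R A = zmap A ?F" unfolding unit_zero using A F by simp
    moreover have "zmap ?F ?F \<cdot> Unit R A = zmap A ?F" using A F by simp
    ultimately show "Id C ?F \<cdot> Unit R A = zmap ?F ?F \<cdot> Unit R A" by simp
  qed (use F in \<open>simp_all add: in_Hom\<close>)
  then show ?thesis unfolding perfect_def using zero_object_iff A F by blast
qed

text \<open>The arrow from \<open>[X, X] / [K, X]\<close> to \<open>A\<close> induced by a projective presentation \<open>f: X \<rightarrow> A\<close> of a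
  perfect object. It is a subobject over \<open>A\<close> of the centralization \<open>d: D \<rightarrow> A\<close> of \<open>f\<close>, and it is
  onto because \<open>f\<close> maps \<open>[X, X]\<close> onto \<open>[A, A] = A\<close>. Hence it is central, and a lift of \<open>f\<close> to a
  central extension, which exists by projectivity and vanishes on \<open>[K, X]\<close>, induces a morphism
  from it. Two such morphisms agree on commutators, so uniqueness amounts to the domain \<open>U\<close> being
  its own commutator. As a subobject of \<open>D\<close>, it is \<open>[D, D]\<close>. Given \<open>y\<close> in \<open>U\<close>, lift the element
  \<open>y\<close> of \<open>[D, D]\<close> to an element \<open>(y, y')\<close> of the commutator of the pullback of \<open>D\<close> and \<open>U\<close> over
  \<open>A\<close>; then \<open>y'\<close> lies in \<open>[U, U]\<close>, and \<open>y = y'\<close> because \<open>d\<close> identifies commutators.\<close>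

theorem universal_central_extension_of_presentation:
  assumes perf: "perfect C R A" and f: "projective_presentation C A f" and q: "is_U C R f q"
    and u: "u \<in> Hom C (Cod C q) A" "u \<cdot> q = f \<cdot> comm_incl C R (Dom C f)"
  shows "universal_central_extension C R A u" "regular_epi C u"
proof -
  define X U where "X = Dom C f" and "U = Cod C q"
  have fr: "regular_epi C f" and proj: "is_projective C X" and "Cod C f = A"
    using f unfolding projective_presentation_def X_def by auto
  then have ft: "f \<in> Hom C X A" using regular_epi_arr by (simp add: in_Hom X_def)
  have ob: "X \<in> Obj C" "A \<in> Obj C" using Hom_Obj[OF ft] by auto
  define m E where "m = comm_incl C R X" and "E = comm_obj C R X"
  note m = comm_incl_typing[OF ob(1), folded m_def E_def]
  have u: "u \<in> Hom C U A" "u \<cdot> q = f \<cdot> m" using u by (simp_all add: U_def X_def m_def)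
  obtain n where n: "relative_commutator C R f n" and sq: "subobject_quotient C m n q"
    using q unfolding is_U_def X_def m_def by blast
  have q: "q \<in> Hom C E U" "regular_epi C q"
    using subobject_quotient_typing[OF sq m(1)] by (simp_all add: U_def)
  have q_zero: "q \<cdot> x = zmap W U \<longleftrightarrow> in_rel_comm f (m \<cdot> x)" if "x \<in> Hom C W E" for x W
    using subobject_quotient_zero[OF ft n sq m(1) that] by (simp add: U_def)
  obtain D p d where p: "regular_epi C p" "p \<in> Hom C X D" and d: "d \<in> Hom C D A" "d \<cdot> p = f"
    and p_zero: "\<And>W x. x \<in> Hom C W X \<Longrightarrow> p \<cdot> x = zmap W D \<longleftrightarrow> in_rel_comm f x"
    and dc: "identifies_comm d"
    by (rule centralization[OF fr ft]) blast
  have obs: "D \<in> Obj C" "U \<in> Obj C" "E \<in> Obj C" using Hom_Obj p q by auto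
  have pm: "p \<cdot> m \<in> Hom C E D" using p m by (simp add: in_Hom)
  obtain i where i: "i \<in> Hom C U D" "i \<cdot> q = p \<cdot> m"
  proof (rule regular_epi_factor[OF q(2,1) pm])
    fix W z assume z: "z \<in> Hom C W E" "q \<cdot> z = zmap W U"
    have "m \<cdot> z \<in> Hom C W X" using m(1) z(1) by (simp add: in_Hom)
    then have "p \<cdot> (m \<cdot> z) = zmap W D" using p_zero q_zero z by blast
    then show "(p \<cdot> m) \<cdot> z = zmap W D" using p(2) m(1) z(1) by (simp add: in_Hom)
  qed blast
  have i_mono: "is_mono C i"
  proof (rule zero_kernel_mono[OF i(1)])
    fix W y assume y: "y \<in> Hom C W U" "i \<cdot> y = zmap W D"
    obtain V c b where c: "c \<in> Hom C V W" "regular_epi C c" "b \<in> Hom C V E" "q \<cdot> b = y \<cdot> c"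
      using cover_lift[OF q(2,1) y(1)] .
    have W: "W \<in> Obj C" "V \<in> Obj C" using Hom_Obj[OF c(1)] by auto
    have mb: "m \<cdot> b \<in> Hom C V X" using m(1) c(3) by (simp add: in_Hom)
    have "p \<cdot> (m \<cdot> b) = i \<cdot> (q \<cdot> b)"
      using i(1) q(1) p(2) m(1) c(3) by (simp add: in_Hom comp_reduce[OF i(2)])
    also have "\<dots> = zmap V D"
      unfolding c(4) using i(1) y(1) c(1) obs by (simp add: in_Hom comp_reduce[OF y(2)])
    finally have "p \<cdot> (m \<cdot> b) = zmap V D" .
    then have "q \<cdot> b = zmap V U" using p_zero[OF mb] q_zero[OF c(3)] by blast
    then have eq: "y \<cdot> c = zmap V U" unfolding c(4) .
    show "y = zmap W U"
      by (rule regular_epi_epi[OF c(2,1), of _ U]) (use eq y(1) c(1) W obs in \<open>simp_all add: in_Hom\<close>)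
  qed
  have di: "d \<cdot> i = u"
    by (rule regular_epi_epi[OF q(2,1), of _ A])
      (use d(1) i u q(1) p(2) m(1) in \<open>simp_all add: in_Hom comp_reduce[OF d(2)]\<close>)
  \<comment> \<open>The restriction of \<open>f\<close> to the commutator is still onto.\<close>
  show ur: "regular_epi C u"
  proof -
    have idA: "Id C A \<in> Hom C A A" using ob by (simp add: in_Hom)
    obtain V c x where c: "c \<in> Hom C V A" "regular_epi C c" "x \<in> Hom C V X" "in_comm x"
      "f \<cdot> x = Id C A \<cdot> c"
      by (rule in_comm_lift[OF fr ft idA perfect_in_comm[OF perf idA]])
    obtain t where t: "t \<in> Hom C V E" "m \<cdot> t = x"
      using in_comm_factor[OF c(3,4)] unfolding m_def E_def .
    have "u \<cdot> (q \<cdot> t) = f \<cdot> (m \<cdot> t)"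
      using u(1) q(1) t(1) ft m(1) by (simp add: in_Hom comp_reduce[OF u(2)])
    also have "\<dots> = c" unfolding t(2) c(5) using c(1) by (simp add: in_Hom)
    finally have "u \<cdot> (q \<cdot> t) = c" .
    moreover have "q \<cdot> t \<in> Hom C V U" using q(1) t(1) by (simp add: in_Hom)
    ultimately show ?thesis using regular_epi_cancel[OF _ _ u(1)] c(2) by blast
  qed
  have uc: "identifies_comm u"
    unfolding identifies_comm_def
  proof (intro allI impI)
    fix V W x0 x1 z
    assume x: "x0 \<in> Hom C V (Dom C u)" "x1 \<in> Hom C V (Dom C u)" "u \<cdot> x0 = u \<cdot> x1"
      and z: "z \<in> Hom C W V" "in_comm z"
    have x': "x0 \<in> Hom C V U" "x1 \<in> Hom C V U" using x u(1) by (simp_all add: in_Hom)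
    have ix: "i \<cdot> x0 \<in> Hom C V D" "i \<cdot> x1 \<in> Hom C V D" using i(1) x' by (simp_all add: in_Hom)
    have "d \<cdot> (i \<cdot> x0) = u \<cdot> x0" "d \<cdot> (i \<cdot> x1) = u \<cdot> x1"
      using d(1) i(1) x' by (simp_all add: in_Hom comp_reduce[OF di])
    then have "d \<cdot> (i \<cdot> x0) = d \<cdot> (i \<cdot> x1)" using x(3) by simp
    then have "(i \<cdot> x0) \<cdot> z = (i \<cdot> x1) \<cdot> z" by (rule identifies_commD[OF dc d(1) ix _ z])
    then have eq: "i \<cdot> (x0 \<cdot> z) = i \<cdot> (x1 \<cdot> z)" using i(1) x' z(1) by (simp add: in_Hom)
    show "x0 \<cdot> z = x1 \<cdot> z"
      by (rule monoD[OF i_mono i(1) _ _ eq, of W]) (use x' z(1) in \<open>simp_all add: in_Hom\<close>)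
  qed
  have U_perfect: "in_comm y" if y: "y \<in> Hom C W U" for y W
  proof -
    obtain V c b where c: "c \<in> Hom C V W" "regular_epi C c" "b \<in> Hom C V E" "q \<cdot> b = y \<cdot> c"
      using cover_lift[OF q(2,1) y] .
    define x where "x = i \<cdot> (y \<cdot> c)"
    have yc: "y \<cdot> c \<in> Hom C V U" using y c by (simp add: in_Hom)
    have x: "x \<in> Hom C V D" unfolding x_def using i(1) yc by (simp add: in_Hom)
    have mb: "m \<cdot> b \<in> Hom C V X" using m(1) c(3) by (simp add: in_Hom)
    have "i \<cdot> (q \<cdot> b) = p \<cdot> (m \<cdot> b)"
      using i(1) q(1) p(2) m(1) c(3) by (simp add: in_Hom comp_reduce[OF i(2)])
    then have "x = p \<cdot> (m \<cdot> b)" unfolding x_def c(4) .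
    then have xc: "in_comm x"
      using in_comm_postcomp[OF mb in_comm_precomp[OF m(1,3) c(3)] p(2)] by simp
    obtain T b' a where pb: "is_pullback C u d b' a" "b' \<in> Hom C T U" "a \<in> Hom C T D"
      "u \<cdot> b' = d \<cdot> a"
      using pullback_exists[OF u(1) d(1)] by metis
    have a: "regular_epi C a" by (rule regular_epi_pullback_stable[OF pb(1) ur])
    obtain V2 c2 w where c2: "c2 \<in> Hom C V2 V" "regular_epi C c2" "w \<in> Hom C V2 T" "in_comm w"
      "a \<cdot> w = x \<cdot> c2"
      by (rule in_comm_lift[OF a pb(3) x xc])
    have ib: "i \<cdot> b' \<in> Hom C T D" using i(1) pb(2) by (simp add: in_Hom)
    have "d \<cdot> a = d \<cdot> (i \<cdot> b')"
      unfolding pb(4)[symmetric] using d(1) i(1) pb(2) by (simp add: in_Hom comp_reduce[OF di])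
    then have "a \<cdot> w = (i \<cdot> b') \<cdot> w" by (rule identifies_commD[OF dc d(1) pb(3) ib _ c2(3,4)])
    then have "i \<cdot> ((y \<cdot> c) \<cdot> c2) = i \<cdot> (b' \<cdot> w)"
      unfolding c2(5) x_def using i(1) y c(1) c2(1,3) pb(2) by (simp add: in_Hom)
    then have "(y \<cdot> c) \<cdot> c2 = b' \<cdot> w"
      by (rule monoD[OF i_mono i(1), rotated 2]) (use yc c2(1,3) pb(2) in \<open>simp_all add: in_Hom\<close>)
    then have "in_comm ((y \<cdot> c) \<cdot> c2)" using in_comm_postcomp[OF c2(3,4) pb(2)] by simp
    then have "in_comm (y \<cdot> c)" by (rule in_comm_descend[OF yc c2(1,2)])
    then show ?thesis by (rule in_comm_descend[OF y c(1,2)])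
  qed
  show "universal_central_extension C R A u"
    unfolding universal_central_extension_iff
  proof (intro conjI allI impI)
    show "central_extension C R u" by (rule identifies_comm_central[OF ur u(1) uc])
    have DU: "Dom C u = U" using u(1) by (simp add: in_Hom)
    show "Cod C u = A" using u(1) by (simp add: in_Hom)
    fix g assume gc: "central_extension C R g" and cod: "Cod C g = A"
    define Z where "Z = Dom C g"
    have g: "g \<in> Hom C Z A"
      using gc regular_epi_arr cod unfolding central_extension_def by (simp add: in_Hom Z_def)
    have gi: "identifies_comm g" by (rule central_identifies_comm[OF gc])
    have "regular_epi C g" using gc unfolding central_extension_def by blast
    moreover have "f \<in> Hom C X (Cod C g)" using ft unfolding cod .
    ultimately obtain h where h: "h \<in> Hom C X Z" "g \<cdot> h = f"
      using proj unfolding is_projective_def Z_def by blast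
    have hm: "h \<cdot> m \<in> Hom C E Z" using h(1) m(1) by (simp add: in_Hom)
    obtain v where v: "v \<in> Hom C U Z" "v \<cdot> q = h \<cdot> m"
    proof (rule regular_epi_factor[OF q(2,1) hm])
      fix W z assume z: "z \<in> Hom C W E" "q \<cdot> z = zmap W U"
      have mz: "m \<cdot> z \<in> Hom C W X" using m(1) z(1) by (simp add: in_Hom)
      have "in_rel_comm f (m \<cdot> z)" using q_zero z by blast
      then have "h \<cdot> (m \<cdot> z) = zmap W Z" by (rule in_rel_comm_vanishes[OF _ ft mz gi g h])
      then show "(h \<cdot> m) \<cdot> z = zmap W Z" using h(1) m(1) z(1) by (simp add: in_Hom)
    qed blast
    have gv: "g \<cdot> v = u"
      by (rule regular_epi_epi[OF q(2,1), of _ A])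
        (use g v u q(1) h(1) m(1) in \<open>simp_all add: in_Hom comp_reduce[OF h(2)]\<close>)
    show "\<exists>!h. h \<in> Hom C (Dom C u) (Dom C g) \<and> g \<cdot> h = u"
    proof (rule ex1I[of _ v], unfold DU Z_def[symmetric])
      show "v \<in> Hom C U Z \<and> g \<cdot> v = u" using v(1) gv by blast
      fix v' assume v': "v' \<in> Hom C U Z \<and> g \<cdot> v' = u"
      have idU: "Id C U \<in> Hom C U U" using obs by (simp add: in_Hom)
      have "g \<cdot> v' = g \<cdot> v" using v' gv by simp
      then have "v' \<cdot> Id C U = v \<cdot> Id C U"
        using identifies_commD[OF gi g _ v(1) _ idU U_perfect[OF idU], of v'] v' by blast
      then show "v' = v" using v' v(1) by (simp add: in_Hom)
    qed
  qed
qed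

section \<open>The second homology object\<close>

lemma is_U_exists:
  assumes f: "regular_epi C f" "f \<in> Hom C X Y"
  obtains q where "is_U C R f q"
proof -
  have X: "X \<in> Obj C" and D: "Dom C f = X" using f Hom_Obj[OF f(2)] by (auto simp: in_Hom)
  obtain n where n: "relative_commutator C R f n" using relative_commutator_exists[OF f(2)] .
  obtain j where j: "j \<in> Hom C (Dom C n) (comm_obj C R X)" "comm_incl C R X \<cdot> j = n"
    using relative_commutator_factor(3)[OF n f(2)] by blast
  obtain q where "subobject_quotient C (comm_incl C R X) n q"
    by (rule subobject_quotient_exists[OF f n comm_incl_typing(2,1)[OF X] j])
  then show ?thesis using that n D unfolding is_U_def by blast
qed

lemma kernel_commutator_meet:
  assumes f: "f \<in> Hom C X Y" and k: "is_kernel C k f" and w: "is_meet C k (comm_incl C R X) w"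
  shows "w \<in> Hom C (Dom C w) X" "is_mono C w"
    "\<exists>i. i \<in> Hom C (Dom C w) (comm_obj C R X) \<and> comm_incl C R X \<cdot> i = w"
    "f \<cdot> w = zmap (Dom C w) Y"
    "\<lbrakk>x \<in> Hom C W X; f \<cdot> x = zmap W Y; in_comm x\<rbrakk> \<Longrightarrow> \<exists>t. t \<in> Hom C W (Dom C w) \<and> w \<cdot> t = x"
proof -
  have ob: "X \<in> Obj C" "Y \<in> Obj C" using Hom_Obj[OF f] by auto
  define K where "K = Dom C k"
  have kt: "k \<in> Hom C K X" "f \<cdot> k = zmap K Y" "is_mono C k"
    using kernel_typing[OF k f] kernel_mono[OF k f] by (simp_all add: K_def)
  note m = comm_incl_typing[OF ob(1)]
  obtain a b where pb: "is_pullback C k (comm_incl C R X) a b" and w_eq: "w = k \<cdot> a"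
    using w unfolding is_meet_def by blast
  define M where "M = Dom C a"
  have ab: "a \<in> Hom C M K" "b \<in> Hom C M (comm_obj C R X)" "k \<cdot> a = comm_incl C R X \<cdot> b"
    using pullback_typing[OF pb kt(1) m(1)] by (simp_all add: M_def)
  have wt: "w \<in> Hom C M X" unfolding w_eq using kt(1) ab(1) by (simp add: in_Hom)
  then have Dw: "Dom C w = M" by (simp add: in_Hom)
  show "w \<in> Hom C (Dom C w) X" unfolding Dw by (rule wt)
  show "is_mono C w"
    unfolding w_eq ab(3) by (rule mono_comp[OF pullback_mono[OF pb kt(3,1) m(1)] m(2) ab(2) m(1)])
  show "\<exists>i. i \<in> Hom C (Dom C w) (comm_obj C R X) \<and> comm_incl C R X \<cdot> i = w"
    unfolding Dw using ab(2) ab(3)[symmetric] unfolding w_eq by blast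
  show "f \<cdot> w = zmap (Dom C w) Y"
    unfolding Dw w_eq using f kt(1) ab(1) ob by (simp add: in_Hom comp_reduce[OF kt(2)])
  assume x: "x \<in> Hom C W X" "f \<cdot> x = zmap W Y" "in_comm x"
  obtain s where s: "s \<in> Hom C W K" "k \<cdot> s = x" using kernel_lift[OF k f x(1,2)] K_def by blast
  obtain r where r: "r \<in> Hom C W (comm_obj C R X)" "comm_incl C R X \<cdot> r = x"
    using in_comm_factor[OF x(1,3)] .
  obtain t where t: "t \<in> Hom C W M" "a \<cdot> t = s"
    using pullback_lift[OF pb kt(1) m(1) s(1) r(1)] s(2) r(2) M_def by metis
  have "w \<cdot> t = x" unfolding w_eq using kt(1) ab(1) t s(2) by (simp add: in_Hom)
  then show "\<exists>t. t \<in> Hom C W (Dom C w) \<and> w \<cdot> t = x" using t(1) Dw by blast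
qed

lemma is_H2_exists:
  assumes f: "regular_epi C f" "f \<in> Hom C X Y"
  obtains w p where "is_H2 C R f w p"
proof -
  have X: "X \<in> Obj C" and D: "Dom C f = X" using f Hom_Obj[OF f(2)] by (auto simp: in_Hom)
  note m = comm_incl_typing[OF X]
  obtain K k where k: "is_kernel C k f" "k \<in> Hom C K X" using kernel_exists[OF f(2)] by metis
  obtain a b where pb: "is_pullback C k (comm_incl C R X) a b"
    using pullback_exists[OF k(2) m(1)] by metis
  define w where "w = k \<cdot> a"
  have meet: "is_meet C k (comm_incl C R X) w"
    unfolding is_meet_def using kernel_mono[OF k(1) f(2)] m(2) pb w_def by blast
  note w = kernel_commutator_meet[OF f(2) k(1) meet]
  obtain n where n: "relative_commutator C R f n" using relative_commutator_exists[OF f(2)] .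
  note nf = relative_commutator_factor[OF n f(2)]
  have "in_rel_comm f n" by (rule relative_commutator_self[OF n f(2)])
  then have fn: "f \<cdot> n = zmap (Dom C n) Y" by (rule in_rel_comm_kernel[OF _ f(2) nf(1)])
  have "in_comm n" using nf(3) in_comm_precomp[OF m(1,3)] by blast
  then obtain j where j: "j \<in> Hom C (Dom C n) (Dom C w)" "w \<cdot> j = n" using w(5)[OF nf(1) fn] by blast
  obtain p where "subobject_quotient C w n p"
    by (rule subobject_quotient_exists[OF f n w(2,1) j])
  then show ?thesis using that k(1) meet n D unfolding is_H2_def by blast
qed

text \<open>Exactness: an element of \<open>U\<close> over zero lifts locally to an element of \<open>[X, X]\<close> in the kernel
  of \<open>f\<close>, so it comes from \<open>K \<and> [X, X]\<close>; and \<open>h\<close> is monic because both quotients are taken by the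
  same subobject \<open>[K, X]\<close>.\<close>

lemma H2_U_exact:
  assumes f: "f \<in> Hom C X A" and H2: "is_H2 C R f w p" and U: "is_U C R f q"
  obtains h u where "u \<in> Hom C (Cod C q) A" "u \<cdot> q = f \<cdot> comm_incl C R (Dom C f)"
    "induced_arrows C R f w p q h u" "is_kernel C h u"
proof -
  have ob: "X \<in> Obj C" "A \<in> Obj C" and D: "Dom C f = X" using f Hom_Obj[OF f] by (auto simp: in_Hom)
  define m E where "m = comm_incl C R X" and "E = comm_obj C R X"
  note m = comm_incl_typing[OF ob(1), folded m_def E_def]
  obtain k n where k: "is_kernel C k f" and meet: "is_meet C k m w"
    and n: "relative_commutator C R f n" and sp: "subobject_quotient C w n p"
    using H2 unfolding is_H2_def D m_def by blast
  obtain n' where n': "relative_commutator C R f n'" and sq: "subobject_quotient C m n' q"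
    using U unfolding is_U_def D m_def by blast
  define M P Q where "M = Dom C w" and "P = Cod C p" and "Q = Cod C q"
  note w = kernel_commutator_meet[OF f k meet[unfolded m_def], folded m_def E_def M_def]
  note p = subobject_quotient_typing[OF sp w(1), folded P_def]
  note q = subobject_quotient_typing[OF sq m(1), folded Q_def]
  note p_zero = subobject_quotient_zero[OF f n sp w(1), folded P_def]
  note q_zero = subobject_quotient_zero[OF f n' sq m(1), folded Q_def]
  obtain i where i: "i \<in> Hom C M E" "m \<cdot> i = w" using w(3) by blast
  have obs: "P \<in> Obj C" "Q \<in> Obj C" "M \<in> Obj C" "E \<in> Obj C" using Hom_Obj p q by auto
  have mi: "m \<cdot> (i \<cdot> x) = w \<cdot> x" if "x \<in> Hom C W M" for x W
    using that m(1) i(1) by (simp add: in_Hom comp_reduce[OF i(2)])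
  have fm: "f \<cdot> m \<in> Hom C E A" and qi: "q \<cdot> i \<in> Hom C M Q"
    using f m(1) q(1) i(1) by (simp_all add: in_Hom)
  obtain u where u: "u \<in> Hom C Q A" "u \<cdot> q = f \<cdot> m"
  proof (rule regular_epi_factor[OF q(2,1) fm])
    fix W z assume z: "z \<in> Hom C W E" "q \<cdot> z = zmap W Q"
    have mz: "m \<cdot> z \<in> Hom C W X" using m(1) z(1) by (simp add: in_Hom)
    have "in_rel_comm f (m \<cdot> z)" using q_zero z by blast
    then have "f \<cdot> (m \<cdot> z) = zmap W A" by (rule in_rel_comm_kernel[OF _ f mz])
    then show "(f \<cdot> m) \<cdot> z = zmap W A" using f m(1) z(1) by (simp add: in_Hom)
  qed blast
  obtain h where h: "h \<in> Hom C P Q" "h \<cdot> p = q \<cdot> i"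
  proof (rule regular_epi_factor[OF p(2,1) qi])
    fix W z assume z: "z \<in> Hom C W M" "p \<cdot> z = zmap W P"
    have iz: "i \<cdot> z \<in> Hom C W E" using i(1) z(1) by (simp add: in_Hom)
    have "in_rel_comm f (m \<cdot> (i \<cdot> z))" using p_zero z mi[OF z(1)] by simp
    then have "q \<cdot> (i \<cdot> z) = zmap W Q" using q_zero[OF iz] by blast
    then show "(q \<cdot> i) \<cdot> z = zmap W Q" using q(1) i(1) z(1) by (simp add: in_Hom)
  qed blast
  have hp: "h \<cdot> (p \<cdot> x) = q \<cdot> (i \<cdot> x)" if "x \<in> Hom C W M" for x W
    using that h(1) p(1) q(1) i(1) by (simp add: in_Hom comp_reduce[OF h(2)])
  have "induced_arrows C R f w p q h u"
    unfolding induced_arrows_def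
  proof (intro conjI bexI[of _ i])
    show "h \<in> Hom C (Cod C p) (Cod C q)" "u \<in> Hom C (Cod C q) (Cod C f)"
      using h(1) u(1) f by (simp_all add: P_def Q_def in_Hom)
    show "u \<cdot> q = f \<cdot> comm_incl C R (Dom C f)" using u(2) unfolding D m_def .
    show "comm_incl C R (Dom C f) \<cdot> i = w" using i(2) unfolding D m_def .
    show "i \<in> Hom C (Dom C w) (comm_obj C R (Dom C f))" using i(1) unfolding D M_def E_def .
    show "h \<cdot> p = q \<cdot> i" by (rule h(2))
  qed
  moreover have "is_kernel C h u"
  proof (rule kernelI[OF h(1) u(1)])
    show hm: "is_mono C h"
    proof (rule zero_kernel_mono[OF h(1)])
      fix W y assume y: "y \<in> Hom C W P" "h \<cdot> y = zmap W Q"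
      obtain V c x where c: "c \<in> Hom C V W" "regular_epi C c" "x \<in> Hom C V M" "p \<cdot> x = y \<cdot> c"
        using cover_lift[OF p(2,1) y(1)] .
      have W: "W \<in> Obj C" "V \<in> Obj C" using Hom_Obj[OF c(1)] by auto
      have ix: "i \<cdot> x \<in> Hom C V E" using i(1) c(3) by (simp add: in_Hom)
      have "q \<cdot> (i \<cdot> x) = h \<cdot> (y \<cdot> c)" using hp[OF c(3)] unfolding c(4) by simp
      also have "\<dots> = zmap V Q"
        using h(1) y(1) c(1) obs by (simp add: in_Hom comp_reduce[OF y(2)])
      finally have "in_rel_comm f (m \<cdot> (i \<cdot> x))" using q_zero[OF ix] by blast
      then have "p \<cdot> x = zmap V P" using p_zero[OF c(3)] mi[OF c(3)] by simp
      then have eq: "y \<cdot> c = zmap V P" unfolding c(4) .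
      show "y = zmap W P"
        by (rule regular_epi_epi[OF c(2,1), of _ P]) (use eq y(1) c(1) W obs in \<open>simp_all add: in_Hom\<close>)
    qed
    have uqx: "u \<cdot> (q \<cdot> x) = f \<cdot> (m \<cdot> x)" if "x \<in> Hom C W E" for x W
      using that u(1) q(1) f m(1) by (simp add: in_Hom comp_reduce[OF u(2)])
    show "u \<cdot> h = zmap P A"
    proof (rule regular_epi_epi[OF p(2,1), of _ A])
      have "u \<cdot> (h \<cdot> p) = f \<cdot> w" unfolding h(2) using uqx[OF i(1)] i(2) by simp
      then have "u \<cdot> (h \<cdot> p) = zmap M A" using w(4) by simp
      then show "(u \<cdot> h) \<cdot> p = zmap P A \<cdot> p" using u(1) h(1) p(1) ob by (simp add: in_Hom)
    qed (use u(1) h(1) obs ob in \<open>simp_all add: in_Hom\<close>)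
    fix W y assume y: "y \<in> Hom C W Q" "u \<cdot> y = zmap W A"
    obtain V c b where c: "c \<in> Hom C V W" "regular_epi C c" "b \<in> Hom C V E" "q \<cdot> b = y \<cdot> c"
      using cover_lift[OF q(2,1) y(1)] .
    have mb: "m \<cdot> b \<in> Hom C V X" using m(1) c(3) by (simp add: in_Hom)
    have "f \<cdot> (m \<cdot> b) = u \<cdot> (y \<cdot> c)" using uqx[OF c(3)] unfolding c(4) by simp
    also have "\<dots> = zmap V A" using u(1) y(1) c(1) ob by (simp add: in_Hom comp_reduce[OF y(2)])
    finally obtain x where x: "x \<in> Hom C V M" "w \<cdot> x = m \<cdot> b"
      using w(5)[OF mb _ in_comm_precomp[OF m(1,3) c(3)]] by blast
    have ix: "i \<cdot> x = b"
      by (rule monoD[OF m(2,1), of _ V]) (use x i c(3) mi[OF x(1)] in \<open>simp_all add: in_Hom\<close>)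
    have "h \<cdot> (p \<cdot> x) = y \<cdot> c" using hp[OF x(1)] unfolding ix c(4) .
    moreover have "p \<cdot> x \<in> Hom C V P" using p(1) x(1) by (simp add: in_Hom)
    ultimately obtain t where "t \<in> Hom C W P" "h \<cdot> t = y"
      using mono_factor_descend[OF c(2,1) hm h(1) y(1)] by blast
    then show "\<exists>t. t \<in> Hom C W P \<and> h \<cdot> t = y" by blast
  qed
  ultimately show ?thesis using that u unfolding Q_def D m_def by blast
qed

end

theorem theorem2p15:
  fixes C :: "('o, 'm) cat" and B :: "'o set" and R :: "('o, 'm) reflector" and A :: 'o
  assumes "semi_abelian C"
    and "enough_projectives C"
    and "birkhoff_subcategory C B R"
    and "A \<in> Obj C"
  shows "(perfect C R A \<longleftrightarrow> (\<exists>u. universal_central_extension C R A u)) \<and>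
    (perfect C R A \<longrightarrow>
      (\<forall>f. projective_presentation C A f \<longrightarrow>
        (\<exists>w p. is_H2 C R f w p) \<and> (\<exists>q. is_U C R f q) \<and>
        (\<forall>w p q. is_H2 C R f w p \<and> is_U C R f q \<longrightarrow>
          (\<exists>h u. universal_central_extension C R A u \<and>
             induced_arrows C R f w p q h u \<and> short_exact C h u))))"
proof -
  interpret semi_abelian_birkhoff C B R
    using assms(1,3) by (simp add: semi_abelian_birkhoff_def)
  have typing: "regular_epi C f \<and> f \<in> Hom C (Dom C f) A" if "projective_presentation C A f" for f
    using that regular_epi_arr unfolding projective_presentation_def by (auto simp: in_Hom)
  have extension: "\<exists>h u. universal_central_extension C R A u \<and>
      induced_arrows C R f w p q h u \<and> short_exact C h u"
    if perf: "perfect C R A" and f: "projective_presentation C A f"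
      and H2: "is_H2 C R f w p" and U: "is_U C R f q" for f w p q
  proof -
    obtain h u where u: "u \<in> Hom C (Cod C q) A" "u \<cdot>\<^bsub>C\<^esub> q = f \<cdot>\<^bsub>C\<^esub> comm_incl C R (Dom C f)"
      and ind: "induced_arrows C R f w p q h u" and ker: "is_kernel C h u"
      using H2_U_exact[OF _ H2 U] typing[OF f] by blast
    note univ = universal_central_extension_of_presentation[OF perf f U u]
    have "short_exact C h u"
      unfolding short_exact_def using ker kernel_cokernel[OF univ(2) u(1) ker] by blast
    then show ?thesis using univ(1) ind by blast
  qed
  have exists: "(\<exists>w p. is_H2 C R f w p) \<and> (\<exists>q. is_U C R f q)"
    if "projective_presentation C A f" for f
    using is_H2_exists is_U_exists typing[OF that] by metis
  have "\<exists>u. universal_central_extension C R A u" if perf: "perfect C R A"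
  proof -
    obtain f where f: "projective_presentation C A f"
      using assms(2,4) unfolding enough_projectives_def by blast
    then obtain w p q where "is_H2 C R f w p" "is_U C R f q" using exists by blast
    then show ?thesis using extension[OF perf f] by blast
  qed
  then show ?thesis
    using universal_central_extension_perfect assms(4) exists extension by blast
qed

end
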